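(* Let $N\ge 2$, $s\in(0,1)$ and $\tau\in(0,1)$, and assume that any second eigenfunction of the annulus $B_1(0)\setminus\overline{B_\tau(0)}\subset\mathbb{R}^N$ cannot be radial (i.e. no second eigenfunction of this annulus is radial). Then $$\lambda_{2,s}\big(B_1(0)\setminus\overline{B_\tau(a)}\big)\leq \lambda_{2,s}\big(B_1(0)\setminus\overline{B_\tau(0)}\big)\quad\text{for all } a\in B_{1-\tau}(0),$$ and equality holds if and only if $a=0$.
   Context: $B_r(a)$ is the open ball in $\mathbb{R}^N$ of radius $r$ centered at $a$. For $s\in(0,1)$, $b_{N,s}=\frac{s4^s\Gamma(\frac N2+s)}{\pi^{N/2}\Gamma(1-s)}$, and $\mathcal{E}_s(\phi,\psi)=\frac{b_{N,s}}{2}\int_{\mathbb{R}^{2N}}\frac{(\phi(x)-\phi(y))(\psi(x)-\psi(y))}{|x-y|^{N+2s}}\,dx\,dy$ is the bilinear form of the fractional Laplacian $(-\Delta)^s$. For a bounded open set $\Omega\subset\mathbb{R}^N$, $\mathcal{H}^s_0(\Omega)$ is the completion of $C_c^\infty(\Omega)$ with respect to the norm $\mathcal{E}_s(\psi,\psi)^{1/2}$ (functions extended by $0$ outside $\Omega$). A function $\phi\in\mathcal{H}^s_0(\Omega)$ is a weak solution of $(-\Delta)^s\phi=\mu\phi$ in $\Omega$, $\phi=0$ in $\mathbb{R}^N\setminus\Omega$, if $\mathcal{E}_s(\phi,\psi)=\mu\int_\Omega\phi\psi\,dx$ for all $\psi\in\mathcal{H}^s_0(\Omega)$. The eigenvalues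 (those $\mu$ with a nontrivial weak solution), counted with multiplicity, are $0<\lambda_{1,s}(\Omega)<\lambda_{2,s}(\Omega)\le\lambda_{3,s}(\Omega)\le\dots\nearrow+\infty$. A second eigenfunction of $\Omega$ is a nontrivial weak solution with $\mu=\lambda_{2,s}(\Omega)$. A function is radial if it depends only on $|x|$ (a.e.). *)

theory Defs
  imports "HOL-Analysis.Analysis" "HOL-Library.Extended_Nat"
begin

text \<open>
  Elements of the function spaces are almost-everywhere classes of measurable functions.
  They are represented by Borel functions; every Lebesgue measurable function agrees almost
  everywhere with one. Hence ``nontrivial'', ``radial'' and ``linearly independent'' are read
  modulo almost-everywhere equality.
\<close>

primrec times_cont_diff ::
  "nat \<Rightarrow> ('a::euclidean_space \<Rightarrow> real) \<Rightarrow> bool" where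
  "times_cont_diff 0 f \<longleftrightarrow> continuous_on UNIV f"
| "times_cont_diff (Suc k) f \<longleftrightarrow>
     (\<forall>x. f differentiable (at x)) \<and>
     (\<forall>v. times_cont_diff k (\<lambda>x. frechet_derivative f (at x) v))"

definition test_function :: "'a::euclidean_space set \<Rightarrow> ('a \<Rightarrow> real) \<Rightarrow> bool" where
  "test_function \<Omega> \<phi> \<longleftrightarrow>
     (\<forall>k. times_cont_diff k \<phi>) \<and>
     compact (closure {x. \<phi> x \<noteq> 0}) \<and> closure {x. \<phi> x \<noteq> 0} \<subseteq> \<Omega>"

definition frac_const :: "nat \<Rightarrow> real \<Rightarrow> real" where
  "frac_const N s =
     s * 4 powr s * Gamma (real N / 2 + s) / (pi powr (real N / 2) * Gamma (1 - s))"

definition frac_integrand ::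
  "real \<Rightarrow> ('a::euclidean_space \<Rightarrow> real) \<Rightarrow> ('a \<Rightarrow> real) \<Rightarrow> 'a \<times> 'a \<Rightarrow> real" where
  "frac_integrand s \<phi> \<psi> = (\<lambda>(x, y).
     (\<phi> x - \<phi> y) * (\<psi> x - \<psi> y) / norm (x - y) powr (real DIM('a) + 2 * s))"

definition frac_form ::
  "real \<Rightarrow> ('a::euclidean_space \<Rightarrow> real) \<Rightarrow> ('a \<Rightarrow> real) \<Rightarrow> real" where
  "frac_form s \<phi> \<psi> =
     frac_const DIM('a) s / 2 * (LINT z|lborel. frac_integrand s \<phi> \<psi> z)"

text \<open>
  The completion of the test functions under the energy norm, for bounded \<open>\<Omega>\<close>, realized as a
  space of functions: the energy closure of the test functions among the functions of finite
  energy that vanish outside \<open>\<Omega>\<close>. By the fractional Poincare inequality the energy norm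
  dominates the norm of \<open>L\<^sup>2\<close> on the latter functions, and they form a complete space modulo
  almost-everywhere equality, so that this closure is the completion. The integrability
  condition is needed because the Bochner integral of a non-integrable function is \<open>0\<close>.
\<close>

definition H0s :: "real \<Rightarrow> 'a::euclidean_space set \<Rightarrow> ('a \<Rightarrow> real) set" where
  "H0s s \<Omega> = {\<phi>. \<phi> \<in> borel_measurable borel \<and> (\<forall>x. x \<notin> \<Omega> \<longrightarrow> \<phi> x = 0) \<and>
     integrable lborel (frac_integrand s \<phi> \<phi>) \<and>
     (\<exists>\<psi> :: nat \<Rightarrow> 'a \<Rightarrow> real. (\<forall>n. test_function \<Omega> (\<psi> n)) \<and>
        (\<lambda>n. frac_form s (\<lambda>x. \<psi> n x - \<phi> x) (\<lambda>x. \<psi> n x - \<phi> x)) \<longlonglongrightarrow> 0)}"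

definition weak_solution ::
  "real \<Rightarrow> 'a::euclidean_space set \<Rightarrow> real \<Rightarrow> ('a \<Rightarrow> real) \<Rightarrow> bool" where
  "weak_solution s \<Omega> \<mu> \<phi> \<longleftrightarrow> \<phi> \<in> H0s s \<Omega> \<and>
     (\<forall>\<psi>\<in>H0s s \<Omega>. frac_form s \<phi> \<psi> = \<mu> * (LINT x:\<Omega>|lborel. \<phi> x * \<psi> x))"

definition nontrivial :: "('a::euclidean_space \<Rightarrow> real) \<Rightarrow> bool" where
  "nontrivial \<phi> \<longleftrightarrow> \<not> (AE x in lborel. \<phi> x = 0)"

definition frac_eigenvalue :: "real \<Rightarrow> 'a::euclidean_space set \<Rightarrow> real \<Rightarrow> bool" where
  "frac_eigenvalue s \<Omega> \<mu> \<longleftrightarrow> (\<exists>\<phi>. weak_solution s \<Omega> \<mu> \<phi> \<and> nontrivial \<phi>)"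

definition ae_independent :: "nat \<Rightarrow> (nat \<Rightarrow> 'a::euclidean_space \<Rightarrow> real) \<Rightarrow> bool" where
  "ae_independent m \<phi> \<longleftrightarrow>
     (\<forall>c :: nat \<Rightarrow> real. (AE x in lborel. (\<Sum>i<m. c i * \<phi> i x) = 0) \<longrightarrow> (\<forall>i<m. c i = 0))"

text \<open>The dimension of the eigenspace, modulo almost-everywhere equality.\<close>

definition frac_multiplicity :: "real \<Rightarrow> 'a::euclidean_space set \<Rightarrow> real \<Rightarrow> enat" where
  "frac_multiplicity s \<Omega> \<mu> =
     Sup {enat m | m. \<exists>\<phi>. (\<forall>i<m. weak_solution s \<Omega> \<mu> (\<phi> i)) \<and> ae_independent m \<phi>}"

text \<open>
  The \<open>k\<close>-th eigenvalue (\<open>k \<ge> 1\<close>) in increasing order, counted with multiplicity: the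
  least eigenvalue \<open>\<mu>\<close> such that the multiplicities of the eigenvalues \<open>\<nu> \<le> \<mu>\<close> add up to at
  least \<open>k\<close>. The sum is taken over finite sets \<open>F\<close> because \<^const>\<open>sum\<close> over an infinite set
  is \<open>0\<close>.
\<close>

definition frac_lambda :: "nat \<Rightarrow> real \<Rightarrow> 'a::euclidean_space set \<Rightarrow> real" where
  "frac_lambda k s \<Omega> = (LEAST \<mu>. frac_eigenvalue s \<Omega> \<mu> \<and>
     (\<exists>F. finite F \<and> F \<subseteq> {\<nu>. frac_eigenvalue s \<Omega> \<nu> \<and> \<nu> \<le> \<mu>} \<and>
          enat k \<le> (\<Sum>\<nu>\<in>F. frac_multiplicity s \<Omega> \<nu>)))"

definition second_eigenfunction ::
  "real \<Rightarrow> 'a::euclidean_space set \<Rightarrow> ('a \<Rightarrow> real) \<Rightarrow> bool" where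
  "second_eigenfunction s \<Omega> \<phi> \<longleftrightarrow>
     weak_solution s \<Omega> (frac_lambda 2 s \<Omega>) \<phi> \<and> nontrivial \<phi>"

definition radial :: "('a::euclidean_space \<Rightarrow> real) \<Rightarrow> bool" where
  "radial \<phi> \<longleftrightarrow> (\<exists>g :: real \<Rightarrow> real. AE x in lborel. \<phi> x = g (norm x))"

end

theory Submission
  imports Defs
begin

text \<open>
  A nonradial second eigenfunction of the concentric annulus differs from its composition with some
  reflection in a hyperplane through \<open>0\<close>. This gives a second eigenfunction \<open>\<phi>\<close> that is antisymmetric
  in a hyperplane, which may be rotated so that it contains the centre \<open>a\<close> of the other hole.
  Antisymmetric functions are admissible for \<open>\<lambda>\<^sub>2\<close> of the eccentric annulus, because a symmetric and an
  antisymmetric minimizer of the Rayleigh quotient are independent eigenfunctions.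

  Polarize \<open>\<phi>\<close> with respect to the reflection that exchanges \<open>0\<close> and \<open>a\<close>: the larger of the values of
  \<open>\<bar>\<phi>\<bar>\<close> at two mirror points goes to the side of \<open>0\<close>, and the sign is that of the half space. The result
  lives on the eccentric annulus and has the same norm in \<open>L\<^sup>2\<close>. Since \<open>t \<mapsto> t powr - q\<close> is strictly
  decreasing and convex, polarization lowers the energy, strictly unless \<open>\<phi>\<close> has one sign in the half
  space and is already polarized up to a reflection. In that case \<open>\<phi>\<close> vanishes on an open subset of
  the concentric annulus, which the nonlocal equation forbids. Polarization is applied to Lipschitz
  approximations of \<open>\<phi>\<close> only, and the loss of energy passes to the limit by Fatou's lemma.
\<close>

section \<open>Minimizers of a quotient of quadratic forms\<close>

text \<open>The second eigenvalue is a minimum only among functions orthogonal to the first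
  eigenfunction, which changes with the domain and whose orthogonality polarization destroys.
  Oddness in a hyperplane is a linear condition independent of the domain. It survives polarization
  when the two mirrors are perpendicular, and both annuli respect it when the odd hyperplane passes
  through both centres; such a hyperplane exists because N \<ge> 2. The definition of the eigenvalue
  through \<open>LEAST\<close> has content only once the eigenvalues below a bound are known to be
  finitely many, hence the compactness theory. Membership in \<open>H0s\<close> asks for
  approximation by test functions, and polarization is nonlinear, so for a general element it is not
  clear that its polarization can be approximated on the other annulus; for Lipschitz functions of
  compact support this is explicit. The energy loss is therefore expressed through the original
  function alone, so that it still makes sense in the limit.\<close>

locale semi_inner =
  fixes V :: "('a \<Rightarrow> real) set" and B :: "('a \<Rightarrow> real) \<Rightarrow> ('a \<Rightarrow> real) \<Rightarrow> real"
  assumes lincomb: "f \<in> V \<Longrightarrow> g \<in> V \<Longrightarrow> (\<lambda>x. a * f x + b * g x) \<in> V"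
    and lin: "f \<in> V \<Longrightarrow> g \<in> V \<Longrightarrow> h \<in> V \<Longrightarrow> B (\<lambda>x. a * f x + b * g x) h = a * B f h + b * B g h"
    and sym: "f \<in> V \<Longrightarrow> g \<in> V \<Longrightarrow> B f g = B g f"
    and nonneg: "f \<in> V \<Longrightarrow> 0 \<le> B f f"
begin

lemma diff_in: "f \<in> V \<Longrightarrow> g \<in> V \<Longrightarrow> (\<lambda>x. f x - g x) \<in> V"
  using lincomb[of f g 1 "-1"] by simp

lemma scale_in: "f \<in> V \<Longrightarrow> (\<lambda>x. a * f x) \<in> V"
  using lincomb[of f f a 0] by simp

lemma expand:
  assumes "f \<in> V" "g \<in> V"
  shows "B (\<lambda>x. a * f x + b * g x) (\<lambda>x. a * f x + b * g x)
    = a\<^sup>2 * B f f + 2 * a * b * B f g + b\<^sup>2 * B g g"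
proof -
  have l: "(\<lambda>x. a * f x + b * g x) \<in> V" using lincomb assms by blast
  show ?thesis
    using lin[OF assms l, of a b] sym[OF assms(1) l] sym[OF assms(2) l] sym[OF assms]
      lin[OF assms assms(1), of a b] lin[OF assms assms(2), of a b]
    by (simp add: algebra_simps power2_eq_square)
qed

lemma diff_left:
  "f \<in> V \<Longrightarrow> g \<in> V \<Longrightarrow> h \<in> V \<Longrightarrow> B (\<lambda>x. f x - g x) h = B f h - B g h"
  using lin[of f g h 1 "-1"] by simp

lemma expand_diff:
  assumes "f \<in> V" "g \<in> V"
  shows "B (\<lambda>x. f x - g x) (\<lambda>x. f x - g x) = B f f - 2 * B f g + B g g"
  using expand[OF assms, of 1 "-1"] by simp

lemma expand_add:
  assumes "f \<in> V" "g \<in> V"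
  shows "B (\<lambda>x. f x + g x) (\<lambda>x. f x + g x) = B f f + 2 * B f g + B g g"
  using expand[OF assms, of 1 1] by simp

lemma scale_scale:
  assumes "f \<in> V"
  shows "B (\<lambda>x. a * f x) (\<lambda>x. a * f x) = a\<^sup>2 * B f f"
  using expand[OF assms assms, of a 0] by simp

text \<open>From 2 B(u, v) \<le> B(u, u) + B(v, v). The factor 2 replaces the square roots of the
  norm inequality; the limit arguments only need a bound of the squared distance.\<close>

lemma triangle:
  assumes "f \<in> V" "g \<in> V" "h \<in> V"
  shows "B (\<lambda>x. f x - h x) (\<lambda>x. f x - h x)
    \<le> 2 * B (\<lambda>x. f x - g x) (\<lambda>x. f x - g x) + 2 * B (\<lambda>x. g x - h x) (\<lambda>x. g x - h x)"
proof -
  let ?u = "\<lambda>x. f x - g x" and ?v = "\<lambda>x. g x - h x"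
  have uv: "?u \<in> V" "?v \<in> V" using assms diff_in by auto
  have "0 \<le> B (\<lambda>x. ?u x - ?v x) (\<lambda>x. ?u x - ?v x)" using uv diff_in nonneg by blast
  then have "2 * B ?u ?v \<le> B ?u ?u + B ?v ?v" using expand_diff[OF uv] by linarith
  moreover have "B (\<lambda>x. f x - h x) (\<lambda>x. f x - h x) = B ?u ?u + 2 * B ?u ?v + B ?v ?v"
    using expand_add[OF uv] by simp
  ultimately show ?thesis by linarith
qed

lemma cauchy_schwarz:
  assumes "f \<in> V" "g \<in> V"
  shows "(B f g)\<^sup>2 \<le> B f f * B g g"
proof (cases "B g g = 0")
  case False
  then have pos: "0 < B g g" using nonneg[OF assms(2)] by simp
  have "0 \<le> (B g g)\<^sup>2 * B f f + 2 * B g g * (- B f g) * B f g + (- B f g)\<^sup>2 * B g g"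
    using expand[OF assms, of "B g g" "- B f g"] nonneg lincomb assms by metis
  then have "0 \<le> B g g * (B f f * B g g - (B f g)\<^sup>2)"
    by (simp add: algebra_simps power2_eq_square)
  then show ?thesis using pos by (simp add: zero_le_mult_iff)
next
  case True
  have "B f g = 0"
  proof (rule ccontr)
    assume n: "B f g \<noteq> 0"
    \<comment> \<open>This \<open>t\<close> makes B f f + 2 t B f g equal to -1, against
      nonnegativity. The form is only semidefinite, so \<open>B g g = 0\<close> does not force
      \<open>g\<close> to vanish.\<close>
    define t where "t = - (B f f + 1) / (2 * B f g)"
    have "0 \<le> B f f + 2 * t * B f g"
      using expand[OF assms, of 1 t] nonneg[OF lincomb[OF assms, of 1 t]] True by simp
    then show False using n by (simp add: t_def field_simps)
  qed
  then show ?thesis using True by simp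
qed

lemma tendsto_left:
  assumes "\<And>n. u n \<in> V" "f \<in> V" "g \<in> V"
    and lim: "(\<lambda>n::nat. B (\<lambda>x. u n x - f x) (\<lambda>x. u n x - f x)) \<longlonglongrightarrow> 0"
  shows "(\<lambda>n. B (u n) g) \<longlonglongrightarrow> B f g"
proof -
  have "(\<lambda>n. (B (u n) g - B f g)\<^sup>2) \<longlonglongrightarrow> 0"
  proof (rule tendsto_sandwich[OF _ _ tendsto_const])
    show "(\<lambda>n. B (\<lambda>x. u n x - f x) (\<lambda>x. u n x - f x) * B g g) \<longlonglongrightarrow> 0"
      using tendsto_mult_right[OF lim, of "B g g"] by simp
    show "\<forall>\<^sub>F n in sequentially. (B (u n) g - B f g)\<^sup>2 \<le> B (\<lambda>x. u n x - f x) (\<lambda>x. u n x - f x) * B g g"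
    proof (intro always_eventually allI)
      fix n
      show "(B (u n) g - B f g)\<^sup>2 \<le> B (\<lambda>x. u n x - f x) (\<lambda>x. u n x - f x) * B g g"
        using cauchy_schwarz[OF diff_in[OF assms(1,2)] assms(3), of n] diff_left[OF assms(1-3), of n] by simp
    qed
  qed simp
  then have "(\<lambda>n. B (u n) g - B f g) \<longlonglongrightarrow> 0" by (simp add: tendsto_null_power)
  then show ?thesis using LIM_zero_iff by blast
qed

lemma tendsto_diag:
  assumes "\<And>n. u n \<in> V" "f \<in> V"
    and lim: "(\<lambda>n::nat. B (\<lambda>x. u n x - f x) (\<lambda>x. u n x - f x)) \<longlonglongrightarrow> 0"
  shows "(\<lambda>n. B (u n) (u n)) \<longlonglongrightarrow> B f f"
proof -
  have "(\<lambda>n. B (\<lambda>x. u n x - f x) (\<lambda>x. u n x - f x) + 2 * B (u n) f - B f f) \<longlonglongrightarrow> 0 + 2 * B f f - B f f"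
    by (intro tendsto_intros lim tendsto_left assms)
  moreover have "B (\<lambda>x. u n x - f x) (\<lambda>x. u n x - f x) + 2 * B (u n) f - B f f = B (u n) (u n)" for n
    using expand_diff[of "u n" f] assms by simp
  ultimately show ?thesis by simp
qed

end

text \<open>\<open>E\<close> stands for the energy, \<open>L\<close> for the L2 product. Compactness
  only produces an \<open>L\<close>-Cauchy subsequence, so no limit in L2 has to be named.
  Abstracting from \<open>V\<close> lets one argument serve the symmetric functions, the
  antisymmetric functions and the whole space.\<close>

locale compact_form = E: semi_inner V E + L: semi_inner V L
  for V :: "('a \<Rightarrow> real) set" and E L :: "('a \<Rightarrow> real) \<Rightarrow> ('a \<Rightarrow> real) \<Rightarrow> real" +
  fixes C :: real
  assumes poincare: "f \<in> V \<Longrightarrow> L f f \<le> C * E f f"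
    and complete: "(\<And>n. u n \<in> V) \<Longrightarrow>
      (\<And>e. 0 < e \<Longrightarrow> \<exists>N. \<forall>j\<ge>N. \<forall>k\<ge>N. E (\<lambda>x. u j x - u k x) (\<lambda>x. u j x - u k x) < e) \<Longrightarrow>
      \<exists>w\<in>V. (\<lambda>n::nat. E (\<lambda>x. u n x - w x) (\<lambda>x. u n x - w x)) \<longlonglongrightarrow> 0"
    and compact: "(\<And>n::nat. u n \<in> V) \<Longrightarrow> (\<And>n. E (u n) (u n) \<le> M) \<Longrightarrow>
      \<exists>r::nat \<Rightarrow> nat. strict_mono r \<and> (\<forall>e>0. \<exists>N. \<forall>j\<ge>N. \<forall>k\<ge>N.
        L (\<lambda>x. u (r j) x - u (r k) x) (\<lambda>x. u (r j) x - u (r k) x) < e)"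
begin

text \<open>The direct method: a minimizing sequence for the Rayleigh quotient has an
  \<open>L\<close>-Cauchy subsequence, the parallelogram law makes it \<open>E\<close>-Cauchy, and
  completeness yields a minimizer.\<close>

lemma minimizer_exists:
  assumes "f0 \<in> V" "L f0 f0 > 0"
  shows "\<exists>u\<in>V. \<exists>m. 0 < L u u \<and> (\<forall>v\<in>V. E u v = m * L u v) \<and> (\<forall>v\<in>V. m * L v v \<le> E v v)"
proof -
  define S where "S = {E f f | f. f \<in> V \<and> L f f = 1}"
  define m where "m = Inf S"
  have normed: "(\<lambda>x. (1 / sqrt (L f f)) * f x) \<in> V"
      "L (\<lambda>x. (1 / sqrt (L f f)) * f x) (\<lambda>x. (1 / sqrt (L f f)) * f x) = 1"
      "E (\<lambda>x. (1 / sqrt (L f f)) * f x) (\<lambda>x. (1 / sqrt (L f f)) * f x) = E f f / L f f"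
    if "f \<in> V" "L f f > 0" for f
    using that L.scale_in[of f "1 / sqrt (L f f)"] L.scale_scale[of f "1 / sqrt (L f f)"] E.scale_scale[of f "1 / sqrt (L f f)"]
    by (auto simp: power_divide)
  have S_I: "E f f \<in> S" if "f \<in> V" "L f f = 1" for f using that by (auto simp: S_def)
  have ne: "S \<noteq> {}" using S_I[OF normed(1,2)[OF assms]] by blast
  have bdd: "bdd_below S" unfolding S_def using E.nonneg by (intro bdd_belowI[of _ 0]) auto
  have m0: "0 \<le> m" unfolding m_def using E.nonneg by (intro cInf_greatest ne) (auto simp: S_def)
  have minL: "m * L v v \<le> E v v" if "v \<in> V" for v
  proof (cases "L v v = 0")
    case True then show ?thesis using E.nonneg that by simp
  next
    case False
    then have p: "0 < L v v" using L.nonneg[OF that] by simp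
    have "E v v / L v v \<in> S" using S_I[OF normed(1,2)[OF that p]] normed(3)[OF that p] by simp
    then have "m \<le> E v v / L v v" unfolding m_def using bdd by (rule cInf_lower)
    then show ?thesis using p by (simp add: field_simps)
  qed
  have "\<exists>f. f \<in> V \<and> L f f = 1 \<and> E f f < m + 1 / (real n + 1)" for n :: nat
  proof -
    have "Inf S < m + 1 / (real n + 1)" unfolding m_def by simp
    from cInf_lessD[OF ne this] obtain x where "x \<in> S" "x < m + 1 / (real n + 1)" by blast
    then show ?thesis by (auto simp: S_def)
  qed
  then obtain u where u: "\<And>n. u n \<in> V" "\<And>n. L (u n) (u n) = 1"
      "\<And>n::nat. E (u n) (u n) < m + 1 / (real n + 1)" by metis
  have "E (u n) (u n) \<le> m + 1" for n
  proof -
    have "1 / (real n + 1) \<le> 1" by simp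
    then show ?thesis using u(3)[of n] by linarith
  qed
  then obtain r :: "nat \<Rightarrow> nat" where r: "strict_mono r"
      "\<And>e. e>0 \<Longrightarrow> \<exists>N. \<forall>j\<ge>N. \<forall>k\<ge>N.
        L (\<lambda>x. u (r j) x - u (r k) x) (\<lambda>x. u (r j) x - u (r k) x) < e"
    using compact[of u "m+1", OF u(1)] by auto
  define v where "v n = u (r n)" for n
  have v: "\<And>n. v n \<in> V" "\<And>n. L (v n) (v n) = 1" using u by (auto simp: v_def)
  have vE: "E (v n) (v n) < m + 1 / (real n + 1)" for n
  proof -
    have "1 / (real (r n) + 1) \<le> 1 / (real n + 1)"
      using seq_suble[OF r(1), of n] by (simp add: frac_le)
    then show ?thesis using u(3)[of "r n"] by (simp add: v_def)
  qed
  \<comment> \<open>Parallelogram law: the sum of two almost-minimizers has quotient at least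
    \<open>m\<close>, which bounds the energy of their difference by the two excess energies and
    \<open>m\<close> times their \<open>L\<close>-distance.\<close>
  have cau: "E (\<lambda>x. v j x - v k x) (\<lambda>x. v j x - v k x)
      \<le> 2 / (real j + 1) + 2 / (real k + 1) + m * L (\<lambda>x. v j x - v k x) (\<lambda>x. v j x - v k x)" for j k
  proof -
    have "m * L (\<lambda>x. v j x + v k x) (\<lambda>x. v j x + v k x) \<le> E (\<lambda>x. v j x + v k x) (\<lambda>x. v j x + v k x)"
      using minL E.lincomb[OF v(1) v(1), of 1 j 1 k] by simp
    moreover have "L (\<lambda>x. v j x + v k x) (\<lambda>x. v j x + v k x) = 4 - L (\<lambda>x. v j x - v k x) (\<lambda>x. v j x - v k x)"
      using L.expand_diff[OF v(1) v(1), of j k] L.expand_add[OF v(1) v(1), of j k] v(2) by simp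
    ultimately have "m * 4 - m * L (\<lambda>x. v j x - v k x) (\<lambda>x. v j x - v k x)
        \<le> E (\<lambda>x. v j x + v k x) (\<lambda>x. v j x + v k x)"
      by (simp add: right_diff_distrib)
    moreover have "2 / (real i + 1) = 2 * (1 / (real i + 1))" for i by simp
    ultimately show ?thesis
      using vE[of j] vE[of k] E.expand_diff[OF v(1) v(1), of j k] E.expand_add[OF v(1) v(1), of j k]
      by linarith
  qed
  have "\<exists>w\<in>V. (\<lambda>n. E (\<lambda>x. v n x - w x) (\<lambda>x. v n x - w x)) \<longlonglongrightarrow> 0"
  proof (rule complete[OF v(1)])
    fix e :: real assume e: "0 < e"
    \<comment> \<open>\<open>m\<close> may be 0, hence the denominator with
      \<open>m + 1\<close>.\<close>
    have "0 < e / (2 * (m + 1))" using e m0 by simp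
    from r(2)[OF this] obtain N1 where N1: "\<And>j k. j \<ge> N1 \<Longrightarrow> k \<ge> N1 \<Longrightarrow>
      L (\<lambda>x. v j x - v k x) (\<lambda>x. v j x - v k x) < e / (2 * (m + 1))" unfolding v_def by blast
    obtain N2 :: nat where N2: "8 / e < real N2" using reals_Archimedean2 by blast
    have "E (\<lambda>x. v j x - v k x) (\<lambda>x. v j x - v k x) < e" if "j \<ge> max N1 N2" "k \<ge> max N1 N2" for j k
    proof -
      have small: "2 / (real j + 1) \<le> e / 4" if "j \<ge> N2" for j
      proof -
        have "8 / e \<le> real j + 1" using N2 that by linarith
        then show ?thesis using e by (simp add: field_simps)
      qed
      have "m * L (\<lambda>x. v j x - v k x) (\<lambda>x. v j x - v k x) \<le> m * (e / (2 * (m + 1)))"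
        using N1[of j k] that m0 by (intro mult_left_mono) auto
      also have "\<dots> < e / 2" using m0 e by (simp add: field_simps)
      finally show ?thesis using cau[of j k] small[of j] small[of k] that by linarith
    qed
    then show "\<exists>N. \<forall>j\<ge>N. \<forall>k\<ge>N. E (\<lambda>x. v j x - v k x) (\<lambda>x. v j x - v k x) < e" by blast
  qed
  then obtain w where w: "w \<in> V" and lim: "(\<lambda>n. E (\<lambda>x. v n x - w x) (\<lambda>x. v n x - w x)) \<longlonglongrightarrow> 0" by blast
  have limL: "(\<lambda>n. L (\<lambda>x. v n x - w x) (\<lambda>x. v n x - w x)) \<longlonglongrightarrow> 0"
  proof (rule tendsto_sandwich[OF _ _ tendsto_const])
    show "(\<lambda>n. C * E (\<lambda>x. v n x - w x) (\<lambda>x. v n x - w x)) \<longlonglongrightarrow> 0"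
      using tendsto_mult_left[OF lim, of C] by simp
  qed (use poincare L.nonneg E.diff_in[OF v(1) w] in auto)
  have Lw: "L w w = 1" using L.tendsto_diag[OF v(1) w limL] v(2) LIMSEQ_unique[OF _ tendsto_const] by auto
  have "E w w \<le> m + 0"
  proof (rule LIMSEQ_le[OF E.tendsto_diag[OF v(1) w lim]])
    show "(\<lambda>n. m + 1 / (real n + 1)) \<longlonglongrightarrow> m + 0"
      using LIMSEQ_inverse_real_of_nat by (intro tendsto_add tendsto_const) (simp add: inverse_eq_divide add.commute)
  qed (use vE less_imp_le in blast)
  then have Ew: "E w w = m" using minL[OF w] Lw by simp
  \<comment> \<open>The form E - m L is again positive semidefinite and takes the value 0 at
    \<open>w\<close>, so Cauchy-Schwarz annihilates all its pairings with \<open>w\<close>. This is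
    the Euler-Lagrange equation without any differentiation.\<close>
  interpret D: semi_inner V "\<lambda>f g. E f g - m * L f g"
    using E.lincomb E.lin L.lin E.sym L.sym minL
    by unfold_locales (auto simp: algebra_simps)
  have "E w z = m * L w z" if "z \<in> V" for z
    using D.cauchy_schwarz[OF w that] Ew Lw by simp
  then show ?thesis using w Lw minL by (intro bexI[of _ w] exI[of _ m]) auto
qed

text \<open>Eigenfunctions to distinct eigenvalues are \<open>L\<close>-orthogonal. Normalized ones
  with energy at most \<open>M\<close> would form an infinite family at mutual squared distance 2,
  which contradicts \<open>compact\<close>.\<close>

lemma finite_spectrum:
  "finite {\<mu>. \<mu> \<le> M \<and> (\<exists>u\<in>V. 0 < L u u \<and> (\<forall>v\<in>V. E u v = \<mu> * L u v))}" (is "finite ?S")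
proof (rule ccontr)
  assume inf: "infinite ?S"
  from infinite_iff_countable_subset[THEN iffD1, OF inf]
  obtain \<mu> :: "nat \<Rightarrow> real" where \<mu>: "inj \<mu>" "range \<mu> \<subseteq> ?S"
    by (elim exE conjE) (rule that)
  have "\<exists>u\<in>V. 0 < L u u \<and> (\<forall>v\<in>V. E u v = \<mu> n * L u v)" for n
    using subsetD[OF \<mu>(2) rangeI, of n] by simp
  then obtain w where w: "\<And>n. w n \<in> V" "\<And>n. 0 < L (w n) (w n)"
      "\<And>n v. v \<in> V \<Longrightarrow> E (w n) v = \<mu> n * L (w n) v" by metis
  define u where "u n = (\<lambda>x. (1 / sqrt (L (w n) (w n))) * w n x)" for n
  have u: "u n \<in> V" "L (u n) (u n) = 1" for n
    using w(1,2) L.scale_in[of "w n" "1 / sqrt (L (w n) (w n))"] L.scale_scale[of "w n" "1 / sqrt (L (w n) (w n))"]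
    by (auto simp: u_def power_divide less_imp_le less_imp_neq[symmetric])
  have lin1: "X (u n) v = (1 / sqrt (L (w n) (w n))) * X (w n) v" 
    if "semi_inner V X" "v \<in> V" for X n v
    using semi_inner.lin[OF that(1) w(1) w(1) that(2), of "1 / sqrt (L (w n) (w n))" n 0 n]
    by (simp add: u_def)
  have uE: "E (u n) v = \<mu> n * L (u n) v" if "v \<in> V" for n v
    using lin1[OF E.semi_inner_axioms that] lin1[OF L.semi_inner_axioms that] w(3)[OF that] by simp
  have orth: "L (u j) (u k) = 0" if "j \<noteq> k" for j k
  proof -
    have "\<mu> j * L (u j) (u k) = E (u j) (u k)" using uE[OF u(1)] by simp
    also have "\<dots> = E (u k) (u j)" by (rule E.sym[OF u(1) u(1)])
    also have "\<dots> = \<mu> k * L (u k) (u j)" by (rule uE[OF u(1)])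
    also have "L (u k) (u j) = L (u j) (u k)" by (rule L.sym[OF u(1) u(1)])
    finally have "(\<mu> j - \<mu> k) * L (u j) (u k) = 0" by (simp only: left_diff_distrib right_minus_eq)
    moreover have "\<mu> j \<noteq> \<mu> k" using \<mu>(1) that by (auto dest: injD)
    ultimately show ?thesis unfolding mult_eq_0_iff right_minus_eq by blast
  qed
  have "E (u n) (u n) \<le> M" for n
    using uE[OF u(1)] u(2) subsetD[OF \<mu>(2) rangeI, of n] by simp
  then obtain r :: "nat \<Rightarrow> nat" where r: "strict_mono r"
      "\<And>e. e>0 \<Longrightarrow> \<exists>N. \<forall>j\<ge>N. \<forall>k\<ge>N.
        L (\<lambda>x. u (r j) x - u (r k) x) (\<lambda>x. u (r j) x - u (r k) x) < e"
    using compact[of u M, OF u(1)] by auto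
  from r(2)[of 1] obtain N where "\<forall>j\<ge>N. \<forall>k\<ge>N.
      L (\<lambda>x. u (r j) x - u (r k) x) (\<lambda>x. u (r j) x - u (r k) x) < 1" by auto
  then have N: "L (\<lambda>x. u (r N) x - u (r (Suc N)) x) (\<lambda>x. u (r N) x - u (r (Suc N)) x) < 1"
    by simp
  have "r N \<noteq> r (Suc N)" using r(1) by (metis n_not_Suc_n strict_mono_eq)
  then show False using N L.expand_diff[OF u(1) u(1), of "r N" "r (Suc N)"] orth u(2) by simp
qed

end

section \<open>The energy form\<close>

abbreviation frac_quad :: "real \<Rightarrow> ('a::euclidean_space \<Rightarrow> real) \<Rightarrow> real" where
  "frac_quad s f \<equiv> frac_form s f f"

definition fin_energy :: "real \<Rightarrow> ('a::euclidean_space \<Rightarrow> real) set" where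
  "fin_energy s = {f. f \<in> borel_measurable borel \<and> integrable lborel (frac_integrand s f f)}"

text \<open>At the origin the value is 0 (from \<open>0 powr p = 0\<close> and
  \<open>1 / 0 = 0\<close>), not infinity; comparisons of kernels therefore have to exclude
  coinciding points.\<close>

definition frac_ker :: "real \<Rightarrow> 'a::euclidean_space \<Rightarrow> real" where
  "frac_ker s z = 1 / norm z powr (real DIM('a) + 2 * s)"

lemma frac_ker_nonneg: "0 \<le> frac_ker s z"
  by (simp add: frac_ker_def)

lemma frac_integrand_eq:
  "frac_integrand s f g (x, y) = (f x - f y) * (g x - g y) * frac_ker s (x - y)"
  by (simp add: frac_integrand_def frac_ker_def)

lemma borel_measurable_fst_borel [measurable]:
  "fst \<in> borel_measurable (borel :: ('a::euclidean_space \<times> 'a) measure)"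
  by (intro borel_measurable_continuous_onI continuous_intros)

lemma borel_measurable_snd_borel [measurable]:
  "snd \<in> borel_measurable (borel :: ('a::euclidean_space \<times> 'a) measure)"
  by (intro borel_measurable_continuous_onI continuous_intros)

lemma ball_measurable [measurable]: "ball (a :: 'a::euclidean_space) r \<in> sets borel"
  by simp

lemma frac_ker_measurable [measurable]: "frac_ker s \<in> borel_measurable borel"
  unfolding frac_ker_def by measurable

lemma frac_integrand_measurable [measurable]:
  assumes [measurable]: "f \<in> borel_measurable borel" "g \<in> borel_measurable borel"
  shows "frac_integrand s f g \<in> borel_measurable borel"
proof -
  have "frac_integrand s f g = (\<lambda>z. (f (fst z) - f (snd z)) * (g (fst z) - g (snd z)) * frac_ker s (fst z - snd z))"
    by (auto simp: fun_eq_iff frac_integrand_eq)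
  then show ?thesis by simp
qed

lemma nn_integral_shift:
  fixes x :: "'a::euclidean_space"
  assumes [measurable]: "k \<in> borel_measurable borel"
  shows "(\<integral>\<^sup>+y. k (x - y) \<partial>lborel) = (\<integral>\<^sup>+y. k y \<partial>lborel)"
proof -
  have "lborel = distr lborel borel (\<lambda>y. x - y)"
    using lborel_affine[of "-1" x] by (simp add: density_1 one_ennreal_def[symmetric])
  then have "(\<integral>\<^sup>+y. k y \<partial>lborel) = (\<integral>\<^sup>+y. k y \<partial>distr lborel borel (\<lambda>y. x - y))" by simp
  also have "\<dots> = (\<integral>\<^sup>+y. k (x - y) \<partial>lborel)" by (simp add: nn_integral_distr)
  finally show ?thesis by simp
qed

lemma nn_integral_product:
  fixes f :: "'a::euclidean_space \<times> 'a \<Rightarrow> ennreal"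
  assumes "f \<in> borel_measurable borel"
  shows "(\<integral>\<^sup>+z. f z \<partial>lborel) = (\<integral>\<^sup>+x. (\<integral>\<^sup>+y. f (x, y) \<partial>lborel) \<partial>lborel)"
  using assms lborel.nn_integral_fst[of f "lborel :: 'a measure"]
  by (simp add: lborel_prod)

lemma AE_product:
  fixes P :: "'a::euclidean_space \<Rightarrow> bool"
  assumes "AE x in lborel. P x"
  shows "AE z in (lborel :: ('a \<times> 'a) measure). P (fst z) \<and> P (snd z)"
proof -
  obtain N where N: "{x. \<not> P x} \<subseteq> N" "N \<in> sets lborel" "emeasure lborel N = 0"
    using assms by (auto elim!: AE_E simp: space_lborel)
  have "emeasure (lborel \<Otimes>\<^sub>M lborel) (N \<times> (UNIV :: 'a set)) = 0"
    "emeasure (lborel \<Otimes>\<^sub>M lborel) ((UNIV :: 'a set) \<times> N) = 0"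
    using N by (subst lborel.emeasure_pair_measure_Times; simp)+
  then have "N \<times> (UNIV :: 'a set) \<in> null_sets lborel" "(UNIV :: 'a set) \<times> N \<in> null_sets lborel"
    using N by (auto simp: null_sets_def lborel_prod intro!: borel_Times)
  then have "(N \<times> UNIV) \<union> (UNIV \<times> N) \<in> null_sets lborel" by (rule null_sets.Un)
  then show ?thesis by (rule AE_I') (use N(1) in auto)
qed

section \<open>Integrability of the singular kernel\<close>

lemma ex_dyadic:
  fixes r :: real
  assumes "0 < r"
  obtains k :: int where "2 powr (real_of_int k) \<le> r" "r < 2 powr (real_of_int k + 1)"
proof
  have r: "2 powr (log 2 r) = r" using assms by simp
  have "2 powr real_of_int \<lfloor>log 2 r\<rfloor> \<le> 2 powr (log 2 r)" by (intro powr_mono) auto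
  then show "2 powr real_of_int \<lfloor>log 2 r\<rfloor> \<le> r" unfolding r .
  have "2 powr (log 2 r) < 2 powr (real_of_int \<lfloor>log 2 r\<rfloor> + 1)"
    by (intro powr_less_mono) auto
  then show "r < 2 powr (real_of_int \<lfloor>log 2 r\<rfloor> + 1)" unfolding r .
qed

text \<open>Dyadic shells: where the norm is about 2^k the kernel is at most 2^(-k(N + 2s)) and the
  volume about 2^(kN). Outer shells sum with ratio 2^(-2s), inner ones, thanks to the squared norm,
  with ratio 2^(2s - 2). Both ratios are below 1 because 0 < s < 1.\<close>

lemma nn_integral_ker_finite:
  assumes s: "0 < s" "s < 1"
  shows "(\<integral>\<^sup>+(z::'a::euclidean_space). ennreal (min 1 ((norm z)\<^sup>2) * frac_ker s z) \<partial>lborel) < \<infinity>"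
proof -
  define N where "N = real DIM('a)"
  define p where "p = N + 2 * s"
  have p: "p > 0" "N > 0" using s by (auto simp: p_def N_def)
  define V where "V = unit_ball_vol N"
  have V: "V \<ge> 0" using p by (simp add: V_def)
  \<comment> \<open>\<open>t1\<close> covers the shells with exponent k \<ge> 0; \<open>t2\<close>
    covers those with exponent -k - 1, which lie in the ball of radius 2^(-k).\<close>
  define t1 where "t1 k z = ennreal (2 powr (- real k * p)) * indicator (ball (0::'a) (2 powr (real k + 1))) z" for k :: nat and z
  define t2 where "t2 k z = ennreal (2 powr (- 2 * real k + (real k + 1) * p)) * indicator (ball (0::'a) (2 powr (- real k))) z" for k :: nat and z
  have [measurable]: "t1 k \<in> borel_measurable borel" "t2 k \<in> borel_measurable borel" for k
    unfolding t1_def t2_def by measurable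
  have bnd: "ennreal (min 1 ((norm z)\<^sup>2) * frac_ker s z) \<le> (\<Sum>k. t1 k z) + (\<Sum>k. t2 k z)" for z
  proof (cases "z = 0")
    case True then show ?thesis by (simp add: frac_ker_def)
  next
    case False
    then have r: "0 < norm z" by simp
    from ex_dyadic[OF r] obtain k where k: "2 powr (real_of_int k) \<le> norm z" "norm z < 2 powr (real_of_int k + 1)" by blast
    have ker: "frac_ker s z \<le> 2 powr (- real_of_int k * p)"
    proof -
      have "(2 powr real_of_int k) powr p \<le> norm z powr p" using k p by (intro powr_mono2) auto
      then have "1 / norm z powr p \<le> 1 / (2 powr real_of_int k) powr p" using r by (intro divide_left_mono) auto
      then show ?thesis unfolding frac_ker_def p_def N_def by (simp add: powr_powr powr_minus_divide)
    qed
    show ?thesis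
    proof (cases "k \<ge> 0")
      case True
      have "min 1 ((norm z)\<^sup>2) * frac_ker s z \<le> 1 * 2 powr (- real_of_int k * p)"
        using ker frac_ker_nonneg[of s z] by (intro mult_mono) auto
      then have "ennreal (min 1 ((norm z)\<^sup>2) * frac_ker s z) \<le> ennreal (2 powr (- real_of_int k * p))"
        by (simp add: ennreal_leI)
      also have "\<dots> = t1 (nat k) z" using True k by (simp add: t1_def)
      also have "\<dots> \<le> (\<Sum>k. t1 k z)"
        using sum_le_suminf[of "\<lambda>k. t1 k z" "{nat k}"] by simp
      finally show ?thesis by (rule order_trans) simp
    next
      case False
      define j where "j = nat (- k - 1)"
      have j: "real_of_int k = - real j - 1" using False by (simp add: j_def)
      have "(norm z)\<^sup>2 \<le> (2 powr (- real j))\<^sup>2" using k j by (intro power_mono) auto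
      also have "\<dots> = 2 powr (- 2 * real j)" by (simp add: powr_power)
      finally have "min 1 ((norm z)\<^sup>2) * frac_ker s z \<le> 2 powr (- 2 * real j) * 2 powr (- real_of_int k * p)"
        using ker frac_ker_nonneg[of s z] by (intro mult_mono) auto
      also have "\<dots> = 2 powr (- 2 * real j + (real j + 1) * p)"
        by (simp only: powr_add[symmetric] j) (simp add: algebra_simps)
      finally have "ennreal (min 1 ((norm z)\<^sup>2) * frac_ker s z) \<le> ennreal (2 powr (- 2 * real j + (real j + 1) * p))"
        by (rule ennreal_leI)
      also have "\<dots> = t2 j z" using k j by (simp add: t2_def)
      also have "\<dots> \<le> (\<Sum>k. t2 k z)"
        using sum_le_suminf[of "\<lambda>k. t2 k z" "{j}"] by simp
      finally show ?thesis by (rule order_trans) simp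
    qed
  qed
  have geo: "(\<Sum>k. ennreal (c * q ^ k)) \<noteq> \<infinity>" if "0 \<le> c" "0 \<le> q" "q < 1" for c q :: real
  proof -
    have "summable (\<lambda>k. c * q ^ k)" using that by (intro summable_mult[OF summable_geometric]) simp
    from ennreal_suminf_neq_top[OF this] that show ?thesis
      unfolding infinity_ennreal_def by (metis mult_nonneg_nonneg zero_le_power)
  qed
  have i1: "(\<integral>\<^sup>+z. t1 k z \<partial>lborel) = ennreal (V * 2 powr N * (2 powr (- 2 * s)) ^ k)" for k
  proof -
    have "(2 powr (real k + 1)) ^ DIM('a) = 2 powr ((real k + 1) * N)"
      by (simp add: N_def powr_powr[symmetric] powr_realpow)
    then have "(\<integral>\<^sup>+z. t1 k z \<partial>lborel) = ennreal (2 powr (- real k * p)) * ennreal (V * 2 powr ((real k + 1) * N))"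
      unfolding t1_def by (simp add: nn_integral_cmult_indicator emeasure_ball V_def N_def)
    also have "\<dots> = ennreal (V * 2 powr (- real k * p + (real k + 1) * N))"
      by (simp only: ennreal_mult'[symmetric] ennreal_mult''[symmetric] powr_ge_zero V mult_nonneg_nonneg powr_add mult.commute mult.left_commute mult.assoc)
    also have "- real k * p + (real k + 1) * N = N + (- 2 * s) * real k" by (simp add: p_def algebra_simps)
    also have "2 powr \<dots> = 2 powr N * (2 powr (- 2 * s)) ^ k"
      by (simp only: powr_add powr_powr[symmetric]) (simp add: powr_realpow)
    finally show ?thesis by (simp add: mult_ac)
  qed
  have i2: "(\<integral>\<^sup>+z. t2 k z \<partial>lborel) = ennreal (V * 2 powr p * (2 powr (2 * s - 2)) ^ k)" for k
  proof -
    have "(2 powr (- real k)) ^ DIM('a) = 2 powr ((- real k) * N)"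
      by (simp only: N_def powr_powr[symmetric]) (simp add: powr_realpow)
    then have "(\<integral>\<^sup>+z. t2 k z \<partial>lborel) = ennreal (2 powr (- 2 * real k + (real k + 1) * p)) * ennreal (V * 2 powr ((- real k) * N))"
      unfolding t2_def by (simp add: nn_integral_cmult_indicator emeasure_ball V_def N_def)
    also have "\<dots> = ennreal (V * 2 powr (- 2 * real k + (real k + 1) * p + (- real k) * N))"
      by (simp only: ennreal_mult'[symmetric] ennreal_mult''[symmetric] powr_ge_zero V mult_nonneg_nonneg powr_add mult.commute mult.left_commute mult.assoc)
    also have "- 2 * real k + (real k + 1) * p + (- real k) * N = p + (2 * s - 2) * real k" by (simp add: p_def algebra_simps)
    also have "2 powr \<dots> = 2 powr p * (2 powr (2 * s - 2)) ^ k"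
      by (simp only: powr_add powr_powr[symmetric]) (simp add: powr_realpow)
    finally show ?thesis by (simp add: mult_ac)
  qed
  have "(\<integral>\<^sup>+(z::'a). ennreal (min 1 ((norm z)\<^sup>2) * frac_ker s z) \<partial>lborel)
      \<le> (\<integral>\<^sup>+z. (\<Sum>k. t1 k z) + (\<Sum>k. t2 k z) \<partial>lborel)"
    by (intro nn_integral_mono bnd)
  also have "\<dots> = (\<Sum>k. \<integral>\<^sup>+z. t1 k z \<partial>lborel) + (\<Sum>k. \<integral>\<^sup>+z. t2 k z \<partial>lborel)"
    by (subst nn_integral_add) (simp_all add: nn_integral_suminf)
  also have "\<dots> < \<infinity>"
  proof -
    have q: "2 powr (- 2 * s) < (1::real)" "2 powr (2 * s - 2) < (1::real)"
      using s by (auto simp: powr_less_one)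
    have "(\<Sum>k. ennreal (V * 2 powr N * (2 powr (- 2 * s)) ^ k)) \<noteq> \<infinity>"
      "(\<Sum>k. ennreal (V * 2 powr p * (2 powr (2 * s - 2)) ^ k)) \<noteq> \<infinity>"
      by (rule geo; (rule q)?; (simp add: V)?)+
    then show ?thesis
      unfolding i1 i2 less_top[symmetric] infinity_ennreal_def ennreal_add_eq_top by blast
  qed
  finally show ?thesis .
qed

text \<open>A common integrable majorant, up to a factor, for the energy densities of all bounded
  Lipschitz functions that vanish outside \<open>ball 0 R\<close>. The indicators are added because
  the density is sure to vanish only if both points lie outside the ball.\<close>

definition lip_bound :: "real \<Rightarrow> real \<Rightarrow> 'a::euclidean_space \<times> 'a \<Rightarrow> real" where
  "lip_bound s R = (\<lambda>(x, y). (indicator (ball 0 R) x + indicator (ball 0 R) y) *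
     (min 1 ((norm (x - y))\<^sup>2) * frac_ker s (x - y)))"

lemma lip_bound_nonneg: "0 \<le> lip_bound s R z"
  by (auto simp: lip_bound_def frac_ker_nonneg split: prod.split)

lemma lip_bound_integrable:
  assumes s: "0 < s" "s < 1"
  shows "integrable lborel (lip_bound s R :: 'a::euclidean_space \<times> 'a \<Rightarrow> real)"
proof -
  define k where "k z = ennreal (min 1 ((norm (z::'a))\<^sup>2) * frac_ker s z)" for z
  have [measurable]: "k \<in> borel_measurable borel" unfolding k_def by measurable
  have [measurable]: "(lip_bound s R :: 'a \<times> 'a \<Rightarrow> real) \<in> borel_measurable borel"
    unfolding lip_bound_def case_prod_unfold by measurable
  have k_sym: "k (x - y) = k (y - x)" for x y
    by (simp add: k_def frac_ker_def norm_minus_commute)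
  define I where "I x = (indicator (ball 0 R) x :: ennreal)" for x :: 'a
  have [measurable]: "I \<in> borel_measurable borel" unfolding I_def by measurable
  have "(\<integral>\<^sup>+z. ennreal (lip_bound s R z) \<partial>(lborel :: ('a \<times> 'a) measure))
      = (\<integral>\<^sup>+z. I (fst z) * k (fst z - snd z) + I (snd z) * k (snd z - fst z) \<partial>lborel)"
  proof (intro nn_integral_cong)
    fix z :: "'a \<times> 'a"
    define t where "t = min 1 ((norm (fst z - snd z))\<^sup>2) * frac_ker s (fst z - snd z)"
    have "0 \<le> t" by (simp add: t_def frac_ker_nonneg)
    moreover have "k (fst z - snd z) = ennreal t" by (simp add: k_def t_def)
    moreover have "I x = ennreal (indicator (ball 0 R) x)" for x by (simp add: I_def indicator_def)
    moreover have "lip_bound s R z = indicator (ball 0 R) (fst z) * t + indicator (ball 0 R) (snd z) * t"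
      by (cases z) (simp add: lip_bound_def t_def distrib_right)
    ultimately show "ennreal (lip_bound s R z) = I (fst z) * k (fst z - snd z) + I (snd z) * k (snd z - fst z)"
      using k_sym[of "snd z" "fst z"] by (simp only: ennreal_mult'[symmetric] mult_nonneg_nonneg ennreal_plus[symmetric] indicator_pos_le)
  qed
  also have "\<dots> = (\<integral>\<^sup>+z. I (fst z) * k (fst z - snd z) \<partial>lborel) + (\<integral>\<^sup>+z. I (snd z) * k (snd z - fst z) \<partial>lborel)"
    by (rule nn_integral_add) measurable
  also have "(\<integral>\<^sup>+z. I (fst z) * k (fst z - snd z) \<partial>lborel) = (\<integral>\<^sup>+x. I x * (\<integral>\<^sup>+y. k y \<partial>lborel) \<partial>lborel)"
    by (subst nn_integral_product) (simp_all add: nn_integral_cmult nn_integral_shift)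
  also have "(\<integral>\<^sup>+z. I (snd z) * k (snd z - fst z) \<partial>lborel) = (\<integral>\<^sup>+x. I x * (\<integral>\<^sup>+y. k y \<partial>lborel) \<partial>lborel)"
  proof -
    have "(\<integral>\<^sup>+z. I (snd z) * k (snd z - fst z) \<partial>lborel) = (\<integral>\<^sup>+y. \<integral>\<^sup>+x. I y * k (y - x) \<partial>lborel \<partial>lborel)"
      using lborel_pair.nn_integral_snd[of "\<lambda>z. I (snd z) * k (snd z - fst z)"]
      by (simp add: lborel_prod case_prod_unfold)
    then show ?thesis by (simp add: nn_integral_cmult nn_integral_shift)
  qed
  also have "(\<integral>\<^sup>+x. I x * (\<integral>\<^sup>+y. k y \<partial>lborel) \<partial>lborel) = emeasure lborel (ball (0::'a) R) * (\<integral>\<^sup>+y. k y \<partial>lborel)"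
    unfolding I_def by (subst nn_integral_multc) simp_all
  also have "\<dots> + \<dots> < \<infinity>"
    using nn_integral_ker_finite[OF s, where 'a='a] emeasure_lborel_ball_finite[of "0::'a" R]
    by (simp add: k_def ennreal_mult_less_top)
  finally show ?thesis
    by (intro integrableI_nonneg) (auto simp: lip_bound_nonneg)
qed

lemma frac_integrand_le_lip_bound:
  assumes lip: "\<And>x y. \<bar>f x - f y\<bar> \<le> A * norm (x - y)" and bd: "\<And>x. \<bar>f x\<bar> \<le> A"
    and van: "\<And>x. x \<notin> ball 0 R \<Longrightarrow> f x = 0"
  shows "frac_integrand s f f z \<le> 4 * A\<^sup>2 * lip_bound s R z"
proof -
  obtain x y where z: "z = (x, y)" by force
  show ?thesis
  proof (cases "x \<in> ball 0 R \<or> y \<in> ball 0 R")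
    case False
    then show ?thesis using van by (simp add: z frac_integrand_eq lip_bound_def)
  next
    case True
    have A: "0 \<le> A" using bd[of x] by linarith
    have "\<bar>f x - f y\<bar>\<^sup>2 \<le> (A * norm (x - y))\<^sup>2" using lip by (intro power_mono) auto
    moreover have "\<bar>f x - f y\<bar>\<^sup>2 \<le> (2 * A)\<^sup>2" using bd[of x] bd[of y] by (intro power_mono) auto
    ultimately have "(f x - f y)\<^sup>2 \<le> 4 * A\<^sup>2 * min 1 ((norm (x - y))\<^sup>2)"
      by (auto simp: power_mult_distrib min_def intro: order_trans[OF _ mult_right_mono[of "A\<^sup>2" "4 * A\<^sup>2"]])
    then have "frac_integrand s f f z \<le> 4 * A\<^sup>2 * min 1 ((norm (x - y))\<^sup>2) * frac_ker s (x - y)"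
      unfolding z frac_integrand_eq power2_eq_square[symmetric]
      by (intro mult_right_mono frac_ker_nonneg)
    also have "\<dots> = 4 * A\<^sup>2 * (1 * (min 1 ((norm (x - y))\<^sup>2) * frac_ker s (x - y)))" by simp
    also have "\<dots> \<le> 4 * A\<^sup>2 * lip_bound s R z"
      unfolding z lip_bound_def case_prod_conv using True
      by (intro mult_left_mono mult_right_mono) (auto simp: indicator_def frac_ker_nonneg)
    finally show ?thesis .
  qed
qed

lemma frac_integrand_nonneg: "0 \<le> frac_integrand s f f z"
  by (cases z) (simp add: frac_integrand_eq frac_ker_nonneg)

lemma lipschitz_fin_energy:
  fixes f :: "'a::euclidean_space \<Rightarrow> real"
  assumes s: "0 < s" "s < 1"
    and lip: "\<And>x y. \<bar>f x - f y\<bar> \<le> A * norm (x - y)" and bd: "\<And>x. \<bar>f x\<bar> \<le> A"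
    and van: "\<And>x. x \<notin> ball 0 R \<Longrightarrow> f x = 0"
  shows "f \<in> fin_energy s"
proof -
  have "A-lipschitz_on UNIV f"
    using lip bd[of 0] by (intro lipschitz_onI) (auto simp: dist_norm)
  then have [measurable]: "f \<in> borel_measurable borel"
    by (intro borel_measurable_continuous_onI lipschitz_on_continuous_on)
  have "integrable lborel (frac_integrand s f f)"
  proof (rule Bochner_Integration.integrable_bound)
    show "integrable lborel (\<lambda>z::'a\<times>'a. 4 * A\<^sup>2 * lip_bound s R z)"
      by (intro integrable_mult_right lip_bound_integrable[OF s])
    show "AE z in lborel. norm (frac_integrand s f f z) \<le> norm (4 * A\<^sup>2 * lip_bound s R z)"
      using order_trans[OF frac_integrand_le_lip_bound[OF lip bd van] abs_ge_self]
      by (auto simp: frac_integrand_nonneg)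
  qed simp
  then show ?thesis by (simp add: fin_energy_def)
qed

lemma frac_const_pos:
  assumes "0 < s" "s < 1"
  shows "0 < frac_const DIM('a::euclidean_space) s"
  unfolding frac_const_def using assms by (intro divide_pos_pos mult_pos_pos Gamma_real_pos) auto

lemma frac_integrand_integrable:
  assumes "f \<in> fin_energy s" "g \<in> fin_energy s"
  shows "integrable lborel (frac_integrand s f g)"
proof (rule Bochner_Integration.integrable_bound)
  show "integrable lborel (\<lambda>z. frac_integrand s f f z + frac_integrand s g g z)"
    using assms by (auto simp: fin_energy_def)
  show "frac_integrand s f g \<in> borel_measurable lborel" using assms by (auto simp: fin_energy_def)
  show "AE z in lborel. norm (frac_integrand s f g z) \<le> norm (frac_integrand s f f z + frac_integrand s g g z)"
  proof (intro AE_I2)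
    fix z :: "'a \<times> 'a"
    obtain x y where z: "z = (x, y)" by force
    have "\<bar>u * v\<bar> \<le> u * u + v * v" for u v :: real
    proof -
      have "0 \<le> (\<bar>u\<bar> - \<bar>v\<bar>)\<^sup>2" by simp
      then have "2 * (\<bar>u\<bar> * \<bar>v\<bar>) \<le> u * u + v * v" by (simp add: power2_eq_square algebra_simps)
      moreover have "0 \<le> \<bar>u\<bar> * \<bar>v\<bar>" by simp
      ultimately show ?thesis unfolding abs_mult by linarith
    qed
    then have "\<bar>(f x - f y) * (g x - g y)\<bar> * frac_ker s (x - y)
      \<le> ((f x - f y) * (f x - f y) + (g x - g y) * (g x - g y)) * frac_ker s (x - y)"
      by (intro mult_right_mono frac_ker_nonneg)
    then show "norm (frac_integrand s f g z) \<le> norm (frac_integrand s f f z + frac_integrand s g g z)"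
      using frac_integrand_nonneg[of s f z] frac_integrand_nonneg[of s g z]
      by (simp add: z frac_integrand_eq abs_mult distrib_right frac_ker_nonneg)
  qed
qed

lemma semi_inner_frac_form:
  assumes s: "0 < s" "s < 1"
  shows "semi_inner (fin_energy s) (frac_form s :: ('a::euclidean_space \<Rightarrow> real) \<Rightarrow> _)"
proof
  fix f g h :: "'a \<Rightarrow> real" and a b :: real
  assume f: "f \<in> fin_energy s" and g: "g \<in> fin_energy s"
  have e: "frac_integrand s (\<lambda>x. a * f x + b * g x) h = (\<lambda>z. a * frac_integrand s f h z + b * frac_integrand s g h z)" for h
    by (auto simp: fun_eq_iff frac_integrand_eq algebra_simps)
  have sy: "frac_integrand s h k = frac_integrand s k h" for h k :: "'a \<Rightarrow> real"
    by (auto simp: fun_eq_iff frac_integrand_eq)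
  show "frac_form s f g = frac_form s g f" unfolding frac_form_def sy[of f g] ..
  show "(\<lambda>x. a * f x + b * g x) \<in> fin_energy s"
  proof -
    let ?l = "\<lambda>x. a * f x + b * g x"
    have "integrable lborel (frac_integrand s f ?l)" "integrable lborel (frac_integrand s g ?l)"
      unfolding sy[of _ ?l] e
      by (intro Bochner_Integration.integrable_add integrable_mult_right frac_integrand_integrable f g)+
    then have "integrable lborel (frac_integrand s ?l ?l)" by (simp add: e[of ?l])
    then show ?thesis using f g by (auto simp: fin_energy_def)
  qed
  show "frac_form s (\<lambda>x. a * f x + b * g x) h = a * frac_form s f h + b * frac_form s g h"
    if "h \<in> fin_energy s"
    using frac_integrand_integrable[OF f that] frac_integrand_integrable[OF g that]
    by (simp add: frac_form_def e algebra_simps)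
next
  fix f :: "'a \<Rightarrow> real"
  show "0 \<le> frac_form s f f"
    using frac_const_pos[OF s, where 'a='a] unfolding frac_form_def
    by (intro mult_nonneg_nonneg integral_nonneg_AE AE_I2 frac_integrand_nonneg) auto
qed

section \<open>Smooth approximation\<close>

text \<open>\<open>times_cont_diff\<close> is phrased with \<open>frechet_derivative\<close>; by
  uniqueness of the derivative any explicit formula can be used instead.\<close>

lemma times_cont_diff_SucI:
  assumes "\<And>x. (f has_derivative D x) (at x)" "\<And>v. times_cont_diff k (\<lambda>x. D x v)"
  shows "times_cont_diff (Suc k) f"
  using assms frechet_derivative_at[OF assms(1)]
  by (auto simp: differentiable_def)

lemma times_cont_diff_Suc_has_derivative:
  "times_cont_diff (Suc k) f \<Longrightarrow> (f has_derivative frechet_derivative f (at x)) (at x)"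
  by (simp add: frechet_derivative_works)

lemma times_cont_diff_continuous:
  assumes "times_cont_diff k f"
  shows "continuous_on UNIV f"
proof (cases k)
  case (Suc m)
  then show ?thesis using assms
    by (auto intro!: continuous_at_imp_continuous_on differentiable_imp_continuous_within)
qed (use assms in simp)

lemma times_cont_diff_Suc_imp: "times_cont_diff (Suc k) f \<Longrightarrow> times_cont_diff k f"
proof (induction k arbitrary: f)
  case 0
  then show ?case using times_cont_diff_continuous[OF 0] by simp
next
  case (Suc k)
  then show ?case by (subst times_cont_diff.simps) (auto simp del: times_cont_diff.simps simp: times_cont_diff.simps(2)[of "Suc k"])
qed

lemma times_cont_diff_const: "times_cont_diff k (\<lambda>x::'a::euclidean_space. c)"
proof (induction k arbitrary: c)
  case (Suc k)
  show ?case by (rule times_cont_diff_SucI[of _ "\<lambda>_ _. 0"]) (auto simp: Suc)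
qed simp

lemma times_cont_diff_add:
  "times_cont_diff k f \<Longrightarrow> times_cont_diff k g \<Longrightarrow> times_cont_diff k (\<lambda>x. f x + g x)"
proof (induction k arbitrary: f g)
  case (Suc k)
  show ?case
    by (rule times_cont_diff_SucI[of _ "\<lambda>x v. frechet_derivative f (at x) v + frechet_derivative g (at x) v"])
      (use Suc in \<open>auto intro!: has_derivative_add simp: frechet_derivative_works\<close>)
qed (auto intro: continuous_on_add)

lemma times_cont_diff_mult:
  "times_cont_diff k f \<Longrightarrow> times_cont_diff k g \<Longrightarrow> times_cont_diff k (\<lambda>x. f x * g x)"
proof (induction k arbitrary: f g)
  case (Suc k)
  note fg = times_cont_diff_Suc_imp[OF Suc.prems(1)] times_cont_diff_Suc_imp[OF Suc.prems(2)]
  show ?case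
  proof (rule times_cont_diff_SucI)
    show "((\<lambda>x. f x * g x) has_derivative
      (\<lambda>v. f x * frechet_derivative g (at x) v + frechet_derivative f (at x) v * g x)) (at x)" for x
      using Suc.prems by (intro has_derivative_mult times_cont_diff_Suc_has_derivative)
    show "times_cont_diff k (\<lambda>x. f x * frechet_derivative g (at x) v + frechet_derivative f (at x) v * g x)" for v
      using Suc fg by (intro times_cont_diff_add Suc.IH) auto
  qed
qed (auto intro: continuous_on_mult)

lemma times_cont_diff_inner: "times_cont_diff k (\<lambda>x::'a::euclidean_space. (x - a) \<bullet> v)"
proof (cases k)
  case (Suc m)
  show ?thesis unfolding Suc
    by (rule times_cont_diff_SucI[of _ "\<lambda>_ w. w \<bullet> v"])
      (auto intro!: derivative_eq_intros times_cont_diff_const)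
qed (auto intro!: continuous_intros)

section \<open>Smooth bumps built from exp(-1/t)\<close>

definition flat_exp :: "nat \<Rightarrow> real \<Rightarrow> real" where
  "flat_exp j t = (if 0 < t then exp (- 1 / t) / t ^ j else 0)"

lemma flat_exp_tendsto_0: "(flat_exp j \<longlongrightarrow> 0) (at 0)"
proof (rule filterlim_split_at)
  show "(flat_exp j \<longlongrightarrow> 0) (at_left 0)"
    by (rule tendsto_eventually) (auto simp: flat_exp_def eventually_at_filter)
  have "((\<lambda>t. inverse t ^ j / exp (inverse t)) \<longlongrightarrow> 0) (at_right (0::real))"
    by (rule filterlim_compose[OF tendsto_power_div_exp_0 filterlim_inverse_at_top_right])
  then show "(flat_exp j \<longlongrightarrow> 0) (at_right 0)"
    by (rule Lim_transform_eventually)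
      (auto simp: flat_exp_def eventually_at_filter exp_minus field_simps)
qed

lemma flat_exp_deriv:
  "(flat_exp j has_real_derivative (flat_exp (j + 2) t - real j * flat_exp (j + 1) t)) (at t)"
proof -
  consider "t > 0" | "t = 0" | "t < 0" by linarith
  then show ?thesis
  proof cases
    case 1
    have "((\<lambda>t. exp (- 1 / t) / t ^ j) has_real_derivative
        (exp (- 1 / t) * (1 / t\<^sup>2) * t ^ j - exp (- 1 / t) * (real j * t ^ (j - 1))) / (t ^ j * t ^ j)) (at t)"
      using 1 by (auto intro!: derivative_eq_intros simp: power2_eq_square)
    moreover have "(exp (- 1 / t) * (1 / t\<^sup>2) * t ^ j - exp (- 1 / t) * (real j * t ^ (j - 1))) / (t ^ j * t ^ j)
      = flat_exp (j + 2) t - real j * flat_exp (j + 1) t"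
      using 1 by (cases j) (auto simp: flat_exp_def field_simps power2_eq_square)
    ultimately have "((\<lambda>t. exp (- 1 / t) / t ^ j) has_real_derivative
        (flat_exp (j + 2) t - real j * flat_exp (j + 1) t)) (at t)" by simp
    then show ?thesis
      by (rule has_field_derivative_transform_within_open[of _ _ _ "{0<..}"]) (use 1 in \<open>auto simp: flat_exp_def\<close>)
  next
    case 2
    \<comment> \<open>Away from 0 the difference quotient of \<open>flat_exp j\<close> at 0 is
      \<open>flat_exp (Suc j)\<close>, which tends to 0.\<close>
    have "((\<lambda>h. flat_exp j h / h) \<longlongrightarrow> 0) (at 0)"
      using flat_exp_tendsto_0[of "Suc j"]
      by (rule Lim_transform_eventually) (auto simp: flat_exp_def eventually_at_filter)
    then show ?thesis unfolding DERIV_def 2 by (simp add: flat_exp_def)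
  next
    case 3
    have "((\<lambda>_. 0) has_real_derivative 0) (at t)" by simp
    then have "(flat_exp j has_real_derivative 0) (at t)"
      by (rule has_field_derivative_transform_within_open[of _ _ _ "{..<0}"]) (use 3 in \<open>auto simp: flat_exp_def\<close>)
    then show ?thesis using 3 by (simp add: flat_exp_def)
  qed
qed

definition bump :: "'a::euclidean_space \<Rightarrow> real \<Rightarrow> 'a \<Rightarrow> real" where
  "bump a r z = flat_exp 0 (r\<^sup>2 - (z - a) \<bullet> (z - a))"

text \<open>The family over all \<open>j\<close> is closed under differentiation up to affine
  factors, so the induction on the order of differentiability has to leave \<open>j\<close>
  free.\<close>

lemma times_cont_diff_flat_exp:
  "times_cont_diff k (\<lambda>z::'a::euclidean_space. flat_exp j (r\<^sup>2 - (z - a) \<bullet> (z - a)))"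
proof (induction k arbitrary: j)
  have der: "((\<lambda>z. flat_exp j (r\<^sup>2 - (z - a) \<bullet> (z - a))) has_derivative
      (\<lambda>v. (flat_exp (j + 2) (r\<^sup>2 - (z - a) \<bullet> (z - a)) + (- real j) * flat_exp (j + 1) (r\<^sup>2 - (z - a) \<bullet> (z - a)))
        * ((- 2) * ((z - a) \<bullet> v)))) (at z)" for z :: 'a and j
  proof -
    have "((\<lambda>z. r\<^sup>2 - (z - a) \<bullet> (z - a)) has_derivative (\<lambda>v. (- 2) * ((z - a) \<bullet> v))) (at z)"
      by (auto intro!: derivative_eq_intros simp: inner_commute)
    from has_derivative_compose[OF this flat_exp_deriv[unfolded has_field_derivative_def]]
    show ?thesis by (simp add: mult.commute)
  qed
  {
    case 0
    show ?case
      by (simp, intro continuous_at_imp_continuous_on ballI has_derivative_continuous) (rule der)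
  next
    case (Suc k)
    show ?case
      by (rule times_cont_diff_SucI[OF der])
        (intro times_cont_diff_mult times_cont_diff_add times_cont_diff_const times_cont_diff_inner Suc)
  }
qed

lemma times_cont_diff_bump: "times_cont_diff k (bump a r)"
  using times_cont_diff_flat_exp[of k 0 r a] unfolding bump_def[abs_def] .

lemma bump_nonneg: "0 \<le> bump a r z"
  by (simp add: bump_def flat_exp_def)

lemma bump_pos_iff:
  assumes "0 < r"
  shows "0 < bump a r z \<longleftrightarrow> z \<in> ball a r"
proof -
  have "(z - a) \<bullet> (z - a) < r\<^sup>2 \<longleftrightarrow> norm (z - a) < r"
    using assms unfolding power2_norm_eq_inner[symmetric]
    by (auto intro: power2_less_imp_less power_strict_mono)
  then show ?thesis by (auto simp: bump_def flat_exp_def dist_norm norm_minus_commute)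
qed

lemma bump_eq_0: "0 < r \<Longrightarrow> z \<notin> ball a r \<Longrightarrow> bump a r z = 0"
  using bump_pos_iff[of r a z] bump_nonneg[of a r z] by linarith

lemma bump_continuous: "continuous_on S (bump a r)"
  using times_cont_diff_continuous[OF times_cont_diff_bump] continuous_on_subset by blast

lemma bump_measurable [measurable]: "bump a r \<in> borel_measurable borel"
  by (intro borel_measurable_continuous_onI bump_continuous)

text \<open>Nonempty open sets have positive measure. This is how an almost everywhere statement is
  turned into one usable point.\<close>

lemma AE_open_witness:
  fixes U :: "'a::euclidean_space set"
  assumes "open U" "U \<noteq> {}" "AE x in lborel. P x"
  obtains x where "x \<in> U" "P x"
proof -
  obtain N where N: "{x. \<not> P x} \<subseteq> N" "N \<in> sets lborel" "emeasure lborel N = 0"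
    using assms(3) by (auto elim!: AE_E simp: space_lborel)
  obtain a e where e: "0 < e" "ball a e \<subseteq> U" using assms(1,2) by (meson ex_in_conv openE)
  have "\<not> ball a e \<subseteq> N"
  proof
    assume "ball a e \<subseteq> N"
    then have "emeasure lborel (ball a e) \<le> emeasure lborel N" using N by (intro emeasure_mono) auto
    then show False using N(3) e(1) unit_ball_vol_pos[of "real DIM('a)"] by (simp add: emeasure_ball)
  qed
  then show ?thesis using that N(1) e(2) by blast
qed

lemma integrable_continuous_bounded_support:
  fixes f :: "'a::euclidean_space \<Rightarrow> real"
  assumes "continuous_on UNIV f" "\<And>x. x \<notin> cbox a b \<Longrightarrow> f x = 0"
  shows "integrable lborel f"
proof -
  have "integrable lborel (\<lambda>x. indicator (cbox a b) x *\<^sub>R f x)"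
    by (rule borel_integrable_compact[OF compact_cbox continuous_on_subset[OF assms(1)]]) simp
  moreover have "(\<lambda>x. indicator (cbox a b) x *\<^sub>R f x) = f"
    by (rule ext) (use assms(2) in \<open>auto simp: indicator_def\<close>)
  ultimately show ?thesis by (simp only:)
qed

lemma ball_subset_cbox:
  obtains u v :: "'a::euclidean_space" where "ball a r \<subseteq> cbox u v"
  using bounded_subset_cbox_symmetric[OF bounded_ball] by metis

lemma bump_integrable: "0 < r \<Longrightarrow> integrable lborel (bump a r)"
  by (metis ball_subset_cbox bump_continuous bump_eq_0 integrable_continuous_bounded_support subsetD)

lemma bump_integral_pos:
  assumes "0 < r"
  shows "0 < (LINT z|lborel. bump a r z)"
proof (rule ccontr)
  assume "\<not> 0 < (LINT z|lborel. bump a r z)"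
  moreover have "0 \<le> (LINT z|lborel. bump a r z)" by (intro integral_nonneg_AE AE_I2 bump_nonneg)
  ultimately have "(LINT z|lborel. bump a r z) = 0" by simp
  then have "AE z in lborel. bump a r z = 0"
    using integral_nonneg_eq_0_iff_AE[OF bump_integrable[OF assms, of a] AE_I2[OF bump_nonneg]] by blast
  then obtain z where "z \<in> ball a r" "bump a r z = 0"
    by (rule AE_open_witness[rotated 2, of _ "ball a r"]) (use assms in auto)
  then show False using bump_pos_iff[OF assms, of a z] by simp
qed

section \<open>Mollification of Lipschitz functions\<close>

definition mollifier :: "real \<Rightarrow> 'a::euclidean_space \<Rightarrow> real" where
  "mollifier r z = bump 0 r z * (1 / (LINT z|lborel. bump (0::'a) r z))"

text \<open>In this convolution the smooth factor carries \<open>x - t\<close> and the rough,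
  compactly supported one carries \<open>t\<close>: the domain of integration stays fixed and
  derivatives in \<open>x\<close> fall on \<open>g\<close> alone.\<close>

definition mollify :: "('a::euclidean_space \<Rightarrow> real) \<Rightarrow> ('a \<Rightarrow> real) \<Rightarrow> 'a \<Rightarrow> real" where
  "mollify f g x = (LINT t|lborel. f t * g (x - t))"

lemma mollify_eq_integral:
  assumes f: "continuous_on UNIV f" "\<And>x. x \<notin> cbox a b \<Longrightarrow> f x = 0" and g: "continuous_on UNIV g"
  shows "mollify f g x = integral (cbox a b) (\<lambda>t. f t * g (x - t))"
proof -
  have c: "continuous_on UNIV (\<lambda>t. f t * g (x - t))"
    by (intro continuous_intros f(1) continuous_on_compose2[OF g]) auto
  have "set_integrable lborel (cbox a b) (\<lambda>t. f t * g (x - t))"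
    unfolding set_integrable_def
    by (rule borel_integrable_compact) (use c continuous_on_subset in auto)
  from set_borel_integral_eq_integral(2)[OF this]
  have "integral (cbox a b) (\<lambda>t. f t * g (x - t)) = (LINT t:cbox a b|lborel. f t * g (x - t))" by simp
  also have "\<dots> = mollify f g x"
    unfolding mollify_def set_lebesgue_integral_def
    by (intro Bochner_Integration.integral_cong) (auto simp: indicator_def f(2))
  finally show ?thesis by simp
qed

text \<open>Differentiation under the integral over a fixed box. The derivative is again a
  \<open>mollify\<close>, with \<open>g\<close> replaced by a directional derivative, so the
  induction runs over all \<open>g\<close>.\<close>

lemma times_cont_diff_mollify:
  fixes f :: "'a::euclidean_space \<Rightarrow> real"
  assumes f: "continuous_on UNIV f" "\<And>x. x \<notin> cbox a b \<Longrightarrow> f x = 0" and g: "times_cont_diff k g"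
  shows "times_cont_diff k (mollify f g)"
  using g
proof (induction k arbitrary: g)
  case 0
  then have g: "continuous_on UNIV g" by simp
  have "continuous_on UNIV (\<lambda>x. integral (cbox a b) (\<lambda>t. f t * g (x - t)))"
    by (rule integral_continuous_on_param)
      (auto simp: case_prod_unfold intro!: continuous_intros continuous_on_compose2[OF f(1)] continuous_on_compose2[OF g])
  then show ?case by (simp add: mollify_eq_integral[OF f g])
next
  case (Suc k)
  let ?D = "\<lambda>z. frechet_derivative g (at z)"
  have gc: "continuous_on UNIV g" by (rule times_cont_diff_continuous[OF Suc.prems])
  have gd: "(g has_derivative ?D z) (at z)" for z by (rule times_cont_diff_Suc_has_derivative[OF Suc.prems])
  have Dc: "continuous_on UNIV (\<lambda>z. ?D z v)" for v
    using Suc.prems times_cont_diff_continuous by auto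
  \<comment> \<open>The Leibniz rule asks for a derivative that is jointly continuous as a bounded
    linear map; in finite dimension this can be checked one direction at a time.\<close>
  define F where "F x t = f t *\<^sub>R Blinfun (?D (x - t))" for x t
  have Fv: "blinfun_apply (F x t) v = f t * ?D (x - t) v" for x t v
    unfolding F_def using has_derivative_bounded_linear[OF gd]
    by (simp add: scaleR_blinfun.rep_eq bounded_linear_Blinfun_apply)
  have Fc: "continuous_on (UNIV \<times> cbox a b) (\<lambda>(x, t). F x t)"
    by (rule continuous_on_blinfun_componentwise)
      (auto simp: case_prod_unfold Fv intro!: continuous_intros continuous_on_compose2[OF f(1)] continuous_on_compose2[OF Dc])
  have der: "(mollify f g has_derivative (\<lambda>v. mollify f (\<lambda>z. ?D z v) x)) (at x)" for x
  proof -
    have "((\<lambda>x. integral (cbox a b) (\<lambda>t. f t * g (x - t))) has_derivative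
        blinfun_apply (integral (cbox a b) (F x))) (at x within UNIV)"
    proof (rule leibniz_rule[OF _ _ Fc])
      fix x t :: 'a
      have "((\<lambda>x. x - t) has_derivative (\<lambda>h. h)) (at x)" by (auto intro!: derivative_eq_intros)
      from has_derivative_compose[OF this gd]
      have "((\<lambda>x. g (x - t)) has_derivative ?D (x - t)) (at x)" .
      then show "((\<lambda>x. f t * g (x - t)) has_derivative blinfun_apply (F x t)) (at x within UNIV)"
        using has_derivative_mult_right[of "\<lambda>x. g (x - t)" "?D (x - t)" "at x" "f t"]
        by (simp add: Fv[abs_def] has_derivative_eq_rhs)
      show "(\<lambda>t. f t * g (x - t)) integrable_on cbox a b"
        by (intro integrable_continuous continuous_intros continuous_on_compose2[OF f(1)] continuous_on_compose2[OF gc]) auto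
    qed auto
    moreover have "blinfun_apply (integral (cbox a b) (F x)) = (\<lambda>v. mollify f (\<lambda>z. ?D z v) x)"
    proof
      fix v
      have "F x integrable_on cbox a b"
        by (intro integrable_continuous continuous_on_compose2[OF Fc, of _ "\<lambda>t. (x, t)", simplified]) (auto intro!: continuous_intros)
      then show "blinfun_apply (integral (cbox a b) (F x)) v = mollify f (\<lambda>z. ?D z v) x"
        by (simp add: blinfun_apply_integral mollify_eq_integral[OF f Dc] Fv)
    qed
    moreover have "mollify f g = (\<lambda>x. integral (cbox a b) (\<lambda>t. f t * g (x - t)))"
      by (rule ext) (rule mollify_eq_integral[OF f gc])
    ultimately show ?thesis by simp
  qed
  show ?case
    by (rule times_cont_diff_SucI[OF der]) (use Suc in auto)
qed

lemma mollify_swap: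
  fixes f g :: "'a::euclidean_space \<Rightarrow> real"
  assumes [measurable]: "f \<in> borel_measurable borel" "g \<in> borel_measurable borel"
  shows "mollify f g x = (LINT t|lborel. f (x - t) * g t)"
proof -
  have "lborel = distr lborel borel (\<lambda>y. x - y)"
    using lborel_affine[of "-1" x] by (simp add: density_1 one_ennreal_def[symmetric])
  then have "(LINT t|lborel. f t * g (x - t)) = (LINT t|distr lborel borel (\<lambda>y. x - y). f t * g (x - t))" by simp
  also have "\<dots> = (LINT t|lborel. f (x - t) * g t)" by (subst integral_distr) auto
  finally show ?thesis by (simp add: mollify_def)
qed

text \<open>Averaging over translates keeps the Lipschitz constant \<open>A\<close>. This uniformity
  is the point: it lets the energies of all approximants be dominated by one integrable
  function.\<close>

lemma test_function_H0s_approx: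
  fixes f :: "'a::euclidean_space \<Rightarrow> real"
  assumes "open \<Omega>" "compact K" "K \<subseteq> \<Omega>" and van: "\<And>x. x \<notin> K \<Longrightarrow> f x = 0"
    and lip: "\<And>x y. \<bar>f x - f y\<bar> \<le> A * norm (x - y)" and e0: "0 < e"
  obtains \<psi> where "test_function \<Omega> \<psi>" "\<And>x y. \<bar>\<psi> x - \<psi> y\<bar> \<le> A * norm (x - y)" "\<And>x. \<bar>\<psi> x - f x\<bar> \<le> A * e"
proof -
  obtain d where d: "0 < d" "(\<Union>x\<in>K. cball x d) \<subseteq> \<Omega>"
    using compact_subset_open_imp_cball_epsilon_subset[OF assms(2,1,3)] by blast
  \<comment> \<open>\<open>d\<close> keeps the support inside \<Omega>, \<open>e\<close> controls
    the uniform error.\<close>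
  define r where "r = min d e"
  have r: "0 < r" "r \<le> d" "r \<le> e" using d e0 by (auto simp: r_def)
  have A: "0 \<le> A"
  proof -
    obtain b :: 'a where "b \<in> Basis" by (meson nonempty_Basis ex_in_conv)
    then have "norm b = 1" by simp
    then show ?thesis using lip[of b 0] by (smt (verit) diff_zero mult_cancel_left2 abs_ge_zero)
  qed
  have fc: "continuous_on UNIV f"
  proof -
    have "A-lipschitz_on UNIV f" using lip A by (intro lipschitz_onI) (auto simp: dist_norm)
    then show ?thesis by (rule lipschitz_on_continuous_on)
  qed
  define \<eta> where "\<eta> = (mollifier r :: 'a \<Rightarrow> real)"
  define c where "c = (LINT z|lborel. bump (0::'a) r z)"
  have c: "0 < c" unfolding c_def by (rule bump_integral_pos[OF r(1)])
  have \<eta>: "\<eta> z = bump 0 r z * (1 / c)" for z by (simp add: \<eta>_def mollifier_def c_def)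
  have \<eta>n: "0 \<le> \<eta> z" for z using c bump_nonneg[of 0 r z] by (simp add: \<eta>)
  have \<eta>0: "\<eta> z = 0" if "z \<notin> ball 0 r" for z using bump_eq_0[OF r(1) that] by (simp add: \<eta>)
  have \<eta>s: "times_cont_diff k \<eta>" for k
    unfolding \<eta>[abs_def] by (intro times_cont_diff_mult times_cont_diff_bump times_cont_diff_const)
  have \<eta>c: "continuous_on UNIV \<eta>" by (rule times_cont_diff_continuous[OF \<eta>s])
  have [measurable]: "f \<in> borel_measurable borel" "\<eta> \<in> borel_measurable borel"
    using fc \<eta>c by (auto intro: borel_measurable_continuous_onI)
  have \<eta>i: "integrable lborel \<eta>" "(LINT z|lborel. \<eta> z) = 1"
    using bump_integrable[OF r(1), of "0::'a"] c by (auto simp: \<eta>[abs_def] c_def[symmetric])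
  define \<psi> where "\<psi> = mollify f \<eta>"
  \<comment> \<open>Smoothness is seen with the translation on the mollifier, the Lipschitz bound
    with the translation on \<open>f\<close>; hence the swap.\<close>
  have \<psi>: "\<psi> x = (LINT t|lborel. f (x - t) * \<eta> t)" for x
    unfolding \<psi>_def by (rule mollify_swap) measurable
  obtain u v :: 'a where uv: "ball 0 r \<subseteq> cbox u v" using ball_subset_cbox by blast
  have int: "integrable lborel (\<lambda>t. f (x - t) * \<eta> t)" for x
  proof (rule integrable_continuous_bounded_support[of _ u v])
    show "continuous_on UNIV (\<lambda>t. f (x - t) * \<eta> t)"
      by (intro continuous_intros continuous_on_compose2[OF fc] continuous_on_compose2[OF \<eta>c]) auto
    show "f (x - t) * \<eta> t = 0" if "t \<notin> cbox u v" for t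
      using \<eta>0[of t] that uv by (metis mult_zero_right subsetD)
  qed
  have 1: "\<bar>\<psi> x - \<psi> y\<bar> \<le> A * norm (x - y)" for x y
  proof -
    have "\<psi> x - \<psi> y = (LINT t|lborel. f (x - t) * \<eta> t - f (y - t) * \<eta> t)"
      unfolding \<psi> by (rule Bochner_Integration.integral_diff[symmetric]) (rule int)+
    also have "\<bar>\<dots>\<bar> \<le> (LINT t|lborel. \<bar>f (x - t) * \<eta> t - f (y - t) * \<eta> t\<bar>)"
      by (rule integral_abs_bound)
    also have "\<dots> \<le> (LINT t|lborel. (A * norm (x - y)) * \<eta> t)"
    proof (rule integral_mono)
      show "\<bar>f (x - t) * \<eta> t - f (y - t) * \<eta> t\<bar> \<le> (A * norm (x - y)) * \<eta> t" for t
        using mult_right_mono[OF lip[of "x - t" "y - t"] \<eta>n[of t]] \<eta>n[of t]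
        by (simp add: left_diff_distrib[symmetric] abs_mult)
    qed (use int \<eta>i in auto)
    also have "\<dots> = A * norm (x - y)" using \<eta>i by simp
    finally show ?thesis .
  qed
  have 2: "\<bar>\<psi> x - f x\<bar> \<le> A * e" for x
  proof -
    have "\<psi> x - f x = (LINT t|lborel. f (x - t) * \<eta> t) - (LINT t|lborel. f x * \<eta> t)"
      unfolding \<psi> using \<eta>i by simp
    also have "\<dots> = (LINT t|lborel. f (x - t) * \<eta> t - f x * \<eta> t)"
      by (rule Bochner_Integration.integral_diff[symmetric]) (use int \<eta>i in auto)
    also have "\<bar>\<dots>\<bar> \<le> (LINT t|lborel. \<bar>f (x - t) * \<eta> t - f x * \<eta> t\<bar>)"
      by (rule integral_abs_bound)
    also have "\<dots> \<le> (LINT t|lborel. (A * e) * \<eta> t)"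
    proof (rule integral_mono)
      show "\<bar>f (x - t) * \<eta> t - f x * \<eta> t\<bar> \<le> (A * e) * \<eta> t" for t
      proof (cases "t \<in> ball 0 r")
        case True
        then have "A * norm t \<le> A * e" using r A by (intro mult_left_mono) auto
        then have "\<bar>f (x - t) - f x\<bar> \<le> A * e" using lip[of "x - t" x] by simp
        from mult_right_mono[OF this \<eta>n[of t]] show ?thesis
          using \<eta>n[of t] by (simp add: left_diff_distrib[symmetric] abs_mult)
      qed (simp add: \<eta>0)
    qed (use int \<eta>i in auto)
    also have "\<dots> = A * e" using \<eta>i by simp
    finally show ?thesis .
  qed
  obtain a b where ab: "K \<subseteq> cbox a b"
    using bounded_subset_cbox_symmetric[OF compact_imp_bounded[OF assms(2)]] by metis
  define S where "S = {x + y | x y. x \<in> K \<and> y \<in> cball (0::'a) r}"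
  have Sc: "compact S" unfolding S_def using assms(2) by (intro compact_sums) auto
  have "S \<subseteq> (\<Union>x\<in>K. cball x d)" using r by (auto simp: S_def dist_norm)
  with d have S\<Omega>: "S \<subseteq> \<Omega>" by blast
  have "\<psi> x = 0" if "x \<notin> S" for x
  proof -
    have z: "f t * \<eta> (x - t) = 0" for t
    proof (rule ccontr)
      assume "f t * \<eta> (x - t) \<noteq> 0"
      then have "t \<in> K" "x - t \<in> ball 0 r" using van \<eta>0 by auto
      then have "x \<in> S" unfolding S_def by (intro CollectI exI[of _ t] exI[of _ "x - t"]) auto
      then show False using that by simp
    qed
    show ?thesis unfolding \<psi>_def mollify_def z by simp
  qed
  then have "closure {x. \<psi> x \<noteq> 0} \<subseteq> S" using Sc by (intro closure_minimal compact_imp_closed) auto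
  moreover have "times_cont_diff k \<psi>" for k
    unfolding \<psi>_def by (rule times_cont_diff_mollify[OF fc _ \<eta>s, of a b]) (use ab van in auto)
  ultimately have "test_function \<Omega> \<psi>"
    unfolding test_function_def using S\<Omega> compact_Int_closed[OF Sc closed_closure, of "{x. \<psi> x \<noteq> 0}"]
    by (auto simp: Int_absorb1)
  then show ?thesis using that 1 2 by blast
qed

text \<open>The mollifications converge uniformly with a common Lipschitz constant, so dominated
  convergence with \<open>lip_bound\<close> sends the energy of the error to 0. Through this lemma
  nonsmooth functions such as absolute values and polarizations enter the energy space.\<close>

lemma lipschitz_in_H0s:
  fixes f :: "'a::euclidean_space \<Rightarrow> real"
  assumes s: "0 < s" "s < 1" and \<Omega>: "open \<Omega>" "bounded \<Omega>" and K: "compact K" "K \<subseteq> \<Omega>"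
    and van: "\<And>x. x \<notin> K \<Longrightarrow> f x = 0"
    and lip: "\<And>x y. \<bar>f x - f y\<bar> \<le> A * norm (x - y)" and bd: "\<And>x. \<bar>f x\<bar> \<le> A"
  shows "f \<in> H0s s \<Omega>"
proof -
  obtain R where R: "\<Omega> \<subseteq> ball 0 R" using bounded_subset_ballD[OF \<Omega>(2)] by blast
  have "f x = 0" if "x \<notin> ball 0 R" for x using van that K(2) R by blast
  from lipschitz_fin_energy[OF s lip bd this] have fe: "f \<in> fin_energy s" by simp
  have A: "0 \<le> A" using bd[of 0] by linarith
  have "\<exists>\<psi>. test_function \<Omega> \<psi> \<and> (\<forall>x y. \<bar>\<psi> x - \<psi> y\<bar> \<le> A * norm (x - y)) \<and> (\<forall>x. \<bar>\<psi> x - f x\<bar> \<le> A * (1 / (real n + 1)))" for n :: nat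
    by (rule test_function_H0s_approx[OF \<Omega>(1) K van lip, of "1 / (real n + 1)"]) auto
  then obtain \<psi> where \<psi>: "\<And>n. test_function \<Omega> (\<psi> n)" "\<And>n x y. \<bar>\<psi> n x - \<psi> n y\<bar> \<le> A * norm (x - y)"
      "\<And>n x. \<bar>\<psi> n x - f x\<bar> \<le> A * (1 / (real n + 1))" by metis
  let ?g = "\<lambda>n x. \<psi> n x - f x"
  have lipg: "\<bar>?g n x - ?g n y\<bar> \<le> (2 * A) * norm (x - y)" for n x y
    using \<psi>(2)[of n x y] lip[of x y] by (simp add: algebra_simps)
  have bdg: "\<bar>?g n x\<bar> \<le> 2 * A" for n x
  proof -
    have "A * (1 / (real n + 1)) \<le> A * 2" using A by (intro mult_left_mono) (auto simp: field_simps)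
    then show ?thesis using \<psi>(3)[of n x] by simp
  qed
  have vang: "?g n x = 0" if "x \<notin> ball 0 R" for n x
  proof -
    have "x \<notin> \<Omega>" using that R by blast
    then have "\<psi> n x = 0" using \<psi>(1)[of n] closure_subset[of "{x. \<psi> n x \<noteq> 0}"] by (auto simp: test_function_def)
    then show ?thesis using van K \<open>x \<notin> \<Omega>\<close> by auto
  qed
  have fing: "?g n \<in> fin_energy s" for n by (rule lipschitz_fin_energy[OF s lipg bdg vang])
  have "(\<lambda>n. LINT z|lborel. frac_integrand s (?g n) (?g n) z) \<longlonglongrightarrow> (LINT (z::'a\<times>'a)|lborel. 0)"
  proof (rule integral_dominated_convergence)
    show "integrable lborel (\<lambda>z::'a\<times>'a. 4 * (2 * A)\<^sup>2 * lip_bound s R z)"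
      by (intro integrable_mult_right lip_bound_integrable[OF s])
    show "frac_integrand s (?g n) (?g n) \<in> borel_measurable lborel" for n
      by (rule borel_measurable_integrable) (use fing[of n] in \<open>simp add: fin_energy_def\<close>)
    show "AE z in lborel. norm (frac_integrand s (?g n) (?g n) z) \<le> 4 * (2 * A)\<^sup>2 * lip_bound s R z" for n
      using frac_integrand_le_lip_bound[OF lipg bdg vang]
      by (intro AE_I2) (simp add: frac_integrand_nonneg)
    show "AE z in lborel. (\<lambda>n. frac_integrand s (?g n) (?g n) z) \<longlonglongrightarrow> 0"
    proof (intro AE_I2)
      fix z :: "'a \<times> 'a"
      obtain x y where z: "z = (x, y)" by force
      have "(\<lambda>n. A * (1 / (real n + 1))) \<longlonglongrightarrow> A * 0"
        using LIMSEQ_inverse_real_of_nat by (intro tendsto_mult tendsto_const) (simp add: inverse_eq_divide add.commute)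
      then have l: "(\<lambda>n. ?g n x) \<longlonglongrightarrow> 0" for x
        by (intro Lim_null_comparison[of "\<lambda>n. ?g n x" "\<lambda>n. A * (1 / (real n + 1))"] always_eventually)
          (simp_all only: real_norm_def \<psi>(3) mult_zero_right simp_thms)
      have "(\<lambda>n. (?g n x - ?g n y) * (?g n x - ?g n y) * frac_ker s (x - y)) \<longlonglongrightarrow> (0 - 0) * (0 - 0) * frac_ker s (x - y)"
        by (intro tendsto_intros l)
      then show "(\<lambda>n. frac_integrand s (?g n) (?g n) z) \<longlonglongrightarrow> 0"
        by (simp add: z frac_integrand_eq)
    qed
  qed auto
  then have "(\<lambda>n. frac_quad s (?g n)) \<longlonglongrightarrow> frac_const DIM('a) s / 2 * 0"
    unfolding frac_form_def by (intro tendsto_mult tendsto_const) simp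
  then have "(\<lambda>n. frac_quad s (?g n)) \<longlonglongrightarrow> 0" by simp
  with \<psi>(1) have "\<exists>\<psi>. (\<forall>n. test_function \<Omega> (\<psi> n)) \<and>
        (\<lambda>n. frac_quad s (\<lambda>x. \<psi> n x - f x)) \<longlonglongrightarrow> 0" by (intro exI[of _ \<psi>]) simp
  moreover have "\<forall>x. x \<notin> \<Omega> \<longrightarrow> f x = 0" using van K(2) by blast
  ultimately show ?thesis using fe unfolding H0s_def fin_energy_def by simp
qed

text \<open>The derivative vanishes off the support and every directional derivative is bounded on
  it. The sum of these bounds over the basis bounds the operator norm, and the mean value inequality
  applies.\<close>

lemma test_function_lipschitz:
  fixes \<phi> :: "'a::euclidean_space \<Rightarrow> real"
  assumes "test_function \<Omega> \<phi>"
  obtains A K where "compact K" "K \<subseteq> \<Omega>" "\<And>x. x \<notin> K \<Longrightarrow> \<phi> x = 0"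
    "\<And>x y. \<bar>\<phi> x - \<phi> y\<bar> \<le> A * norm (x - y)" "\<And>x. \<bar>\<phi> x\<bar> \<le> A"
proof -
  define K where "K = closure {x. \<phi> x \<noteq> 0}"
  have K: "compact K" "K \<subseteq> \<Omega>" "\<And>x. x \<notin> K \<Longrightarrow> \<phi> x = 0"
    using assms closure_subset[of "{x. \<phi> x \<noteq> 0}"] by (auto simp: test_function_def K_def)
  have t1: "times_cont_diff (Suc 0) \<phi>" using assms unfolding test_function_def by blast
  have d: "(\<phi> has_derivative frechet_derivative \<phi> (at x)) (at x)" for x
    by (rule times_cont_diff_Suc_has_derivative[OF t1])
  have c: "continuous_on UNIV (\<lambda>x. frechet_derivative \<phi> (at x) v)" for v using t1 by simp
  have d0: "frechet_derivative \<phi> (at x) = (\<lambda>_. 0)" if "x \<notin> K" for x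
  proof -
    have "((\<lambda>_. 0) has_derivative (\<lambda>_. 0)) (at x)" by simp
    then have "(\<phi> has_derivative (\<lambda>_. 0)) (at x)"
      by (rule has_derivative_transform_within_open[of _ _ _ _ "- K"])
        (use that K compact_imp_closed in auto)
    then show ?thesis using frechet_derivative_at by metis
  qed
  have "\<exists>B. 0 \<le> B \<and> (\<forall>x. \<bar>frechet_derivative \<phi> (at x) v\<bar> \<le> B)" for v
  proof -
    have "bounded ((\<lambda>x. frechet_derivative \<phi> (at x) v) ` K)"
      by (intro compact_imp_bounded compact_continuous_image K(1) continuous_on_subset[OF c]) auto
    then obtain B where "\<forall>x\<in>K. \<bar>frechet_derivative \<phi> (at x) v\<bar> \<le> B" by (auto simp: bounded_iff)
    then have "\<bar>frechet_derivative \<phi> (at x) v\<bar> \<le> max 0 B" for x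
      using d0[of x] by (cases "x \<in> K") (auto simp: max.coboundedI2)
    then show ?thesis by (intro exI[of _ "max 0 B"]) auto
  qed
  then obtain B where B: "\<And>v. 0 \<le> B v" "\<And>v x. \<bar>frechet_derivative \<phi> (at x) v\<bar> \<le> B v" by metis
  define A1 where "A1 = (\<Sum>b\<in>Basis. B b)"
  have lip: "\<bar>\<phi> x - \<phi> y\<bar> \<le> A1 * norm (x - y)" for x y
  proof -
    have "norm (\<phi> x - \<phi> y) \<le> A1 * norm (x - y)"
    proof (rule differentiable_bound[of UNIV])
      fix z
      let ?D = "frechet_derivative \<phi> (at z)"
      have L: "bounded_linear ?D" using d by (rule has_derivative_bounded_linear)
      show "onorm ?D \<le> A1"
      proof (rule onorm_le)
        fix v :: 'a
        have "?D v = ?D (\<Sum>b\<in>Basis. (v \<bullet> b) *\<^sub>R b)" by (simp add: euclidean_representation)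
        also have "\<dots> = (\<Sum>b\<in>Basis. (v \<bullet> b) * ?D b)"
          using bounded_linear.linear[OF L] by (simp add: linear_sum linear_scale)
        also have "norm \<dots> \<le> (\<Sum>b\<in>Basis. norm v * B b)"
          by (intro sum_norm_le) (auto simp: abs_mult intro!: mult_mono Basis_le_norm B)
        also have "\<dots> = A1 * norm v" by (simp add: A1_def sum_distrib_left mult.commute)
        finally show "norm (?D v) \<le> A1 * norm v" .
      qed
    qed (use d in auto)
    then show ?thesis by simp
  qed
  have "bounded (\<phi> ` K)"
    by (intro compact_imp_bounded compact_continuous_image K(1) continuous_on_subset[OF times_cont_diff_continuous[OF t1]]) auto
  then obtain A2 where A2: "\<forall>x\<in>K. \<bar>\<phi> x\<bar> \<le> A2" by (auto simp: bounded_iff)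
  define A where "A = max A1 (max 0 A2)"
  have "\<bar>\<phi> x - \<phi> y\<bar> \<le> A * norm (x - y)" for x y
    by (rule order_trans[OF lip]) (auto simp: A_def intro!: mult_right_mono)
  moreover have "\<bar>\<phi> x\<bar> \<le> A" for x
    using A2 K(3)[of x] by (cases "x \<in> K") (auto simp: A_def max.coboundedI2)
  ultimately show ?thesis using that K by blast
qed

section \<open>The energy space\<close>

text \<open>A class between the test functions and \<open>H0s\<close> that, unlike the test
  functions, is stable under absolute values and polarization. One constant \<open>A\<close> serves
  both as Lipschitz constant and as bound.\<close>

definition lip0 :: "'a::euclidean_space set \<Rightarrow> ('a \<Rightarrow> real) set" where
  "lip0 \<Omega> = {f. \<exists>A K. compact K \<and> K \<subseteq> \<Omega> \<and> (\<forall>x. x \<notin> K \<longrightarrow> f x = 0) \<and>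
     (\<forall>x y. \<bar>f x - f y\<bar> \<le> A * norm (x - y)) \<and> (\<forall>x. \<bar>f x\<bar> \<le> A)}"

lemma lip0_subset_H0s:
  assumes "0 < s" "s < 1" "open \<Omega>" "bounded \<Omega>"
  shows "lip0 \<Omega> \<subseteq> H0s s \<Omega>"
  using lipschitz_in_H0s[OF assms] unfolding lip0_def by blast

lemma test_function_lip0: "test_function \<Omega> f \<Longrightarrow> f \<in> lip0 \<Omega>"
  by (erule test_function_lipschitz) (auto simp: lip0_def)

lemma lip0_lincomb:
  assumes "f \<in> lip0 \<Omega>" "g \<in> lip0 \<Omega>"
  shows "(\<lambda>x. a * f x + b * g x) \<in> lip0 \<Omega>"
proof -
  obtain A K where f: "compact K" "K \<subseteq> \<Omega>" "\<And>x. x \<notin> K \<Longrightarrow> f x = 0"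
      "\<And>x y. \<bar>f x - f y\<bar> \<le> A * norm (x - y)" "\<And>x. \<bar>f x\<bar> \<le> A"
    using assms(1) unfolding lip0_def by blast
  obtain B L where g: "compact L" "L \<subseteq> \<Omega>" "\<And>x. x \<notin> L \<Longrightarrow> g x = 0"
      "\<And>x y. \<bar>g x - g y\<bar> \<le> B * norm (x - y)" "\<And>x. \<bar>g x\<bar> \<le> B"
    using assms(2) unfolding lip0_def by blast
  have "\<bar>(a * f x + b * g x) - (a * f y + b * g y)\<bar> \<le> (\<bar>a\<bar> * A + \<bar>b\<bar> * B) * norm (x - y)" for x y
  proof -
    have "\<bar>(a * f x + b * g x) - (a * f y + b * g y)\<bar> = \<bar>a * (f x - f y) + b * (g x - g y)\<bar>"
      by (simp add: algebra_simps)
    also have "\<dots> \<le> \<bar>a\<bar> * \<bar>f x - f y\<bar> + \<bar>b\<bar> * \<bar>g x - g y\<bar>"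
      by (metis abs_mult abs_triangle_ineq)
    also have "\<dots> \<le> \<bar>a\<bar> * (A * norm (x - y)) + \<bar>b\<bar> * (B * norm (x - y))"
      by (intro add_mono mult_left_mono f g) auto
    finally show ?thesis by (simp add: algebra_simps)
  qed
  moreover have "\<bar>a * f x + b * g x\<bar> \<le> \<bar>a\<bar> * A + \<bar>b\<bar> * B" for x
  proof -
    have "\<bar>a * f x + b * g x\<bar> \<le> \<bar>a\<bar> * \<bar>f x\<bar> + \<bar>b\<bar> * \<bar>g x\<bar>" by (metis abs_mult abs_triangle_ineq)
    also have "\<dots> \<le> \<bar>a\<bar> * A + \<bar>b\<bar> * B" by (intro add_mono mult_left_mono f g) auto
    finally show ?thesis .
  qed
  ultimately show ?thesis unfolding lip0_def
    using f(1-3) g(1-3) by (intro CollectI exI[of _ "\<bar>a\<bar> * A + \<bar>b\<bar> * B"] exI[of _ "K \<union> L"]) auto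
qed

lemma lip0_abs:
  assumes "f \<in> lip0 \<Omega>"
  shows "(\<lambda>x. \<bar>f x\<bar>) \<in> lip0 \<Omega>"
proof -
  obtain A K where f: "compact K" "K \<subseteq> \<Omega>" "\<And>x. x \<notin> K \<Longrightarrow> f x = 0"
      "\<And>x y. \<bar>f x - f y\<bar> \<le> A * norm (x - y)" "\<And>x. \<bar>f x\<bar> \<le> A"
    using assms(1) unfolding lip0_def by blast
  have "\<bar>\<bar>f x\<bar> - \<bar>f y\<bar>\<bar> \<le> A * norm (x - y)" for x y using f(4)[of x y] by linarith
  then show ?thesis unfolding lip0_def using f by (intro CollectI exI[of _ A] exI[of _ K]) auto
qed

section \<open>The L2 form, the extended energy and the Poincare inequality\<close>

definition sq_int :: "('a::euclidean_space \<Rightarrow> real) set" where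
  "sq_int = {f. f \<in> borel_measurable borel \<and> integrable lborel (\<lambda>x. f x * f x)}"

definition l2_form :: "('a::euclidean_space \<Rightarrow> real) \<Rightarrow> ('a \<Rightarrow> real) \<Rightarrow> real" where
  "l2_form f g = (LINT x|lborel. f x * g x)"

abbreviation l2_quad :: "('a::euclidean_space \<Rightarrow> real) \<Rightarrow> real" where
  "l2_quad f \<equiv> l2_form f f"

lemma sq_int_mult_integrable:
  assumes "f \<in> sq_int" "g \<in> sq_int"
  shows "integrable lborel (\<lambda>x. f x * g x)"
proof (rule Bochner_Integration.integrable_bound)
  have [measurable]: "f \<in> borel_measurable borel" "g \<in> borel_measurable borel"
    using assms by (auto simp: sq_int_def)
  show "integrable lborel (\<lambda>x. f x * f x + g x * g x)" using assms by (auto simp: sq_int_def)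
  show "(\<lambda>x. f x * g x) \<in> borel_measurable lborel" by simp
  have "\<bar>u * v\<bar> \<le> \<bar>u * u + v * v\<bar>" for u v :: real
  proof -
    have "0 \<le> (\<bar>u\<bar> - \<bar>v\<bar>)\<^sup>2" by simp
    then have "2 * (\<bar>u\<bar> * \<bar>v\<bar>) \<le> u * u + v * v" by (simp add: power2_eq_square algebra_simps)
    moreover have "0 \<le> \<bar>u\<bar> * \<bar>v\<bar>" by simp
    ultimately show ?thesis unfolding abs_mult by linarith
  qed
  then show "AE x in lborel. norm (f x * g x) \<le> norm (f x * f x + g x * g x)" by simp
qed

lemma semi_inner_l2_form: "semi_inner sq_int (l2_form :: ('a::euclidean_space \<Rightarrow> real) \<Rightarrow> _)"
proof
  fix f g h :: "'a \<Rightarrow> real" and a b :: real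
  assume f: "f \<in> sq_int" and g: "g \<in> sq_int"
  have e: "(\<lambda>x. (a * f x + b * g x) * h x) = (\<lambda>x. a * (f x * h x) + b * (g x * h x))" for h :: "'a \<Rightarrow> real"
    by (auto simp: algebra_simps)
  show "l2_form f g = l2_form g f" unfolding l2_form_def by (simp add: mult.commute)
  show "(\<lambda>x. a * f x + b * g x) \<in> sq_int"
  proof -
    have "(\<lambda>x. (a * f x + b * g x) * (a * f x + b * g x)) =
      (\<lambda>x. a\<^sup>2 * (f x * f x) + (2 * a * b) * (f x * g x) + b\<^sup>2 * (g x * g x))"
      by (auto simp: algebra_simps power2_eq_square)
    moreover have "integrable lborel (\<lambda>x. a\<^sup>2 * (f x * f x) + (2 * a * b) * (f x * g x) + b\<^sup>2 * (g x * g x))"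
      by (intro Bochner_Integration.integrable_add integrable_mult_right sq_int_mult_integrable f g)
    ultimately show ?thesis using f g by (auto simp: sq_int_def)
  qed
  show "l2_form (\<lambda>x. a * f x + b * g x) h = a * l2_form f h + b * l2_form g h" if "h \<in> sq_int"
    unfolding l2_form_def e
    using sq_int_mult_integrable[OF f that] sq_int_mult_integrable[OF g that] by simp
next
  fix f :: "'a \<Rightarrow> real"
  show "0 \<le> l2_form f f" unfolding l2_form_def by (intro integral_nonneg_AE) auto
qed

text \<open>With values in \<open>ennreal\<close>, so that Fatou's lemma applies before
  integrability is known; integrability is then a consequence of finiteness.\<close>

definition frac_energy :: "real \<Rightarrow> ('a::euclidean_space \<Rightarrow> real) \<Rightarrow> ennreal" where
  "frac_energy s f = (\<integral>\<^sup>+z. ennreal (frac_integrand s f f z) \<partial>lborel)"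

lemma fin_energy_iff:
  "f \<in> fin_energy s \<longleftrightarrow> f \<in> borel_measurable borel \<and> frac_energy s f < \<infinity>"
proof (cases "f \<in> borel_measurable borel")
  case True
  then have "frac_integrand s f f \<in> borel_measurable lborel" by simp
  moreover have "ennreal (norm (frac_integrand s f f z)) = ennreal (frac_integrand s f f z)" for z
    by (simp add: frac_integrand_nonneg)
  ultimately show ?thesis using True by (simp add: fin_energy_def frac_energy_def integrable_iff_bounded del: real_norm_def)
qed (simp add: fin_energy_def)

lemma frac_energy_eq:
  fixes f :: "'a::euclidean_space \<Rightarrow> real"
  assumes s: "0 < s" "s < 1" and f: "f \<in> fin_energy s"
  shows "frac_energy s f = ennreal (2 / frac_const DIM('a) s * frac_form s f f)"
proof -
  have "frac_energy s f = ennreal (LINT z|lborel. frac_integrand s f f z)"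
    unfolding frac_energy_def using f
    by (intro nn_integral_eq_integral) (auto simp: fin_energy_def frac_integrand_nonneg)
  then show ?thesis using frac_const_pos[OF s, where 'a='a] by (simp add: frac_form_def)
qed

lemma energy_fatou:
  fixes u :: "nat \<Rightarrow> 'a::euclidean_space \<Rightarrow> real"
  assumes u: "\<And>n. u n \<in> borel_measurable borel" and lim: "AE x in lborel. (\<lambda>n. u n x) \<longlonglongrightarrow> w x"
    and bd: "\<forall>\<^sub>F n in sequentially. frac_energy s (u n) \<le> c"
  shows "frac_energy s w \<le> c"
proof -
  have "frac_energy s w = (\<integral>\<^sup>+z. liminf (\<lambda>n. ennreal (frac_integrand s (u n) (u n) z)) \<partial>lborel)"
    unfolding frac_energy_def
  proof (rule nn_integral_cong_AE)
    from AE_product[OF lim]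
    show "AE z in lborel. ennreal (frac_integrand s w w z) = liminf (\<lambda>n. ennreal (frac_integrand s (u n) (u n) z))"
    proof eventually_elim
      case (elim z)
      obtain x y where z: "z = (x, y)" by force
      have "(\<lambda>n. (u n x - u n y) * (u n x - u n y) * frac_ker s (x - y)) \<longlonglongrightarrow> (w x - w y) * (w x - w y) * frac_ker s (x - y)"
        using elim by (intro tendsto_intros) (auto simp: z)
      then have "(\<lambda>n. ennreal (frac_integrand s (u n) (u n) z)) \<longlonglongrightarrow> ennreal (frac_integrand s w w z)"
        by (intro tendsto_ennrealI) (simp add: z frac_integrand_eq)
      then show ?case by (intro lim_imp_Liminf[symmetric]) auto
    qed
  qed
  also have "\<dots> \<le> liminf (\<lambda>n. frac_energy s (u n))"
    unfolding frac_energy_def using u by (intro nn_integral_liminf) auto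
  also have "\<dots> \<le> liminf (\<lambda>n::nat. c)" by (rule Liminf_mono[OF bd])
  finally show ?thesis by (simp add: Liminf_const)
qed

text \<open>For x in the unit ball and y in a fixed ball \<open>S\<close> away from it,
  \<open>f\<close> vanishes at y and the kernel is bounded below. The energy density over such pairs
  alone integrates to a multiple of the squared L2 norm. All domains considered lie in the unit
  ball, so one constant serves them all.\<close>

lemma poincare:
  assumes s: "0 < s" "s < 1"
  obtains C where "0 \<le> C" "\<And>f :: 'a::euclidean_space \<Rightarrow> real. f \<in> fin_energy s \<Longrightarrow>
    (\<And>x. x \<notin> ball 0 1 \<Longrightarrow> f x = 0) \<Longrightarrow> f \<in> sq_int \<and> l2_form f f \<le> C * frac_form s f f"
proof -
  obtain b :: 'a where b: "b \<in> Basis" by (meson nonempty_Basis ex_in_conv)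
  define p where "p = real DIM('a) + 2 * s"
  have p: "0 < p" using s by (simp add: p_def add_nonneg_pos)
  \<comment> \<open>Points of \<open>S\<close> have norm above 2, hence lie outside the unit ball,
    and are at distance at most 5 from its points; this is the 5 in \<open>k\<close>.\<close>
  define S where "S = ball (3 *\<^sub>R b) 1"
  have [measurable]: "S \<in> sets borel" by (simp add: S_def)
  define V where "V = unit_ball_vol (real DIM('a))"
  have V: "0 < V" "emeasure lborel S = ennreal V"
    by (auto simp: V_def S_def emeasure_ball)
  define k where "k = 1 / 5 powr p"
  have k: "0 < k" by (simp add: k_def)
  define C where "C = 1 / (k * V) * (2 / frac_const DIM('a) s)"
  have C: "0 \<le> C" using k V frac_const_pos[OF s, where 'a='a] by (simp add: C_def)
  have "f \<in> sq_int \<and> l2_form f f \<le> C * frac_form s f f"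
    if f: "f \<in> fin_energy s" and van: "\<And>x. x \<notin> ball 0 1 \<Longrightarrow> f x = 0" for f :: "'a \<Rightarrow> real"
  proof -
    have [measurable]: "f \<in> borel_measurable borel" using f by (simp add: fin_energy_def)
    have key: "f x * f x * k * indicator S y \<le> frac_integrand s f f (x, y)" for x y
    proof (cases "x \<in> ball 0 1 \<and> y \<in> S")
      case False
      then show ?thesis using van frac_integrand_nonneg[of s f "(x, y)"] by (auto simp: indicator_def)
    next
      case True
      have y: "norm (y - 3 *\<^sub>R b) < 1" using True by (simp add: S_def dist_norm norm_minus_commute)
      have n3: "norm (3 *\<^sub>R b) = 3" using b by simp
      have "norm (3 *\<^sub>R b) \<le> norm y + norm (y - 3 *\<^sub>R b)" by (metis add.commute norm_minus_commute norm_triangle_sub)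
      then have "2 < norm y" using y n3 by linarith
      then have fy: "f y = 0" using van by simp
      have "norm y \<le> norm (y - 3 *\<^sub>R b) + norm (3 *\<^sub>R b)" by (metis add.commute norm_triangle_sub)
      then have "norm (x - y) \<le> 5" using y n3 True norm_triangle_ineq4[of x y] by simp
      moreover have xy: "x \<noteq> y" using True \<open>2 < norm y\<close> by auto
      ultimately have "norm (x - y) powr p \<le> 5 powr p" using p by (intro powr_mono2) auto
      then have "k \<le> frac_ker s (x - y)" unfolding k_def frac_ker_def p_def[symmetric]
        using xy by (intro divide_left_mono) auto
      then have "f x * f x * k \<le> f x * f x * frac_ker s (x - y)" by (intro mult_left_mono) auto
      then show ?thesis using True fy by (simp add: frac_integrand_eq)
    qed
    have "(\<integral>\<^sup>+x. ennreal (f x * f x) \<partial>lborel) * ennreal (k * V)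
        = (\<integral>\<^sup>+x. \<integral>\<^sup>+y. ennreal (f x * f x * k) * indicator S y \<partial>lborel \<partial>lborel)"
      using k V by (simp add: nn_integral_cmult_indicator ennreal_mult'[symmetric] ennreal_mult''[symmetric] nn_integral_multc[symmetric] mult.assoc)
    also have "\<dots> \<le> (\<integral>\<^sup>+x. \<integral>\<^sup>+y. ennreal (frac_integrand s f f (x, y)) \<partial>lborel \<partial>lborel)"
    proof (intro nn_integral_mono)
      fix x y
      show "ennreal (f x * f x * k) * indicator S y \<le> ennreal (frac_integrand s f f (x, y))"
        using ennreal_leI[OF key[of x y]] by (auto simp: indicator_def)
    qed
    also have "\<dots> = frac_energy s f" unfolding frac_energy_def by (subst nn_integral_product) simp_all
    also have "\<dots> = ennreal (2 / frac_const DIM('a) s * frac_form s f f)" by (rule frac_energy_eq[OF s f])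
    finally have *: "(\<integral>\<^sup>+x. ennreal (f x * f x) \<partial>lborel) * ennreal (k * V) \<le> ennreal (2 / frac_const DIM('a) s * frac_form s f f)" .
    have fin: "(\<integral>\<^sup>+x. ennreal (f x * f x) \<partial>lborel) < \<infinity>"
    proof (rule ccontr)
      assume "\<not> ?thesis"
      then have "(\<integral>\<^sup>+x. ennreal (f x * f x) \<partial>lborel) = top" by (simp add: not_less top_unique)
      then show False using * k V by (simp add: ennreal_top_mult top_unique)
    qed
    have sq: "integrable lborel (\<lambda>x. f x * f x)"
      by (rule integrableI_nonneg) (use fin in auto)
    then have "(\<integral>\<^sup>+x. ennreal (f x * f x) \<partial>lborel) = ennreal (l2_form f f)"
      unfolding l2_form_def by (intro nn_integral_eq_integral) auto
    moreover have nn: "0 \<le> l2_form f f" unfolding l2_form_def by (intro integral_nonneg_AE) auto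
    moreover have "0 \<le> 2 / frac_const DIM('a) s * frac_form s f f"
      using frac_const_pos[OF s, where 'a='a] semi_inner.nonneg[OF semi_inner_frac_form[OF s] f] by simp
    ultimately have "l2_form f f * (k * V) \<le> 2 / frac_const DIM('a) s * frac_form s f f"
      using * k V by (simp add: ennreal_mult'[symmetric])
    then have "l2_form f f \<le> (2 / frac_const DIM('a) s * frac_form s f f) / (k * V)"
      using k V by (simp only: pos_le_divide_eq mult_pos_pos)
    then have "l2_form f f \<le> C * frac_form s f f" by (simp add: C_def mult_ac)
    then show ?thesis using sq by (simp add: sq_int_def)
  qed
  then show ?thesis using that C by blast
qed

section \<open>Linear structure and completeness of the energy space\<close>

lemma H0s_fin_energy: "f \<in> H0s s \<Omega> \<Longrightarrow> f \<in> fin_energy s"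
  by (simp add: H0s_def fin_energy_def)

lemma H0s_vanish: "f \<in> H0s s \<Omega> \<Longrightarrow> x \<notin> \<Omega> \<Longrightarrow> f x = 0"
  by (simp add: H0s_def)

lemma H0s_approx:
  assumes "f \<in> H0s s \<Omega>"
  obtains \<psi> where "\<And>n. \<psi> n \<in> lip0 \<Omega>"
    "(\<lambda>n. frac_quad s (\<lambda>x. \<psi> n x - f x)) \<longlonglongrightarrow> 0"
  using assms test_function_lip0 unfolding H0s_def by blast

text \<open>Each approximant is replaced by a test function within energy 1 / (n + 1) of it. Linear
  combinations, reflections and limits are brought back into \<open>H0s\<close> by this
  lemma.\<close>

lemma H0s_closed:
  fixes f :: "'a::euclidean_space \<Rightarrow> real"
  assumes s: "0 < s" "s < 1" and f: "f \<in> fin_energy s" "\<And>x. x \<notin> \<Omega> \<Longrightarrow> f x = 0"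
    and u: "\<And>n. u n \<in> H0s s \<Omega>" "(\<lambda>n. frac_quad s (\<lambda>x. u n x - f x)) \<longlonglongrightarrow> 0"
    and \<Omega>: "open \<Omega>" "bounded \<Omega>"
  shows "f \<in> H0s s \<Omega>"
proof -
  interpret E: semi_inner "fin_energy s" "frac_form s :: ('a \<Rightarrow> real) \<Rightarrow> _" by (rule semi_inner_frac_form[OF s])
  have "\<exists>\<psi>. test_function \<Omega> \<psi> \<and> frac_quad s (\<lambda>x. \<psi> x - u n x) < 1 / (real n + 1)" for n :: nat
  proof -
    obtain \<psi> :: "nat \<Rightarrow> 'a \<Rightarrow> real" where \<psi>: "\<forall>k. test_function \<Omega> (\<psi> k)"
      "(\<lambda>k. frac_quad s (\<lambda>x. \<psi> k x - u n x)) \<longlonglongrightarrow> 0"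
      using u(1)[of n] by (auto simp: H0s_def)
    have "\<forall>\<^sub>F k in sequentially. frac_quad s (\<lambda>x. \<psi> k x - u n x) < 1 / (real n + 1)"
      by (rule order_tendstoD(2)[OF \<psi>(2)]) simp
    then show ?thesis using \<psi>(1) by (auto simp: eventually_sequentially)
  qed
  then obtain \<psi> where \<psi>: "\<And>n. test_function \<Omega> (\<psi> n)"
      "\<And>n. frac_quad s (\<lambda>x. \<psi> n x - u n x) < 1 / (real n + 1)" by metis
  have \<psi>F: "\<psi> n \<in> fin_energy s" for n
    using test_function_lip0[OF \<psi>(1)] lip0_subset_H0s[OF s \<Omega>] H0s_fin_energy by blast
  have uF: "u n \<in> fin_energy s" for n using u(1) H0s_fin_energy by blast
  have "(\<lambda>n. frac_quad s (\<lambda>x. \<psi> n x - f x)) \<longlonglongrightarrow> 0"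
  proof (rule tendsto_sandwich[OF _ _ tendsto_const])
    have "(\<lambda>n. 2 * (1 / (real n + 1)) + 2 * frac_quad s (\<lambda>x. u n x - f x)) \<longlonglongrightarrow> 2 * 0 + 2 * 0"
      using LIMSEQ_inverse_real_of_nat
      by (intro tendsto_add tendsto_mult tendsto_const u(2)) (simp add: inverse_eq_divide add.commute)
    then show "(\<lambda>n. 2 * (1 / (real n + 1)) + 2 * frac_quad s (\<lambda>x. u n x - f x)) \<longlonglongrightarrow> 0" by simp
    show "\<forall>\<^sub>F n in sequentially. 0 \<le> frac_quad s (\<lambda>x. \<psi> n x - f x)"
      by (intro always_eventually allI E.nonneg E.diff_in \<psi>F f)
    show "\<forall>\<^sub>F n in sequentially. frac_quad s (\<lambda>x. \<psi> n x - f x)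
        \<le> 2 * (1 / (real n + 1)) + 2 * frac_quad s (\<lambda>x. u n x - f x)"
    proof (intro always_eventually allI)
      fix n
      show "frac_quad s (\<lambda>x. \<psi> n x - f x)
        \<le> 2 * (1 / (real n + 1)) + 2 * frac_quad s (\<lambda>x. u n x - f x)"
        using E.triangle[OF \<psi>F uF f(1), of n n] \<psi>(2)[of n] by linarith
    qed
  qed
  with \<psi>(1) have "\<exists>\<psi>. (\<forall>n. test_function \<Omega> (\<psi> n)) \<and>
        (\<lambda>n. frac_quad s (\<lambda>x. \<psi> n x - f x)) \<longlonglongrightarrow> 0" by (intro exI[of _ \<psi>]) simp
  then show ?thesis using f unfolding H0s_def fin_energy_def by simp
qed

lemma H0s_lincomb:
  fixes f g :: "'a::euclidean_space \<Rightarrow> real"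
  assumes s: "0 < s" "s < 1" and \<Omega>: "open \<Omega>" "bounded \<Omega>" and f: "f \<in> H0s s \<Omega>" and g: "g \<in> H0s s \<Omega>"
  shows "(\<lambda>x. a * f x + b * g x) \<in> H0s s \<Omega>"
proof -
  interpret E: semi_inner "fin_energy s" "frac_form s :: ('a \<Rightarrow> real) \<Rightarrow> _" by (rule semi_inner_frac_form[OF s])
  obtain \<phi> where \<phi>: "\<And>n. \<phi> n \<in> lip0 \<Omega>"
    "(\<lambda>n. frac_quad s (\<lambda>x. \<phi> n x - f x)) \<longlonglongrightarrow> 0" using H0s_approx[OF f] by blast
  obtain \<psi> where \<psi>: "\<And>n. \<psi> n \<in> lip0 \<Omega>"
    "(\<lambda>n. frac_quad s (\<lambda>x. \<psi> n x - g x)) \<longlonglongrightarrow> 0" using H0s_approx[OF g] by blast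
  have F: "f \<in> fin_energy s" "g \<in> fin_energy s" using f g H0s_fin_energy by auto
  have F1: "\<phi> n \<in> fin_energy s" "\<psi> n \<in> fin_energy s" for n
    using \<phi>(1)[of n] \<psi>(1)[of n] lip0_subset_H0s[OF s \<Omega>] H0s_fin_energy by blast+
  let ?p = "\<lambda>n x. \<phi> n x - f x" and ?q = "\<lambda>n x. \<psi> n x - g x"
  have F2: "?p n \<in> fin_energy s" "?q n \<in> fin_energy s" for n using E.diff_in F F1 by auto
  have eq: "(\<lambda>x. (a * \<phi> n x + b * \<psi> n x) - (a * f x + b * g x)) = (\<lambda>x. a * ?p n x + b * ?q n x)" for n
    by (auto simp: algebra_simps)
  have "(\<lambda>n. frac_quad s (\<lambda>x. a * ?p n x + b * ?q n x)) \<longlonglongrightarrow> 0"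
  proof (rule tendsto_sandwich[OF _ _ tendsto_const])
    have "(\<lambda>n. 2 * a\<^sup>2 * frac_quad s (?p n) + 2 * b\<^sup>2 * frac_quad s (?q n)) \<longlonglongrightarrow> 2 * a\<^sup>2 * 0 + 2 * b\<^sup>2 * 0"
      by (intro tendsto_intros \<phi> \<psi>)
    then show "(\<lambda>n. 2 * a\<^sup>2 * frac_quad s (?p n) + 2 * b\<^sup>2 * frac_quad s (?q n)) \<longlonglongrightarrow> 0" by simp
    show "\<forall>\<^sub>F n in sequentially. 0 \<le> frac_quad s (\<lambda>x. a * ?p n x + b * ?q n x)"
      by (intro always_eventually allI E.nonneg E.lincomb F2)
    show "\<forall>\<^sub>F n in sequentially. frac_quad s (\<lambda>x. a * ?p n x + b * ?q n x)
      \<le> 2 * a\<^sup>2 * frac_quad s (?p n) + 2 * b\<^sup>2 * frac_quad s (?q n)"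
    proof (intro always_eventually allI)
      fix n
      \<comment> \<open>The expansion with \<open>- b\<close> is nonnegative; adding it removes the
        mixed term.\<close>
      have "0 \<le> frac_quad s (\<lambda>x. a * ?p n x + (- b) * ?q n x)"
        by (intro E.nonneg E.lincomb F2)
      then show "frac_quad s (\<lambda>x. a * ?p n x + b * ?q n x)
        \<le> 2 * a\<^sup>2 * frac_quad s (?p n) + 2 * b\<^sup>2 * frac_quad s (?q n)"
        using E.expand[OF F2, of a n b n] E.expand[OF F2, of a n "- b" n] by simp
    qed
  qed
  then have lim: "(\<lambda>n. frac_quad s (\<lambda>x. (a * \<phi> n x + b * \<psi> n x) - (a * f x + b * g x))) \<longlonglongrightarrow> 0" unfolding eq .
  show ?thesis
  proof (rule H0s_closed[OF s _ _ _ lim \<Omega>])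
    show "(\<lambda>x. a * f x + b * g x) \<in> fin_energy s" by (rule E.lincomb[OF F])
    show "a * f x + b * g x = 0" if "x \<notin> \<Omega>" for x using H0s_vanish[OF f that] H0s_vanish[OF g that] by simp
    show "(\<lambda>x. a * \<phi> n x + b * \<psi> n x) \<in> H0s s \<Omega>" for n
      using lip0_lincomb[OF \<phi>(1) \<psi>(1)] lip0_subset_H0s[OF s \<Omega>] by blast
  qed
qed

text \<open>A Riesz-Fischer argument: a fast subsequence converges almost everywhere because its
  increments are summable in L1, and Fatou's lemma turns the Cauchy property into convergence in
  energy to the pointwise limit.\<close>

lemma H0s_complete:
  fixes u :: "nat \<Rightarrow> 'a::euclidean_space \<Rightarrow> real"
  assumes s: "0 < s" "s < 1" and \<Omega>: "open \<Omega>" "\<Omega> \<subseteq> ball 0 1" and u: "\<And>n. u n \<in> H0s s \<Omega>"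
    and cau: "\<And>e. 0 < e \<Longrightarrow> \<exists>N. \<forall>j\<ge>N. \<forall>k\<ge>N. frac_quad s (\<lambda>x. u j x - u k x) < e"
  shows "\<exists>w\<in>H0s s \<Omega>. (\<lambda>n. frac_quad s (\<lambda>x. u n x - w x)) \<longlonglongrightarrow> 0"
proof -
  interpret E: semi_inner "fin_energy s" "frac_form s :: ('a \<Rightarrow> real) \<Rightarrow> _" by (rule semi_inner_frac_form[OF s])
  have b\<Omega>: "bounded \<Omega>" using \<Omega>(2) bounded_ball bounded_subset by blast
  obtain C where C: "0 \<le> C" "\<And>f :: 'a \<Rightarrow> real. f \<in> fin_energy s \<Longrightarrow>
    (\<And>x. x \<notin> ball 0 1 \<Longrightarrow> f x = 0) \<Longrightarrow> f \<in> sq_int \<and> l2_form f f \<le> C * frac_form s f f"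
    using poincare[OF s] by metis
  have uF: "u n \<in> fin_energy s" for n using u H0s_fin_energy by blast
  have u0: "u n x = 0" if "x \<notin> ball 0 1" for n x using H0s_vanish[OF u] that \<Omega>(2) by blast
  have um [measurable]: "u n \<in> borel_measurable borel" for n using uF by (simp add: fin_energy_def)
  have "\<forall>i. \<exists>N. \<forall>j\<ge>N. \<forall>k\<ge>N. frac_quad s (\<lambda>x. u j x - u k x) < (1/4)^i"
    using cau by simp
  then obtain N where N: "\<And>i j k. j \<ge> N i \<Longrightarrow> k \<ge> N i \<Longrightarrow> frac_quad s (\<lambda>x. u j x - u k x) < (1/4)^i"
    by metis
  \<comment> \<open>Both \<open>r k\<close> and \<open>r (Suc k)\<close> are at least
    \<open>N k\<close>, so consecutive terms differ in energy by less than (1/4)^k;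
    \<open>k \<le> r k\<close> puts late terms of the subsequence into the Cauchy tail.\<close>
  define r where "r k = k + (\<Sum>i\<le>k. N i)" for k :: nat
  have r1: "N k \<le> r k" "k \<le> r k" "N k \<le> r (Suc k)" for k
    using member_le_sum[of k "{..k}" N] by (auto simp: r_def)
  define d where "d k x = u (r (Suc k)) x - u (r k) x" for k x
  have dF: "d k \<in> fin_energy s" for k unfolding d_def[abs_def] by (rule E.diff_in[OF uF uF])
  have dm [measurable]: "d k \<in> borel_measurable borel" for k using dF by (simp add: fin_energy_def)
  have d0: "d k x = 0" if "x \<notin> ball 0 1" for k x using u0[OF that] by (simp add: d_def)
  have dL: "d k \<in> sq_int" "l2_quad (d k) \<le> C * (1/4)^k" for k
  proof -
    have "frac_quad s (d k) \<le> (1/4)^k" using N[OF r1(3) r1(1), of k] by (simp add: d_def[abs_def])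
    then have "C * frac_quad s (d k) \<le> C * (1/4)^k" using C(1) by (rule mult_left_mono)
    then show "d k \<in> sq_int" "l2_quad (d k) \<le> C * (1/4)^k" using C(2)[OF dF d0, of k] by auto
  qed
  define V where "V = unit_ball_vol (real DIM('a))"
  have V: "0 \<le> V" "emeasure lborel (ball (0::'a) 1) = ennreal V" by (auto simp: V_def emeasure_ball)
  have L1: "(\<integral>\<^sup>+x. ennreal \<bar>d k x\<bar> \<partial>lborel) \<le> ennreal ((C + V) * (1/2)^k)" for k
  proof -
    \<comment> \<open>Weighted arithmetic-geometric mean. The squared L2 norm of the increment is of
      order 4^(-k), so both terms integrate to order 2^(-k) over the unit ball.\<close>
    have pt: "\<bar>d k x\<bar> \<le> 2^k * (d k x * d k x) + (1/2)^k * indicator (ball 0 1) x" for x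
    proof (cases "x \<in> ball 0 1")
      case True
      define t where "t = \<bar>d k x\<bar>"
      have "0 \<le> (2^k * t - 1)\<^sup>2" by simp
      then have "2 * (2^k * t) \<le> 2^k * 2^k * (t * t) + 1" by (simp add: power2_eq_square algebra_simps)
      moreover have "0 \<le> 2^k * t" by (simp add: t_def)
      ultimately have "2^k * t \<le> 2^k * 2^k * (t * t) + 1" by linarith
      then have "(1/2)^k * (2^k * t) \<le> (1/2)^k * (2^k * 2^k * (t * t) + 1)" by (rule mult_left_mono) simp
      then have "t \<le> 2^k * (t * t) + (1/2)^k"
        by (simp add: distrib_left mult.assoc[symmetric] power_mult_distrib[symmetric])
      then show ?thesis using True by (simp add: t_def)
    qed (simp add: d0)
    have "(\<integral>\<^sup>+x. ennreal \<bar>d k x\<bar> \<partial>lborel) \<le> (\<integral>\<^sup>+x. ennreal (2^k) * ennreal (d k x * d k x) + ennreal ((1/2)^k) * indicator (ball 0 1) x \<partial>lborel)"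
    proof (intro nn_integral_mono)
      fix x
      have "ennreal \<bar>d k x\<bar> \<le> ennreal (2^k * (d k x * d k x) + (1/2)^k * indicator (ball 0 1) x)"
        by (rule ennreal_leI[OF pt])
      also have "\<dots> = ennreal (2^k) * ennreal (d k x * d k x) + ennreal ((1/2)^k) * indicator (ball 0 1) x"
        by (subst ennreal_plus) (auto simp: ennreal_mult'[symmetric] indicator_def)
      finally show "ennreal \<bar>d k x\<bar> \<le> \<dots>" .
    qed
    also have "\<dots> = ennreal (2^k) * (\<integral>\<^sup>+x. ennreal (d k x * d k x) \<partial>lborel) + ennreal ((1/2)^k) * ennreal V"
      by (subst nn_integral_add) (simp_all add: nn_integral_cmult nn_integral_cmult_indicator V)
    also have "(\<integral>\<^sup>+x. ennreal (d k x * d k x) \<partial>lborel) = ennreal (l2_quad (d k))"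
      unfolding l2_form_def using dL(1)[of k] by (intro nn_integral_eq_integral) (auto simp: sq_int_def)
    also have "ennreal (2^k) * ennreal (l2_quad (d k)) + ennreal ((1/2)^k) * ennreal V
        \<le> ennreal (2^k) * ennreal (C * (1/4)^k) + ennreal ((1/2)^k) * ennreal V"
      by (intro add_mono mult_left_mono ennreal_leI dL(2)) auto
    also have "\<dots> = ennreal (2^k * (C * (1/4)^k) + (1/2)^k * V)"
      using C(1) V by (simp add: ennreal_mult'[symmetric] ennreal_plus[symmetric] del: ennreal_plus)
    also have "2^k * (C * (1/4)^k) + (1/2)^k * V = (C + V) * (1/2)^k"
    proof -
      have "2^k * (1/4)^k = (1/2::real)^k" by (simp add: power_mult_distrib[symmetric])
      then show ?thesis by (simp add: distrib_right mult.left_commute mult.commute)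
    qed
    finally show ?thesis .
  qed
  have "(\<integral>\<^sup>+x. (\<Sum>k. ennreal \<bar>d k x\<bar>) \<partial>lborel) = (\<Sum>k. \<integral>\<^sup>+x. ennreal \<bar>d k x\<bar> \<partial>lborel)"
    by (rule nn_integral_suminf) measurable
  also have "\<dots> \<le> (\<Sum>k. ennreal ((C + V) * (1/2)^k))" by (intro suminf_le L1) auto
  also have "\<dots> < \<infinity>"
  proof -
    have "summable (\<lambda>k. (C + V) * (1/2::real)^k)" by (intro summable_mult[OF summable_geometric]) simp
    then have "(\<Sum>k. ennreal ((C + V) * (1/2::real)^k)) \<noteq> top"
      by (rule ennreal_suminf_neq_top) (use C(1) V in simp)
    then show ?thesis by (metis infinity_ennreal_def less_top)
  qed
  finally have "AE x in lborel. (\<Sum>k. ennreal \<bar>d k x\<bar>) \<noteq> \<infinity>"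
    by (intro nn_integral_noteq_infinite) auto
  then have conv: "AE x in lborel. convergent (\<lambda>k. u (r k) x)"
  proof eventually_elim
    case (elim x)
    then have "summable (\<lambda>k. \<bar>d k x\<bar>)" by (intro summable_suminf_not_top) auto
    then have "summable (\<lambda>k. d k x)" by (rule summable_rabs_cancel)
    then have "convergent (\<lambda>n. \<Sum>k<n. d k x)" by (simp add: summable_iff_convergent)
    moreover have "(\<Sum>k<n. d k x) = u (r n) x - u (r 0) x" for n
      unfolding d_def by (rule sum_lessThan_telescope)
    ultimately have "convergent (\<lambda>n. u (r n) x - u (r 0) x)" by simp
    from convergent_add[OF this convergent_const[of "u (r 0) x"]] show ?case by simp
  qed
  \<comment> \<open>Where the limit fails to exist, on a null set, \<open>lim\<close> is some
    unknown value. Outside \<Omega> the sequence is constantly 0, so \<open>w\<close> vanishes there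
    at every point, as \<open>H0s\<close> demands.\<close>
  define w where "w x = lim (\<lambda>k. u (r k) x)" for x
  have wm [measurable]: "w \<in> borel_measurable borel" unfolding w_def[abs_def] by measurable
  have w0: "w x = 0" if "x \<notin> \<Omega>" for x using H0s_vanish[OF u that] by (simp add: w_def)
  have lim: "AE x in lborel. (\<lambda>k. u (r k) x) \<longlonglongrightarrow> w x"
    using conv by eventually_elim (simp add: w_def convergent_LIMSEQ_iff)
  define b where "b = 2 / frac_const DIM('a) s"
  have b: "0 < b" using frac_const_pos[OF s, where 'a='a] by (simp add: b_def)
  have tail: "\<exists>M. \<forall>n\<ge>M. (\<lambda>x. u n x - w x) \<in> fin_energy s \<and> frac_quad s (\<lambda>x. u n x - w x) \<le> e"
    if e: "0 < e" for e
  proof -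
    obtain M where M: "\<And>j k. j \<ge> M \<Longrightarrow> k \<ge> M \<Longrightarrow> frac_quad s (\<lambda>x. u j x - u k x) < e"
      using cau[OF e] by blast
    have "(\<lambda>x. u n x - w x) \<in> fin_energy s \<and> frac_quad s (\<lambda>x. u n x - w x) \<le> e" if n: "n \<ge> M" for n
    proof -
      \<comment> \<open>Lower semicontinuity with \<open>n\<close> fixed and the other index running
        along the subsequence; finite energy of the difference is part of the outcome.\<close>
      have "frac_energy s (\<lambda>x. u n x - w x) \<le> ennreal (b * e)"
      proof (rule energy_fatou[of "\<lambda>k x. u n x - u (r k) x"])
        show "AE x in lborel. (\<lambda>k. u n x - u (r k) x) \<longlonglongrightarrow> u n x - w x"
          using lim by eventually_elim (intro tendsto_intros)
        have "frac_energy s (\<lambda>x. u n x - u (r k) x) \<le> ennreal (b * e)" if "k \<ge> M" for k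
        proof -
          have "frac_quad s (\<lambda>x. u n x - u (r k) x) \<le> e"
            using M[OF n order_trans[OF that r1(2)]] by simp
          then have "b * frac_quad s (\<lambda>x. u n x - u (r k) x) \<le> b * e"
            using b by simp
          then show ?thesis using frac_energy_eq[OF s E.diff_in[OF uF uF], of n "r k"]
            by (simp add: b_def ennreal_leI)
        qed
        then show "\<forall>\<^sub>F k in sequentially. frac_energy s (\<lambda>x. u n x - u (r k) x) \<le> ennreal (b * e)"
          by (auto simp: eventually_sequentially)
      qed simp
      then have fe: "(\<lambda>x. u n x - w x) \<in> fin_energy s"
        and le: "frac_energy s (\<lambda>x. u n x - w x) \<le> ennreal (b * e)"
        by (auto simp: fin_energy_iff le_less_trans)
      have "b * frac_quad s (\<lambda>x. u n x - w x) \<le> b * e"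
        using le b e unfolding frac_energy_eq[OF s fe] b_def[symmetric] by (simp add: ennreal_le_iff)
      then show ?thesis using fe b by simp
    qed
    then show ?thesis by blast
  qed
  obtain M where M: "(\<lambda>x. u M x - w x) \<in> fin_energy s" using tail[of 1] by auto
  have wF: "w \<in> fin_energy s" using E.diff_in[OF uF M, of M] by simp
  have lim0: "(\<lambda>n. frac_quad s (\<lambda>x. u n x - w x)) \<longlonglongrightarrow> 0"
  proof (rule LIMSEQ_I)
    fix e :: real assume e: "0 < e"
    obtain M where M: "\<And>n. n \<ge> M \<Longrightarrow> frac_quad s (\<lambda>x. u n x - w x) \<le> e / 2"
      using tail[of "e / 2"] e by auto
    have "norm (frac_quad s (\<lambda>x. u n x - w x) - 0) < e" if "n \<ge> M" for n
      using M[OF that] E.nonneg[OF E.diff_in[OF uF wF], of n] e by simp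
    then show "\<exists>no. \<forall>n\<ge>no. norm (frac_quad s (\<lambda>x. u n x - w x) - 0) < e" by blast
  qed
  have "w \<in> H0s s \<Omega>" by (rule H0s_closed[OF s wF w0 u lim0 \<Omega>(1) b\<Omega>])
  then show ?thesis using lim0 by blast
qed

section \<open>Compactness\<close>

text \<open>Half-open cubes of side 1 / m; rounding down makes them disjoint and covering without
  boundary cases.\<close>

definition cell :: "nat \<Rightarrow> ('a \<Rightarrow> int) \<Rightarrow> 'a::euclidean_space set" where
  "cell m i = {x. \<forall>b\<in>Basis. \<lfloor>real m * (x \<bullet> b)\<rfloor> = i b}"

text \<open>The indices are extensional functions on \<open>Basis\<close>, which makes the set
  finite and lets distinct indices be told apart by a coordinate. The range from -m to m suffices
  for the unit ball.\<close>

definition cell_index :: "nat \<Rightarrow> ('a::euclidean_space \<Rightarrow> int) set" where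
  "cell_index m = PiE Basis (\<lambda>_. {- int m..int m})"

lemma finite_cell_index: "finite (cell_index m)"
  unfolding cell_index_def by (intro finite_PiE) auto

lemma cell_measurable [measurable]: "cell m i \<in> sets (borel :: 'a::euclidean_space measure)"
proof -
  have "cell m i = (\<Inter>b\<in>Basis. {x::'a. of_int (i b) \<le> real m * (x \<bullet> b)} \<inter> {x. real m * (x \<bullet> b) < of_int (i b) + 1})"
    by (auto simp: cell_def floor_eq_iff)
  moreover have "{x::'a. of_int (i b) \<le> real m * (x \<bullet> b)} \<in> sets borel" for b
    by (intro borel_closed closed_Collect_le continuous_intros)
  moreover have "{x::'a. real m * (x \<bullet> b) < of_int (i b) + 1} \<in> sets borel" for b
    by (intro borel_open open_Collect_less continuous_intros)
  ultimately show ?thesis by (auto intro!: sets.finite_INT)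
qed

lemma cell_disjoint:
  assumes "i \<in> cell_index m" "j \<in> cell_index m" "x \<in> cell m i" "x \<in> cell m j"
  shows "i = j"
proof (rule PiE_ext[OF assms(1)[unfolded cell_index_def] assms(2)[unfolded cell_index_def]])
  show "i b = j b" if "b \<in> Basis" for b using assms(3,4) that by (simp add: cell_def)
qed

lemma ex_cell:
  assumes "x \<in> ball (0::'a::euclidean_space) 1"
  shows "\<exists>i\<in>cell_index m. x \<in> cell m i"
proof (intro bexI[of _ "restrict (\<lambda>b. \<lfloor>real m * (x \<bullet> b)\<rfloor>) Basis"])
  show "restrict (\<lambda>b. \<lfloor>real m * (x \<bullet> b)\<rfloor>) Basis \<in> cell_index m"
    unfolding cell_index_def
  proof (intro restrict_PiE_iff[THEN iffD2] ballI)
    fix b :: 'a assume "b \<in> Basis"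
    then have "\<bar>x \<bullet> b\<bar> \<le> 1" using Basis_le_norm[of b x] assms by simp
    then have "- 1 \<le> x \<bullet> b" "x \<bullet> b \<le> 1" by auto
    then have "real m * (- 1) \<le> real m * (x \<bullet> b)" "real m * (x \<bullet> b) \<le> real m * 1"
      by (intro mult_left_mono; simp)+
    then show "\<lfloor>real m * (x \<bullet> b)\<rfloor> \<in> {- int m..int m}" by (auto simp: le_floor_iff floor_le_iff)
  qed
qed (auto simp: cell_def)

lemma cell_diameter:
  fixes x y :: "'a::euclidean_space"
  assumes "0 < m" "x \<in> cell m i" "y \<in> cell m i"
  shows "norm (x - y) \<le> real DIM('a) / real m"
proof -
  have "\<bar>(x - y) \<bullet> b\<bar> \<le> 1 / real m" if "b \<in> Basis" for b
  proof -
    have "\<lfloor>real m * (x \<bullet> b)\<rfloor> = i b" "\<lfloor>real m * (y \<bullet> b)\<rfloor> = i b" using assms that by (auto simp: cell_def)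
    then have "\<bar>real m * (x \<bullet> b) - real m * (y \<bullet> b)\<bar> \<le> 1" by (auto simp: floor_eq_iff)
    then have "real m * \<bar>(x - y) \<bullet> b\<bar> \<le> 1"
      using assms(1) by (simp add: inner_diff_left right_diff_distrib[symmetric] abs_mult)
    then show ?thesis using assms(1) by (simp add: field_simps)
  qed
  then have "(\<Sum>b\<in>Basis. \<bar>(x - y) \<bullet> b\<bar>) \<le> (\<Sum>b\<in>(Basis::'a set). 1 / real m)" by (intro sum_mono)
  then show ?thesis using norm_le_l1[of "x - y"] by simp
qed

lemma cell_emeasure:
  fixes i :: "'a::euclidean_space \<Rightarrow> int"
  assumes "0 < m"
  shows "ennreal ((1 / real m) ^ DIM('a)) \<le> emeasure lborel (cell m i)" "emeasure lborel (cell m i) < \<infinity>"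
proof -
  define l where "l = (\<Sum>b\<in>Basis. (of_int (i b) / real m) *\<^sub>R (b::'a))"
  define u where "u = (\<Sum>b\<in>Basis. ((of_int (i b) + 1) / real m) *\<^sub>R (b::'a))"
  have lu: "l \<bullet> b = of_int (i b) / real m" "u \<bullet> b = (of_int (i b) + 1) / real m" if "b \<in> Basis" for b
    using that by (simp_all add: l_def u_def)
  have le: "l \<bullet> b \<le> u \<bullet> b" if "b \<in> Basis" for b using assms that by (simp add: lu divide_right_mono)
  have "box l u \<subseteq> cell m i"
  proof
    fix x assume x: "x \<in> box l u"
    have "\<lfloor>real m * (x \<bullet> b)\<rfloor> = i b" if "b \<in> Basis" for b
    proof -
      have "of_int (i b) / real m < x \<bullet> b" "x \<bullet> b < (of_int (i b) + 1) / real m"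
        using x that lu by (auto simp: mem_box)
      then show ?thesis using assms by (auto simp: floor_eq_iff field_simps)
    qed
    then show "x \<in> cell m i" by (simp add: cell_def)
  qed
  then have "emeasure lborel (box l u) \<le> emeasure lborel (cell m i)" by (intro emeasure_mono) auto
  moreover have "emeasure lborel (box l u) = ennreal (\<Prod>b\<in>Basis. (u - l) \<bullet> b)"
    by (rule emeasure_lborel_box[OF le])
  moreover have "(\<Prod>b\<in>Basis. (u - l) \<bullet> b) = (\<Prod>b\<in>(Basis::'a set). 1 / real m)"
    by (intro prod.cong) (auto simp: inner_diff_left lu diff_divide_distrib[symmetric])
  ultimately show "ennreal ((1 / real m) ^ DIM('a)) \<le> emeasure lborel (cell m i)" by simp
  have "cell m i \<subseteq> cbox l u"
  proof
    fix x assume x: "x \<in> cell m i"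
    have "of_int (i b) / real m \<le> x \<bullet> b \<and> x \<bullet> b \<le> (of_int (i b) + 1) / real m" if "b \<in> Basis" for b
    proof -
      have "\<lfloor>real m * (x \<bullet> b)\<rfloor> = i b" using x that by (simp add: cell_def)
      then show ?thesis using assms by (auto simp: floor_eq_iff field_simps)
    qed
    then show "x \<in> cbox l u" using lu by (auto simp: mem_box)
  qed
  then have "emeasure lborel (cell m i) \<le> emeasure lborel (cbox l u)" by (intro emeasure_mono) auto
  also have "\<dots> < \<infinity>" by (rule emeasure_lborel_cbox_finite)
  finally show "emeasure lborel (cell m i) < \<infinity>" .
qed

text \<open>Expand the square and integrate in one variable at a time. Both sides are a multiple of
  the variance of \<open>v\<close> on \<open>Q\<close>; the double integral is the one that compares
  with the energy density.\<close>

lemma variance_double_integral: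
  fixes v :: "'a::euclidean_space \<Rightarrow> real"
  assumes v: "v \<in> sq_int" and Q [measurable]: "Q \<in> sets borel" "emeasure lborel Q < \<infinity>"
  shows "ennreal (2 * measure lborel Q * (LINT x|lborel. indicator Q x * (v x * v x))
      - 2 * (LINT x|lborel. indicator Q x * v x)\<^sup>2)
    = (\<integral>\<^sup>+z. ennreal ((v (fst z) - v (snd z))\<^sup>2) * indicator (Q \<times> Q) z \<partial>lborel)"
proof -
  have [measurable]: "v \<in> borel_measurable borel" using v by (simp add: sq_int_def)
  have fin: "emeasure lborel Q \<noteq> \<infinity>" using Q(2) by simp
  have iQ: "integrable lborel (indicator Q :: 'a \<Rightarrow> real)" using Q by (intro integrable_real_indicator) auto
  have i2: "integrable lborel (\<lambda>x. indicator Q x * (v x * v x))"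
    using integrable_mult_indicator[of Q lborel "\<lambda>x. v x * v x"] v by (simp add: sq_int_def)
  have "(\<lambda>x. indicator Q x * indicator Q x) = (indicator Q :: 'a \<Rightarrow> real)" by (auto simp: indicator_def)
  then have "indicator Q \<in> sq_int" unfolding sq_int_def using iQ by simp
  from sq_int_mult_integrable[OF this v] have i1: "integrable lborel (\<lambda>x. indicator Q x * v x)" .
  define q where "q = measure lborel Q"
  define S where "S = (LINT x|lborel. indicator Q x * v x)"
  define T where "T = (LINT x|lborel. indicator Q x * (v x * v x))"
  have inner: "(\<integral>\<^sup>+y. ennreal ((v x - v y)\<^sup>2) * indicator Q y \<partial>lborel) = ennreal (q * (v x * v x) - 2 * S * v x + T)" for x
  proof -
    have e: "(v x - v y)\<^sup>2 * indicator Q y = (v x * v x) * indicator Q y - (2 * v x) * (indicator Q y * v y) + indicator Q y * (v y * v y)" for y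
      by (simp add: power2_eq_square algebra_simps)
    have int: "integrable lborel (\<lambda>y. (v x - v y)\<^sup>2 * indicator Q y)"
      unfolding e by (intro Bochner_Integration.integrable_add Bochner_Integration.integrable_diff integrable_mult_right iQ i1 i2)
    have "(\<integral>\<^sup>+y. ennreal ((v x - v y)\<^sup>2) * indicator Q y \<partial>lborel) = (\<integral>\<^sup>+y. ennreal ((v x - v y)\<^sup>2 * indicator Q y) \<partial>lborel)"
      by (intro nn_integral_cong) (auto simp: indicator_def)
    also have "\<dots> = ennreal (LINT y|lborel. (v x - v y)\<^sup>2 * indicator Q y)"
      by (rule nn_integral_eq_integral[OF int]) simp
    also have "(LINT y|lborel. (v x - v y)\<^sup>2 * indicator Q y) = (v x * v x) * q - (2 * v x) * S + T"
      unfolding e using iQ i1 i2 by (simp add: q_def[symmetric] S_def T_def)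
    finally show ?thesis by (simp add: mult_ac)
  qed
  have nn: "0 \<le> q * (v x * v x) - 2 * S * v x + T" for x
  proof -
    have "(LINT y|lborel. (v x - v y)\<^sup>2 * indicator Q y) = (v x * v x) * q - (2 * v x) * S + T"
    proof -
      have e: "(v x - v y)\<^sup>2 * indicator Q y = (v x * v x) * indicator Q y - (2 * v x) * (indicator Q y * v y) + indicator Q y * (v y * v y)" for y
        by (simp add: power2_eq_square algebra_simps)
      show ?thesis unfolding e using iQ i1 i2 by (simp add: q_def[symmetric] S_def T_def)
    qed
    moreover have "0 \<le> (LINT y|lborel. (v x - v y)\<^sup>2 * indicator Q y)" by (intro integral_nonneg_AE) auto
    ultimately show ?thesis by (simp add: mult_ac)
  qed
  have "(\<integral>\<^sup>+z. ennreal ((v (fst z) - v (snd z))\<^sup>2) * indicator (Q \<times> Q) z \<partial>lborel)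
      = (\<integral>\<^sup>+x. indicator Q x * (\<integral>\<^sup>+y. ennreal ((v x - v y)\<^sup>2) * indicator Q y \<partial>lborel) \<partial>lborel)"
  proof (subst nn_integral_product)
    have "(\<lambda>z. indicator (Q \<times> Q) z :: ennreal) = (\<lambda>z. indicator Q (fst z) * indicator Q (snd z))"
      by (auto simp: indicator_def fun_eq_iff)
    then show "(\<lambda>z. ennreal ((v (fst z) - v (snd z))\<^sup>2) * indicator (Q \<times> Q) z) \<in> borel_measurable borel" by simp
  qed (auto simp: nn_integral_cmult[symmetric] indicator_def intro!: nn_integral_cong)
  also have "\<dots> = (\<integral>\<^sup>+x. ennreal (indicator Q x * (q * (v x * v x) - 2 * S * v x + T)) \<partial>lborel)"
    unfolding inner by (intro nn_integral_cong) (auto simp: indicator_def)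
  also have "\<dots> = ennreal (LINT x|lborel. indicator Q x * (q * (v x * v x) - 2 * S * v x + T))"
  proof (rule nn_integral_eq_integral)
    have e: "indicator Q x * (q * (v x * v x) - 2 * S * v x + T) = q * (indicator Q x * (v x * v x)) - (2 * S) * (indicator Q x * v x) + T * indicator Q x" for x
      by (simp add: algebra_simps)
    show "integrable lborel (\<lambda>x. indicator Q x * (q * (v x * v x) - 2 * S * v x + T))"
      unfolding e by (intro Bochner_Integration.integrable_add Bochner_Integration.integrable_diff integrable_mult_right iQ i1 i2)
  qed (use nn in auto)
  also have "(LINT x|lborel. indicator Q x * (q * (v x * v x) - 2 * S * v x + T)) = 2 * q * T - 2 * S\<^sup>2"
  proof -
    have e: "indicator Q x * (q * (v x * v x) - 2 * S * v x + T) = q * (indicator Q x * (v x * v x)) - (2 * S) * (indicator Q x * v x) + T * indicator Q x" for x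
      by (simp add: algebra_simps)
    show ?thesis unfolding e using iQ i1 i2
      by (simp add: q_def[symmetric] S_def[symmetric] T_def[symmetric] power2_eq_square)
  qed
  finally show ?thesis by (simp add: q_def S_def T_def)
qed

text \<open>On a cube the squared norm is the contribution of the mean plus the variance, and the
  energy density controls the variance because points of a cube are at most N / m apart. The powers
  combine to m^N (N / m)^(N + 2s), of order m^(-2s). Up to a small error the L2 norm is governed by
  finitely many averages.\<close>

lemma l2_cell_estimate:
  fixes v :: "'a::euclidean_space \<Rightarrow> real"
  assumes s: "0 < s" "s < 1" and v: "v \<in> fin_energy s" "v \<in> sq_int" "\<And>x. x \<notin> ball 0 1 \<Longrightarrow> v x = 0"
    and m: "0 < m"
  shows "l2_form v v \<le> (\<Sum>i\<in>cell_index m. real m ^ DIM('a) * (LINT x|lborel. indicator (cell m i) x * v x)\<^sup>2)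
    + real DIM('a) powr (real DIM('a) + 2 * s) / 2 * real m powr (- 2 * s) * (LINT z|lborel. frac_integrand s v v z)"
proof -
  have [measurable]: "v \<in> borel_measurable borel" using v by (simp add: sq_int_def)
  define N where "N = DIM('a)"
  define p where "p = real N + 2 * s"
  have p: "0 < p" using s by (simp add: p_def add_nonneg_pos)
  define D where "D = (real N / real m) powr p"
  have D: "0 \<le> D" by (simp add: D_def)
  define F where "F = frac_integrand s v v"
  have Fi: "integrable lborel F" using v by (simp add: F_def fin_energy_def)
  have F0: "0 \<le> F z" for z by (simp add: F_def frac_integrand_nonneg)
  define Q where "Q i = cell m i" for i :: "'a \<Rightarrow> int"
  define q where "q i = measure lborel (Q i)" for i
  define S where "S i = (LINT x|lborel. indicator (Q i) x * v x)" for i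
  define T where "T i = (LINT x|lborel. indicator (Q i) x * (v x * v x))" for i
  define G where "G i = (LINT z|lborel. indicator (Q i \<times> Q i) z * F z)" for i
  have Qm [measurable]: "Q i \<in> sets borel" for i by (simp add: Q_def)
  have QQ [measurable]: "Q i \<times> Q i \<in> sets borel" for i by (simp add: borel_Times)
  have qe: "emeasure lborel (Q i) = ennreal (q i)" for i
    unfolding q_def using cell_emeasure(2)[OF m, of i] by (intro emeasure_eq_ennreal_measure) (simp add: Q_def)
  have q: "(1 / real m) ^ N \<le> q i" "0 < q i" for i
  proof -
    have "ennreal ((1 / real m) ^ N) \<le> ennreal (q i)"
      using cell_emeasure(1)[OF m, of i] unfolding qe[symmetric] by (simp add: Q_def N_def)
    then show 1: "(1 / real m) ^ N \<le> q i" by (subst (asm) ennreal_le_iff) (simp_all add: q_def)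
    have "0 < (1 / real m) ^ N" using m by simp
    then show "0 < q i" using 1 by linarith
  qed
  have Gi: "integrable lborel (\<lambda>z. indicator (Q i \<times> Q i) z * F z)" for i
    using Fi by (intro Bochner_Integration.integrable_bound[OF Fi]) (auto simp: indicator_def)
  have G0: "0 \<le> G i" for i unfolding G_def using F0 by (intro integral_nonneg_AE) auto
  have TS: "T i \<le> real m ^ N * (S i)\<^sup>2 + real m ^ N * (D / 2) * G i" for i
  proof -
    have "ennreal (2 * q i * T i - 2 * (S i)\<^sup>2) = (\<integral>\<^sup>+z. ennreal ((v (fst z) - v (snd z))\<^sup>2) * indicator (Q i \<times> Q i) z \<partial>lborel)"
      unfolding q_def T_def S_def by (rule variance_double_integral[OF v(2)]) (auto simp: qe)
    also have "\<dots> \<le> (\<integral>\<^sup>+z. ennreal (D * (indicator (Q i \<times> Q i) z * F z)) \<partial>lborel)"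
    proof (intro nn_integral_mono)
      fix z :: "'a \<times> 'a"
      obtain x y where z: "z = (x, y)" by force
      have "(v x - v y)\<^sup>2 \<le> D * F z" if "x \<in> Q i" "y \<in> Q i"
      proof (cases "x = y")
        case True
        then show ?thesis using D F0 by simp
      next
        case False
        have "norm (x - y) powr p \<le> D" unfolding D_def N_def
          using cell_diameter[OF m, of x i y] that p by (intro powr_mono2) (auto simp: Q_def)
        then have "1 \<le> D * frac_ker s (x - y)"
          using False by (simp add: frac_ker_def p_def N_def field_simps)
        then have "(v x - v y)\<^sup>2 * 1 \<le> (v x - v y)\<^sup>2 * (D * frac_ker s (x - y))"
          by (rule mult_left_mono) simp
        then show ?thesis by (simp add: F_def z frac_integrand_eq power2_eq_square mult_ac)
      qed
      then show "ennreal ((v (fst z) - v (snd z))\<^sup>2) * indicator (Q i \<times> Q i) z \<le> ennreal (D * (indicator (Q i \<times> Q i) z * F z))"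
        by (auto simp: z indicator_def ennreal_leI)
    qed
    also have "\<dots> = ennreal (D * G i)"
      unfolding G_def using Gi[of i] D F0
      by (subst nn_integral_eq_integral) (auto intro!: AE_I2 mult_nonneg_nonneg)
    finally have "2 * q i * T i - 2 * (S i)\<^sup>2 \<le> D * G i"
      using D G0[of i] by (subst (asm) ennreal_le_iff) auto
    then have "T i \<le> (1 / q i) * ((S i)\<^sup>2 + (D / 2) * G i)" using q(2)[of i] by (simp add: field_simps)
    also have "\<dots> \<le> real m ^ N * ((S i)\<^sup>2 + (D / 2) * G i)"
    proof (rule mult_right_mono)
      have "1 / q i \<le> 1 / (1 / real m) ^ N" using q[of i] m by (intro divide_left_mono) auto
      then show "1 / q i \<le> real m ^ N" by (simp add: power_one_over)
    qed (use D G0 in auto)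
    finally show ?thesis by (simp add: algebra_simps)
  qed
  have one: "(\<Sum>i\<in>(cell_index m :: ('a \<Rightarrow> int) set). indicator (Q i) x) = (1::real)" if x1: "x \<in> ball 0 1" for x
  proof -
    obtain j where j: "j \<in> cell_index m" "x \<in> Q j" using ex_cell[OF x1] unfolding Q_def by blast
    have "(\<Sum>i\<in>(cell_index m :: ('a \<Rightarrow> int) set). indicator (Q i) x) = (\<Sum>i\<in>(cell_index m :: ('a \<Rightarrow> int) set). if i = j then (1::real) else 0)"
    proof (intro sum.cong refl)
      fix i :: "'a \<Rightarrow> int" assume "i \<in> cell_index m"
      then have "x \<in> Q i \<longleftrightarrow> i = j" using j cell_disjoint[of i m j x] unfolding Q_def by blast
      then show "indicator (Q i) x = (if i = j then (1::real) else 0)" by (simp only: indicator_def of_bool_def)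
    qed
    also have "\<dots> = 1" by (subst sum.delta[OF finite_cell_index]) (simp add: j)
    finally show ?thesis .
  qed
  \<comment> \<open>The squares of disjoint cubes are disjoint in the product space, so the energies
    of the cubes add up to at most the full energy.\<close>
  have le1: "(\<Sum>i\<in>cell_index m. indicator (Q i \<times> Q i) z) \<le> (1::real)" for z :: "'a \<times> 'a"
  proof (cases "\<exists>j\<in>cell_index m. z \<in> Q j \<times> Q j")
    case True
    then obtain j where j: "j \<in> cell_index m" "z \<in> Q j \<times> Q j" by blast
    have "(\<Sum>i\<in>(cell_index m :: ('a \<Rightarrow> int) set). indicator (Q i \<times> Q i) z) = (\<Sum>i\<in>(cell_index m :: ('a \<Rightarrow> int) set). if i = j then (1::real) else 0)"
    proof (intro sum.cong refl)
      fix i :: "'a \<Rightarrow> int" assume "i \<in> cell_index m"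
      then have "z \<in> Q i \<times> Q i \<longleftrightarrow> i = j"
        using j cell_disjoint[of i m j "fst z"] unfolding Q_def by (auto simp: mem_Times_iff)
      then show "indicator (Q i \<times> Q i) z = (if i = j then (1::real) else 0)" by (simp only: indicator_def of_bool_def)
    qed
    also have "\<dots> = 1" by (subst sum.delta[OF finite_cell_index]) (simp add: j)
    finally show ?thesis by simp
  next
    case False
    then have "(\<Sum>i\<in>cell_index m. indicator (Q i \<times> Q i) z) = (\<Sum>i\<in>(cell_index m :: ('a \<Rightarrow> int) set). (0::real))"
      by (intro sum.cong) auto
    then show ?thesis by simp
  qed
  have vi: "integrable lborel (\<lambda>x. indicator (Q i) x * (v x * v x))" for i
    using integrable_mult_indicator[of "Q i" lborel "\<lambda>x. v x * v x"] v by (simp add: sq_int_def)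
  have "l2_form v v = (LINT x|lborel. (\<Sum>i\<in>cell_index m. indicator (Q i) x * (v x * v x)))"
    unfolding l2_form_def
  proof (intro Bochner_Integration.integral_cong refl)
    fix x
    show "v x * v x = (\<Sum>i\<in>cell_index m. indicator (Q i) x * (v x * v x))"
      using one[of x] v(3)[of x] by (cases "x \<in> ball 0 1") (simp_all add: sum_distrib_right[symmetric] del: mem_ball)
  qed
  also have "\<dots> = (\<Sum>i\<in>cell_index m. T i)" unfolding T_def by (rule Bochner_Integration.integral_sum) (rule vi)
  also have "\<dots> \<le> (\<Sum>i\<in>cell_index m. real m ^ N * (S i)\<^sup>2 + real m ^ N * (D / 2) * G i)" by (intro sum_mono TS)
  also have "\<dots> = (\<Sum>i\<in>cell_index m. real m ^ N * (S i)\<^sup>2) + real m ^ N * (D / 2) * (\<Sum>i\<in>cell_index m. G i)"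
    by (simp add: sum.distrib sum_distrib_left)
  also have "(\<Sum>i\<in>cell_index m. G i) \<le> (LINT z|lborel. F z)"
  proof -
    have "(\<Sum>i\<in>cell_index m. G i) = (LINT z|lborel. (\<Sum>i\<in>cell_index m. indicator (Q i \<times> Q i) z * F z))"
      unfolding G_def by (rule Bochner_Integration.integral_sum[symmetric]) (rule Gi)
    also have "\<dots> \<le> (LINT z|lborel. F z)"
    proof (rule integral_mono)
      show "integrable lborel (\<lambda>z. \<Sum>i\<in>cell_index m. indicator (Q i \<times> Q i) z * F z)" using Gi by auto
      fix z
      show "(\<Sum>i\<in>cell_index m. indicator (Q i \<times> Q i) z * F z) \<le> F z"
        using mult_right_mono[OF le1 F0, of z z] by (simp add: sum_distrib_right)
    qed (rule Fi)
    finally show ?thesis .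
  qed
  also have "real m ^ N * (D / 2) = real N powr p / 2 * real m powr (- 2 * s)"
  proof -
    have "D = real N powr p * real m powr (- p)"
      unfolding D_def by (simp add: powr_divide powr_minus_divide)
    moreover have "real m ^ N * real m powr (- p) = real m powr (- 2 * s)"
      using m by (simp add: powr_realpow[symmetric] powr_add[symmetric] p_def)
    ultimately show ?thesis by simp
  qed
  finally show ?thesis using D
    by (simp add: N_def p_def S_def Q_def F_def mult_left_mono)
qed

text \<open>Cantor's diagonal argument, in the form of sequential compactness of a countable product
  of compact intervals.\<close>

lemma diagonal_convergent:
  fixes f :: "nat \<Rightarrow> nat \<Rightarrow> real"
  assumes "\<And>k n. \<bar>f k n\<bar> \<le> B k"
  obtains r :: "nat \<Rightarrow> nat" where "strict_mono r" "\<And>k. convergent (\<lambda>n. f k (r n))"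
proof -
  let ?P = "PiE UNIV (\<lambda>k. {- B k..B k})"
  have "compactin (product_topology (\<lambda>_. euclidean) UNIV) ?P"
    unfolding compactin_PiE by auto
  then have "compact ?P" by (simp add: euclidean_product_topology)
  then have "seq_compact ?P" by (rule compact_imp_seq_compact)
  moreover have "\<forall>n. (\<lambda>k. f k n) \<in> ?P" using assms by (auto simp: abs_le_iff minus_le_iff)
  ultimately obtain l r where r: "strict_mono (r :: nat \<Rightarrow> nat)" "((\<lambda>n k. f k n) \<circ> r) \<longlonglongrightarrow> l"
    by (rule seq_compactE)
  have "(\<lambda>n. f k (r n)) \<longlonglongrightarrow> l k" for k
  proof -
    have "isCont (\<lambda>x :: nat \<Rightarrow> real. x k) l"
    proof -
      have "continuous_on UNIV (\<lambda>x :: nat \<Rightarrow> real. x k)" by (rule continuous_on_product_coordinates)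
      then show ?thesis unfolding continuous_on_eq_continuous_at[OF open_UNIV] by blast
    qed
    from isCont_tendsto_compose[OF this r(2)] show ?thesis by (simp add: o_def)
  qed
  then show ?thesis using that r(1) by (auto simp: convergent_def)
qed

text \<open>The averages over all cubes of all meshes are countably many bounded sequences, and one
  subsequence makes all of them converge. The cube estimate turns this into the Cauchy property in
  L2.\<close>

lemma energy_compact:
  fixes u :: "nat \<Rightarrow> 'a::euclidean_space \<Rightarrow> real"
  assumes s: "0 < s" "s < 1" and u: "\<And>n. u n \<in> fin_energy s" "\<And>n x. x \<notin> ball 0 1 \<Longrightarrow> u n x = 0"
    and bd: "\<And>n. frac_quad s (u n) \<le> M"
  shows "\<exists>r::nat \<Rightarrow> nat. strict_mono r \<and> (\<forall>e>0. \<exists>N. \<forall>j\<ge>N. \<forall>k\<ge>N.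
        l2_quad (\<lambda>x. u (r j) x - u (r k) x) < e)"
proof -
  interpret E: semi_inner "fin_energy s" "frac_form s :: ('a \<Rightarrow> real) \<Rightarrow> _" by (rule semi_inner_frac_form[OF s])
  interpret L: semi_inner sq_int "l2_form :: ('a \<Rightarrow> real) \<Rightarrow> _" by (rule semi_inner_l2_form)
  obtain C where C: "0 \<le> C" "\<And>f :: 'a \<Rightarrow> real. f \<in> fin_energy s \<Longrightarrow>
    (\<And>x. x \<notin> ball 0 1 \<Longrightarrow> f x = 0) \<Longrightarrow> f \<in> sq_int \<and> l2_form f f \<le> C * frac_form s f f"
    using poincare[OF s] by metis
  have uL: "u n \<in> sq_int" "l2_quad (u n) \<le> C * M" for n
    using C(2)[OF u, of n] mult_left_mono[OF bd C(1), of n] by auto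
  define ind where "ind = (SIGMA m:(UNIV::nat set). (cell_index m :: ('a \<Rightarrow> int) set))"
  have "countable ind" unfolding ind_def
    by (rule countable_SIGMA) (auto intro: countable_finite finite_cell_index)
  define Q where "Q k = (case from_nat_into ind k of (m, i) \<Rightarrow> cell m i)" for k
  have Qm [measurable]: "Q k \<in> sets borel" for k by (simp add: Q_def split: prod.split)
  define S where "S k v = (LINT x|lborel. indicator (Q k) x * v x)" for k and v :: "'a \<Rightarrow> real"
  define V where "V = measure lborel (ball (0::'a) 1)"
  have iB: "integrable lborel (indicator (ball (0::'a) 1) :: 'a \<Rightarrow> real)"
    by (rule integrable_real_indicator) (simp, rule emeasure_lborel_ball_finite)
  have Iv: "integrable lborel (\<lambda>x. indicator (Q k) x * v x)" "\<bar>S k v\<bar> \<le> l2_form v v + V"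
    if v: "v \<in> sq_int" "\<And>x. x \<notin> ball 0 1 \<Longrightarrow> v x = 0" for k v
  proof -
    have [measurable]: "v \<in> borel_measurable borel" using v by (simp add: sq_int_def)
    have i2: "integrable lborel (\<lambda>x. v x * v x + indicator (ball 0 1) x)"
      using v(1) iB by (simp add: sq_int_def)
    have pt: "\<bar>indicator (Q k) x * v x\<bar> \<le> v x * v x + indicator (ball 0 1) x" for x
    proof (cases "x \<in> ball 0 1")
      case True
      have "0 \<le> (\<bar>v x\<bar> - 1)\<^sup>2" by simp
      then have "2 * \<bar>v x\<bar> \<le> v x * v x + 1" by (simp add: power2_eq_square algebra_simps)
      then have "\<bar>v x\<bar> \<le> v x * v x + 1" by linarith
      then show ?thesis using True by (auto simp: indicator_def)
    qed (simp add: v)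
    show i1: "integrable lborel (\<lambda>x. indicator (Q k) x * v x)"
      by (rule Bochner_Integration.integrable_bound[OF i2]) (use pt in \<open>auto intro!: AE_I2 order_trans[OF pt]\<close>)
    have "\<bar>S k v\<bar> \<le> (LINT x|lborel. \<bar>indicator (Q k) x * v x\<bar>)" unfolding S_def by (rule integral_abs_bound)
    also have "\<dots> \<le> (LINT x|lborel. v x * v x + indicator (ball 0 1) x)"
      by (rule integral_mono) (use i1 i2 pt in auto)
    also have "\<dots> = l2_form v v + V"
      using v(1) iB by (simp add: l2_form_def V_def sq_int_def)
    finally show "\<bar>S k v\<bar> \<le> l2_form v v + V" .
  qed
  have "\<bar>S k (u n)\<bar> \<le> C * M + V" for k n using Iv(2)[OF uL(1) u(2), of k n] uL(2)[of n] by simp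
  then obtain r :: "nat \<Rightarrow> nat" where r: "strict_mono r" "\<And>k. convergent (\<lambda>n. S k (u (r n)))"
    using diagonal_convergent[of "\<lambda>k n. S k (u n)" "\<lambda>_. C * M + V"] by blast
  define b where "b = 2 / frac_const DIM('a) s"
  have b: "0 < b" using frac_const_pos[OF s, where 'a='a] by (simp add: b_def)
  have "\<exists>N. \<forall>j\<ge>N. \<forall>k\<ge>N. l2_quad (\<lambda>x. u (r j) x - u (r k) x) < e" if e: "0 < e" for e
  proof -
    define A where "A = real DIM('a) powr (real DIM('a) + 2 * s) / 2 * (b * (4 * M))"
    have M: "0 \<le> M" using E.nonneg[OF u(1), of 0] bd[of 0] by linarith
    have A: "0 \<le> A" using M b by (simp add: A_def)
    have "((\<lambda>m. A * real m powr (- 2 * s)) \<longlongrightarrow> A * 0) sequentially"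
      using s by (intro tendsto_mult tendsto_const tendsto_neg_powr filterlim_real_sequentially) auto
    then have "\<forall>\<^sub>F m in sequentially. A * real m powr (- 2 * s) < e / 2"
      using e by (intro order_tendstoD(2)) auto
    then have "\<forall>\<^sub>F m in sequentially. A * real m powr (- 2 * s) < e / 2 \<and> 0 < m"
      using eventually_gt_at_top[of 0] by eventually_elim auto
    then obtain m where m: "A * real m powr (- 2 * s) < e / 2" "0 < m"
      using eventually_happens'[OF sequentially_bot] by blast
    define J where "J = (cell_index m :: ('a \<Rightarrow> int) set)"
    have Jf: "finite J" by (simp add: J_def finite_cell_index)
    define K where "K i = to_nat_on ind (m, i)" for i
    have QK: "Q (K i) = cell m i" if "i \<in> J" for i
      using that \<open>countable ind\<close> by (simp add: Q_def K_def J_def ind_def)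
    define l where "l i = lim (\<lambda>n. S (K i) (u (r n)))" for i
    have l: "(\<lambda>n. S (K i) (u (r n))) \<longlonglongrightarrow> l i" for i
      using r(2)[of "K i"] by (simp add: l_def convergent_LIMSEQ_iff)
    \<comment> \<open>The summand 1 keeps \<open>c\<close> positive; \<open>d\<close> is chosen so
      that c (2 d)^2 = e / 2.\<close>
    define c where "c = real m ^ DIM('a) * real (card J) + 1"
    have c: "0 < c" by (simp add: c_def add_nonneg_pos)
    define d where "d = sqrt (e / (8 * c))"
    have d: "0 < d" using e c by (simp add: d_def)
    have "\<forall>\<^sub>F n in sequentially. \<bar>S (K i) (u (r n)) - l i\<bar> < d" for i
      using tendstoD[OF l d, of i] by (simp add: dist_real_def)
    then have "\<forall>\<^sub>F n in sequentially. \<forall>i\<in>J. \<bar>S (K i) (u (r n)) - l i\<bar> < d"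
      using Jf by (simp add: eventually_ball_finite)
    then obtain N where N: "\<And>n i. n \<ge> N \<Longrightarrow> i \<in> J \<Longrightarrow> \<bar>S (K i) (u (r n)) - l i\<bar> < d"
      by (auto simp: eventually_sequentially)
    have "l2_quad (\<lambda>x. u (r j) x - u (r k) x) < e" if jk: "j \<ge> N" "k \<ge> N" for j k
    proof -
      let ?v = "\<lambda>x. u (r j) x - u (r k) x"
      have vF: "?v \<in> fin_energy s" by (intro E.diff_in u)
      have vL: "?v \<in> sq_int" by (intro L.diff_in uL)
      have Ev: "frac_form s ?v ?v \<le> 4 * M"
        using E.expand_diff[OF u(1) u(1), of "r j" "r k"] E.expand_add[OF u(1) u(1), of "r j" "r k"]
          E.nonneg[OF E.lincomb[OF u(1) u(1), of 1 "r j" 1 "r k"]] bd[of "r j"] bd[of "r k"] by simp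
      have Fv: "(LINT z|lborel. frac_integrand s ?v ?v z) = b * frac_form s ?v ?v"
        using frac_const_pos[OF s, where 'a='a] by (simp add: b_def frac_form_def)
      have "(\<Sum>i\<in>J. real m ^ DIM('a) * (LINT x|lborel. indicator (cell m i) x * ?v x)\<^sup>2)
          \<le> (\<Sum>i\<in>J. real m ^ DIM('a) * (2 * d)\<^sup>2)"
      proof (intro sum_mono mult_left_mono)
        fix i assume i: "i \<in> J"
        have "(LINT x|lborel. indicator (cell m i) x * ?v x) = S (K i) (u (r j)) - S (K i) (u (r k))"
          unfolding S_def QK[OF i, symmetric]
          using Iv(1)[OF uL(1) u(2)] by (subst Bochner_Integration.integral_diff[symmetric]) (auto simp: right_diff_distrib)
        moreover have "\<bar>S (K i) (u (r j)) - S (K i) (u (r k))\<bar> \<le> 2 * d"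
          using N[OF jk(1) i] N[OF jk(2) i] by linarith
        ultimately show "(LINT x|lborel. indicator (cell m i) x * ?v x)\<^sup>2 \<le> (2 * d)\<^sup>2"
          by (metis abs_le_square_iff abs_of_pos d mult_pos_pos zero_less_numeral)
      qed simp
      also have "\<dots> = (c - 1) * (4 * d\<^sup>2)" by (simp add: c_def power_mult_distrib)
      also have "\<dots> < c * (4 * d\<^sup>2)" using d by (intro mult_strict_right_mono) auto
      also have "\<dots> = e / 2" using e c by (simp add: d_def)
      finally have 1: "(\<Sum>i\<in>J. real m ^ DIM('a) * (LINT x|lborel. indicator (cell m i) x * ?v x)\<^sup>2) < e / 2" .
      have "real DIM('a) powr (real DIM('a) + 2 * s) / 2 * real m powr (- 2 * s) * (b * frac_form s ?v ?v)
          \<le> real DIM('a) powr (real DIM('a) + 2 * s) / 2 * real m powr (- 2 * s) * (b * (4 * M))"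
        using Ev b by (intro mult_left_mono) auto
      also have "\<dots> = A * real m powr (- 2 * s)" by (simp add: A_def)
      also have "\<dots> < e / 2" by (rule m)
      finally show ?thesis
        using l2_cell_estimate[OF s vF vL _ m(2)] 1 u(2) unfolding Fv J_def by fastforce
    qed
    then show ?thesis by blast
  qed
  then show ?thesis using r(1) by blast
qed

section \<open>Isometric involutions\<close>

text \<open>Reflections, products of commuting reflections and the identity are of this kind. The
  inverse is the map itself, and the identity stands for the absence of a symmetry
  condition.\<close>

definition isom_invol :: "('a::euclidean_space \<Rightarrow> 'a) \<Rightarrow> bool" where
  "isom_invol g \<longleftrightarrow> (\<forall>x. g (g x) = x) \<and> (\<forall>x y. norm (g x - g y) = norm (x - y))"

lemma isom_invol_simps:
  assumes "isom_invol g"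
  shows "g (g x) = x" "norm (g x - g y) = norm (x - y)"
  using assms by (auto simp: isom_invol_def)

lemma isom_invol_id: "isom_invol (\<lambda>x. x)"
  by (simp add: isom_invol_def)

lemma isom_invol_continuous:
  assumes "isom_invol g"
  shows "continuous_on S g"
proof -
  have "1-lipschitz_on S g" by (rule lipschitz_onI) (auto simp: dist_norm isom_invol_simps[OF assms])
  then show ?thesis by (rule lipschitz_on_continuous_on)
qed

lemma isom_invol_measurable [measurable_dest]: "isom_invol g \<Longrightarrow> g \<in> borel_measurable borel"
  by (intro borel_measurable_continuous_onI isom_invol_continuous)

lemma isom_invol_ball:
  assumes "isom_invol g"
  shows "g -` ball a r = ball (g a) r"
proof -
  have "norm (a - g x) = norm (g a - x)" for x
    using isom_invol_simps[OF assms] by metis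
  then show ?thesis by (auto simp: dist_norm)
qed

text \<open>By Vitali's theorem an open set is, up to a null set, a countable disjoint union of
  balls, and the map sends balls to balls of the same radius.\<close>

lemma isom_invol_open_le:
  fixes S :: "'a::euclidean_space set"
  assumes g: "isom_invol g" and S: "open S"
  shows "emeasure lborel S \<le> emeasure lborel (g -` S)"
proof -
  have gm [measurable]: "g \<in> borel_measurable borel" by (rule isom_invol_measurable[OF g])
  have oS: "open (g -` S)" by (rule open_vimage[OF S isom_invol_continuous[OF g]])
  define K where "K = {(a, r). 0 < r \<and> ball a r \<subseteq> S}"
  have cov: "\<exists>i. i \<in> K \<and> x \<in> ball (fst i) (snd i) \<and> snd i < d" if xS: "x \<in> S" and d: "0 < d" for x d
  proof -
    obtain e where e: "0 < e" "ball x e \<subseteq> S" using openE[OF S xS] by blast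
    then have "(x, min e (d / 2)) \<in> K" using d by (auto simp: K_def)
    moreover have "x \<in> ball x (min e (d / 2))" "min e (d / 2) < d" using e d by auto
    ultimately show ?thesis by (intro exI[of _ "(x, min e (d / 2))"]) auto
  qed
  obtain C where C: "countable C" "C \<subseteq> K"
      "pairwise (\<lambda>i j. disjnt (ball (fst i) (snd i)) (ball (fst j) (snd j))) C"
      "negligible (S - (\<Union>i\<in>C. ball (fst i) (snd i)))"
    by (rule Vitali_covering_theorem_balls[of S K fst snd, OF cov])
  let ?U = "\<Union>i\<in>C. ball (fst i) (snd i)"
  have oU: "open ?U" by (intro open_UN) auto
  then have "S - ?U \<in> sets borel" using S by (intro sets.Diff borel_open) auto
  then have "emeasure lborel (S - ?U) = 0"
    using C(4) by (simp add: negligible_iff_null_sets null_sets_completion_iff null_sets_def)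
  have "ball (fst i) (snd i) \<subseteq> S" if "i \<in> C" for i
    using subsetD[OF C(2) that] by (simp add: K_def split_beta)
  then have US: "?U \<subseteq> S" by blast
  have "emeasure lborel S = emeasure lborel (?U \<union> (S - ?U))" using US by (simp add: Un_absorb1)
  also have "\<dots> = emeasure lborel ?U"
  proof (rule emeasure_Un_null_set)
    show "?U \<in> sets lborel" using borel_open[OF oU] by simp
    show "S - ?U \<in> null_sets lborel"
      using \<open>S - ?U \<in> sets borel\<close> \<open>emeasure lborel (S - ?U) = 0\<close> by (simp add: null_sets_def)
  qed
  also have "\<dots> = (\<integral>\<^sup>+i. emeasure lborel (ball (fst i) (snd i)) \<partial>count_space C)"
    using C(1,3) by (intro emeasure_UN_countable) (auto simp: disjoint_family_on_def pairwise_def disjnt_def)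
  also have "\<dots> = (\<integral>\<^sup>+i. emeasure lborel (g -` ball (fst i) (snd i)) \<partial>count_space C)"
    using C(2) by (intro nn_integral_cong) (auto simp: isom_invol_ball[OF g] K_def emeasure_ball)
  also have "\<dots> = emeasure lborel (\<Union>i\<in>C. g -` ball (fst i) (snd i))"
  proof (intro emeasure_UN_countable[symmetric] C(1))
    show "disjoint_family_on (\<lambda>i. g -` ball (fst i) (snd i)) C"
      using C(3) unfolding disjoint_family_on_def pairwise_def disjnt_def by (metis vimage_Int vimage_empty)
  qed (simp add: isom_invol_ball[OF g])
  also have "\<dots> \<le> emeasure lborel (g -` S)"
    using US oS by (intro emeasure_mono) auto
  finally show ?thesis .
qed

lemma distr_isom_invol:
  fixes g :: "'a::euclidean_space \<Rightarrow> 'a"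
  assumes g: "isom_invol g"
  shows "distr lborel borel g = lborel"
proof (rule lborel_eqI[symmetric])
  have gm [measurable]: "g \<in> borel_measurable borel" by (rule isom_invol_measurable[OF g])
  fix l u :: 'a assume le: "\<And>b. b \<in> Basis \<Longrightarrow> l \<bullet> b \<le> u \<bullet> b"
  \<comment> \<open>Applied to the preimage, the inequality gives the opposite one, since the map is
    its own inverse.\<close>
  have "emeasure lborel (g -` box l u) \<le> emeasure lborel (g -` (g -` box l u))"
    by (rule isom_invol_open_le[OF g open_vimage[OF open_box isom_invol_continuous[OF g]]])
  moreover have "g -` (g -` box l u) = box l u" using isom_invol_simps[OF g] by auto
  ultimately have "emeasure lborel (g -` box l u) = emeasure lborel (box l u)"
    using isom_invol_open_le[OF g open_box, of l u] by simp
  then show "emeasure (distr lborel borel g) (box l u) = ennreal (\<Prod>b\<in>Basis. (u - l) \<bullet> b)"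
    using le by (simp add: emeasure_distr)
qed simp

text \<open>The two variables may be moved by different maps: the polarization argument sums the
  energy density over reflections applied to each variable separately.\<close>

lemma distr_isom_invol_pair:
  fixes g h :: "'a::euclidean_space \<Rightarrow> 'a"
  assumes g: "isom_invol g" and h: "isom_invol h"
  shows "distr lborel borel (\<lambda>z. (g (fst z), h (snd z))) = (lborel :: ('a \<times> 'a) measure)"
proof -
  have gm [measurable]: "g \<in> borel_measurable borel" "h \<in> borel_measurable borel"
    using isom_invol_measurable g h by auto
  have "sigma_finite_measure (distr lborel borel h)"
    unfolding distr_isom_invol[OF h] by (rule sigma_finite_lborel)
  then have "distr lborel borel g \<Otimes>\<^sub>M distr lborel borel h
      = distr (lborel \<Otimes>\<^sub>M lborel) (borel \<Otimes>\<^sub>M borel) (\<lambda>(x, y). (g x, h y))"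
    by (intro pair_measure_distr) auto
  then show ?thesis
    by (simp add: distr_isom_invol[OF g] distr_isom_invol[OF h] lborel_prod borel_prod case_prod_unfold)
qed

lemma isom_invol_pair_measurable:
  fixes g h :: "'a::euclidean_space \<Rightarrow> 'a"
  assumes "isom_invol g" "isom_invol h"
  shows "(\<lambda>z. (g (fst z), h (snd z))) \<in> borel_measurable borel"
proof (rule borel_measurable_continuous_onI)
  show "continuous_on UNIV (\<lambda>z. (g (fst z), h (snd z)))"
    by (intro continuous_intros continuous_on_compose2[OF isom_invol_continuous[OF assms(1), of UNIV]]
        continuous_on_compose2[OF isom_invol_continuous[OF assms(2), of UNIV]]) auto
qed

lemma integral_isom_invol_pair:
  fixes F :: "'a::euclidean_space \<times> 'a \<Rightarrow> real"
  assumes g: "isom_invol g" and h: "isom_invol h" and F: "F \<in> borel_measurable borel"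
  shows "(LINT z|lborel. F (g (fst z), h (snd z))) = (LINT z|lborel. F z)"
    "integrable lborel (\<lambda>z. F (g (fst z), h (snd z))) \<longleftrightarrow> integrable lborel F"
proof -
  let ?T = "\<lambda>z. (g (fst z), h (snd z))"
  have T: "?T \<in> measurable lborel borel" using isom_invol_pair_measurable[OF g h] by simp
  show "(LINT z|lborel. F (?T z)) = (LINT z|lborel. F z)"
    using integral_distr[OF T F] by (simp add: distr_isom_invol_pair[OF g h])
  show "integrable lborel (\<lambda>z. F (?T z)) \<longleftrightarrow> integrable lborel F"
    using integrable_distr_eq[OF T F] by (simp add: distr_isom_invol_pair[OF g h])
qed

lemma integral_isom_invol:
  fixes F :: "'a::euclidean_space \<Rightarrow> real"
  assumes g: "isom_invol g" and F: "F \<in> borel_measurable borel"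
  shows "(LINT z|lborel. F (g z)) = (LINT z|lborel. F z)"
    "integrable lborel (\<lambda>z. F (g z)) \<longleftrightarrow> integrable lborel F"
proof -
  have T: "g \<in> measurable lborel borel" using isom_invol_measurable[OF g] by simp
  show "(LINT z|lborel. F (g z)) = (LINT z|lborel. F z)"
    using integral_distr[OF T F] by (simp add: distr_isom_invol[OF g])
  show "integrable lborel (\<lambda>z. F (g z)) \<longleftrightarrow> integrable lborel F"
    using integrable_distr_eq[OF T F] by (simp add: distr_isom_invol[OF g])
qed

lemma AE_isom_invol:
  fixes g :: "'a::euclidean_space \<Rightarrow> 'a"
  assumes g: "isom_invol g" and P: "AE x in lborel. P x"
  shows "AE x in lborel. P (g x)"
proof -
  have T: "g \<in> measurable lborel borel" using isom_invol_measurable[OF g] by simp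
  have "AE x in distr lborel borel g. P x" unfolding distr_isom_invol[OF g] by (rule P)
  from AE_distrD[OF T this] show ?thesis .
qed

lemma frac_integrand_isom_invol:
  assumes "isom_invol g"
  shows "frac_integrand s (\<lambda>x. f (g x)) (\<lambda>x. h (g x)) z = frac_integrand s f h (g (fst z), g (snd z))"
  by (cases z) (simp add: frac_integrand_eq frac_ker_def isom_invol_simps[OF assms])

lemma fin_energy_isom_invol:
  assumes g: "isom_invol g" and f: "f \<in> fin_energy s"
  shows "(\<lambda>x. f (g x)) \<in> fin_energy s"
proof -
  have [measurable]: "g \<in> borel_measurable borel" by (rule isom_invol_measurable[OF g])
  have [measurable]: "f \<in> borel_measurable borel" using f by (simp add: fin_energy_def)
  have "integrable lborel (frac_integrand s (\<lambda>x. f (g x)) (\<lambda>x. f (g x)))"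
    using f integral_isom_invol_pair(2)[OF g g, of "frac_integrand s f f"]
    by (simp add: frac_integrand_isom_invol[OF g, abs_def] fin_energy_def)
  then show ?thesis by (simp add: fin_energy_def)
qed

lemma frac_form_isom_invol:
  assumes g: "isom_invol g" and f: "f \<in> borel_measurable borel" "h \<in> borel_measurable borel"
  shows "frac_form s (\<lambda>x. f (g x)) (\<lambda>x. h (g x)) = frac_form s f h"
  unfolding frac_form_def frac_integrand_isom_invol[OF g]
  using integral_isom_invol_pair(1)[OF g g, of "frac_integrand s f h"] f by simp

lemma l2_form_isom_invol:
  assumes g: "isom_invol g" and [measurable]: "f \<in> borel_measurable borel" "h \<in> borel_measurable borel"
  shows "l2_form (\<lambda>x. f (g x)) (\<lambda>x. h (g x)) = l2_form f h"
  unfolding l2_form_def using integral_isom_invol(1)[OF g, of "\<lambda>x. f x * h x"] by simp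

lemma lip0_isom_invol:
  assumes g: "isom_invol g" and \<Omega>: "\<And>x. x \<in> \<Omega> \<Longrightarrow> g x \<in> \<Omega>" and f: "f \<in> lip0 \<Omega>"
  shows "(\<lambda>x. f (g x)) \<in> lip0 \<Omega>"
proof -
  obtain A K where f: "compact K" "K \<subseteq> \<Omega>" "\<And>x. x \<notin> K \<Longrightarrow> f x = 0"
      "\<And>x y. \<bar>f x - f y\<bar> \<le> A * norm (x - y)" "\<And>x. \<bar>f x\<bar> \<le> A"
    using f unfolding lip0_def by blast
  have "f (g x) = 0" if "x \<notin> g ` K" for x
    using that f(3)[of "g x"] isom_invol_simps(1)[OF g, of x] by (metis imageI)
  moreover have "compact (g ` K)" by (intro compact_continuous_image isom_invol_continuous g f)
  moreover have "\<bar>f (g x) - f (g y)\<bar> \<le> A * norm (x - y)" for x y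
    using f(4)[of "g x" "g y"] by (simp add: isom_invol_simps[OF g])
  ultimately show ?thesis unfolding lip0_def using f(2,5) \<Omega>
    by (intro CollectI exI[of _ A] exI[of _ "g ` K"]) auto
qed

lemma H0s_isom_invol:
  fixes g :: "'a::euclidean_space \<Rightarrow> 'a"
  assumes s: "0 < s" "s < 1" and \<Omega>: "open \<Omega>" "bounded \<Omega>"
    and g: "isom_invol g" and g\<Omega>: "\<And>x. x \<in> \<Omega> \<Longrightarrow> g x \<in> \<Omega>" and f: "f \<in> H0s s \<Omega>"
  shows "(\<lambda>x. f (g x)) \<in> H0s s \<Omega>"
proof -
  interpret E: semi_inner "fin_energy s" "frac_form s :: ('a \<Rightarrow> real) \<Rightarrow> _" by (rule semi_inner_frac_form[OF s])
  obtain \<psi> where \<psi>: "\<And>n. \<psi> n \<in> lip0 \<Omega>"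
    "(\<lambda>n. frac_quad s (\<lambda>x. \<psi> n x - f x)) \<longlonglongrightarrow> 0" using H0s_approx[OF f] by blast
  have F: "f \<in> fin_energy s" "\<psi> n \<in> fin_energy s" for n
    using f H0s_fin_energy \<psi>(1)[of n] lip0_subset_H0s[OF s \<Omega>] by blast+
  have "(\<lambda>x. \<psi> n x - f x) \<in> borel_measurable borel" for n
    using E.diff_in[OF F(2,1)] by (simp add: fin_energy_def)
  then have eq: "frac_quad s (\<lambda>x. \<psi> n (g x) - f (g x))
      = frac_quad s (\<lambda>x. \<psi> n x - f x)" for n
    using frac_form_isom_invol[OF g, of "\<lambda>x. \<psi> n x - f x" "\<lambda>x. \<psi> n x - f x"] by simp
  show ?thesis
  proof (rule H0s_closed[OF s _ _ _ _ \<Omega>, where u = "\<lambda>n x. \<psi> n (g x)"])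
    show "(\<lambda>x. f (g x)) \<in> fin_energy s" by (rule fin_energy_isom_invol[OF g F(1)])
    show "f (g x) = 0" if "x \<notin> \<Omega>" for x
      using H0s_vanish[OF f, of "g x"] that g\<Omega>[of "g x"] isom_invol_simps(1)[OF g] by auto
    show "(\<lambda>x. \<psi> n (g x)) \<in> H0s s \<Omega>" for n
      using lip0_isom_invol[OF g g\<Omega> \<psi>(1)] lip0_subset_H0s[OF s \<Omega>] by blast
    show "(\<lambda>n. frac_quad s (\<lambda>x. \<psi> n (g x) - f (g x))) \<longlonglongrightarrow> 0"
      unfolding eq by (rule \<psi>)
  qed
qed

section \<open>The second eigenvalue\<close>

text \<open>The symmetry is required at every point, not almost everywhere; \<epsilon> will be 1 or
  -1.\<close>

definition H0s_sym :: "real \<Rightarrow> 'a::euclidean_space set \<Rightarrow> ('a \<Rightarrow> 'a) \<Rightarrow> real \<Rightarrow> ('a \<Rightarrow> real) set" where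
  "H0s_sym s \<Omega> g \<epsilon> = {u \<in> H0s s \<Omega>. \<forall>x. u (g x) = \<epsilon> * u x}"

text \<open>The projection onto parity \<epsilon>. It restores exact symmetry where a limit is known
  only up to a null set.\<close>

definition sym_part :: "('a \<Rightarrow> 'a) \<Rightarrow> real \<Rightarrow> ('a \<Rightarrow> real) \<Rightarrow> 'a \<Rightarrow> real" where
  "sym_part g \<epsilon> f x = (1 / 2) * f x + (\<epsilon> / 2) * f (g x)"

context
  fixes s :: real and \<Omega> :: "'a::euclidean_space set"
  assumes s: "0 < s" "s < 1" and \<Omega>: "open \<Omega>" "\<Omega> \<subseteq> ball 0 1"
begin

lemma H0s_sq_int: "f \<in> H0s s \<Omega> \<Longrightarrow> f \<in> sq_int"
  using poincare[OF s, where 'a='a] H0s_fin_energy H0s_vanish \<Omega>(2) by (metis subsetD)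

lemma weak_solution_iff:
  "weak_solution s \<Omega> \<mu> \<phi> \<longleftrightarrow> \<phi> \<in> H0s s \<Omega> \<and> (\<forall>\<psi>\<in>H0s s \<Omega>. frac_form s \<phi> \<psi> = \<mu> * l2_form \<phi> \<psi>)"
proof -
  have "(LINT x:\<Omega>|lborel. \<phi> x * \<psi> x) = l2_form \<phi> \<psi>" if "\<phi> \<in> H0s s \<Omega>" for \<phi> \<psi>
    unfolding set_lebesgue_integral_def l2_form_def using H0s_vanish[OF that]
    by (intro Bochner_Integration.integral_cong) (auto simp: indicator_def)
  then show ?thesis unfolding weak_solution_def by metis
qed

lemma l2_form_pos_iff:
  assumes "\<phi> \<in> H0s s \<Omega>"
  shows "nontrivial \<phi> \<longleftrightarrow> 0 < l2_form \<phi> \<phi>"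
proof -
  have i: "integrable lborel (\<lambda>x. \<phi> x * \<phi> x)" using H0s_sq_int[OF assms] by (simp add: sq_int_def)
  have "l2_form \<phi> \<phi> = 0 \<longleftrightarrow> (AE x in lborel. \<phi> x * \<phi> x = 0)"
    unfolding l2_form_def by (rule integral_nonneg_eq_0_iff_AE[OF i]) simp
  moreover have "0 \<le> l2_form \<phi> \<phi>" using semi_inner.nonneg[OF semi_inner_l2_form H0s_sq_int[OF assms]] .
  ultimately show ?thesis unfolding nontrivial_def by auto
qed

end

lemma bounded_domain: "\<Omega> \<subseteq> ball 0 1 \<Longrightarrow> bounded \<Omega>"
  using bounded_ball bounded_subset by blast

context
  fixes s :: real and \<Omega> :: "'a::euclidean_space set" and g :: "'a \<Rightarrow> 'a"
  assumes s: "0 < s" "s < 1" and \<Omega>: "open \<Omega>" "\<Omega> \<subseteq> ball 0 1"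
    and g: "isom_invol g" and g\<Omega>: "\<And>x. x \<in> \<Omega> \<Longrightarrow> g x \<in> \<Omega>"
begin

interpretation E: semi_inner "fin_energy s" "frac_form s :: ('a \<Rightarrow> real) \<Rightarrow> _" by (rule semi_inner_frac_form[OF s])
interpretation L: semi_inner sq_int "l2_form :: ('a \<Rightarrow> real) \<Rightarrow> _" by (rule semi_inner_l2_form)

lemma sym_part_sym: "\<epsilon>\<^sup>2 = 1 \<Longrightarrow> sym_part g \<epsilon> f (g x) = \<epsilon> * sym_part g \<epsilon> f x"
  by (simp add: sym_part_def isom_invol_simps[OF g] algebra_simps power2_eq_square)

lemma sym_part_H0s:
  assumes "\<epsilon>\<^sup>2 = 1" "f \<in> H0s s \<Omega>"
  shows "sym_part g \<epsilon> f \<in> H0s_sym s \<Omega> g \<epsilon>"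
proof -
  have "(\<lambda>x. (1 / 2) * f x + (\<epsilon> / 2) * f (g x)) \<in> H0s s \<Omega>"
    by (intro H0s_lincomb[OF s \<Omega>(1) bounded_domain[OF \<Omega>(2)]] H0s_isom_invol[OF s \<Omega>(1) bounded_domain[OF \<Omega>(2)] g] g\<Omega> assms)
  then show ?thesis using sym_part_sym[OF assms(1)] by (simp add: H0s_sym_def sym_part_def[abs_def])
qed

lemma sym_part_lip0: "f \<in> lip0 \<Omega> \<Longrightarrow> sym_part g \<epsilon> f \<in> lip0 \<Omega>"
  unfolding sym_part_def[abs_def] by (intro lip0_lincomb lip0_isom_invol[OF g] g\<Omega>)

text \<open>Symmetric criticality: by invariance of the form, pairing with a function of parity
  \<epsilon> sees only the part of \<open>f\<close> of that parity. A critical point within one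
  parity is then critical among all functions.\<close>

lemma frac_form_sym_part:
  assumes "u \<in> fin_energy s" "\<And>x. u (g x) = \<epsilon> * u x" "\<epsilon>\<^sup>2 = 1" "f \<in> fin_energy s"
  shows "frac_form s u (sym_part g \<epsilon> f) = frac_form s u f"
proof -
  have fg: "(\<lambda>x. f (g x)) \<in> fin_energy s" by (rule fin_energy_isom_invol[OF g assms(4)])
  have m: "u \<in> borel_measurable borel" "f \<in> borel_measurable borel" using assms by (auto simp: fin_energy_def)
  have "frac_form s u f = frac_form s (\<lambda>x. u (g x)) (\<lambda>x. f (g x))"
    by (rule frac_form_isom_invol[OF g m, symmetric])
  also have "\<dots> = \<epsilon> * frac_form s u (\<lambda>x. f (g x))"
    using E.lin[OF assms(1) assms(1) fg, of \<epsilon> 0] assms(2) by simp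
  finally have "frac_form s u f = \<epsilon> * frac_form s u (\<lambda>x. f (g x))" .
  moreover have "frac_form s u (sym_part g \<epsilon> f) = (1 / 2) * frac_form s u f + (\<epsilon> / 2) * frac_form s u (\<lambda>x. f (g x))"
    unfolding sym_part_def[abs_def]
    using E.lin[OF assms(4) fg assms(1), of "1 / 2" "\<epsilon> / 2"]
      E.sym[OF assms(1) E.lincomb[OF assms(4) fg, of "1 / 2" "\<epsilon> / 2"]] E.sym[OF assms(1) assms(4)] E.sym[OF assms(1) fg] by simp
  ultimately show ?thesis by simp
qed

lemma sq_int_isom_invol:
  assumes "f \<in> sq_int"
  shows "(\<lambda>x. f (g x)) \<in> sq_int"
proof -
  have m: "f \<in> borel_measurable borel" using assms by (auto simp: sq_int_def)
  have [measurable]: "g \<in> borel_measurable borel" by (rule isom_invol_measurable[OF g])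
  show ?thesis using integral_isom_invol(2)[OF g, of "\<lambda>x. f x * f x"] assms m by (simp add: sq_int_def)
qed

lemma l2_form_sym_part:
  assumes "u \<in> sq_int" "\<And>x. u (g x) = \<epsilon> * u x" "\<epsilon>\<^sup>2 = 1" "f \<in> sq_int"
  shows "l2_form u (sym_part g \<epsilon> f) = l2_form u f"
proof -
  have fg: "(\<lambda>x. f (g x)) \<in> sq_int" by (rule sq_int_isom_invol[OF assms(4)])
  have m: "u \<in> borel_measurable borel" "f \<in> borel_measurable borel" using assms by (auto simp: sq_int_def)
  have "l2_form u f = l2_form (\<lambda>x. u (g x)) (\<lambda>x. f (g x))"
    by (rule l2_form_isom_invol[OF g m, symmetric])
  also have "\<dots> = \<epsilon> * l2_form u (\<lambda>x. f (g x))"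
    using L.lin[OF assms(1) assms(1) fg, of \<epsilon> 0] assms(2) by simp
  finally have "l2_form u f = \<epsilon> * l2_form u (\<lambda>x. f (g x))" .
  moreover have "l2_form u (sym_part g \<epsilon> f) = (1 / 2) * l2_form u f + (\<epsilon> / 2) * l2_form u (\<lambda>x. f (g x))"
    unfolding sym_part_def[abs_def]
    using L.lin[OF assms(4) fg assms(1), of "1 / 2" "\<epsilon> / 2"]
      L.sym[OF assms(1) L.lincomb[OF assms(4) fg, of "1 / 2" "\<epsilon> / 2"]] L.sym[OF assms(1) assms(4)] L.sym[OF assms(1) fg] by simp
  ultimately show ?thesis by simp
qed

lemma frac_form_sym_part_le:
  assumes "\<epsilon>\<^sup>2 = 1" "f \<in> fin_energy s"
  shows "frac_quad s (sym_part g \<epsilon> f) \<le> frac_form s f f"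
proof -
  have fg: "(\<lambda>x. f (g x)) \<in> fin_energy s" by (rule fin_energy_isom_invol[OF g assms(2)])
  have m: "f \<in> borel_measurable borel" using assms by (auto simp: fin_energy_def)
  have e: "frac_quad s (\<lambda>x. f (g x)) = frac_form s f f" by (rule frac_form_isom_invol[OF g m m])
  have "0 \<le> frac_quad s (\<lambda>x. 1 * f x + (- \<epsilon>) * f (g x))"
    by (rule E.nonneg[OF E.lincomb[OF assms(2) fg]])
  then have "2 * \<epsilon> * frac_form s f (\<lambda>x. f (g x)) \<le> 2 * frac_form s f f"
    unfolding E.expand[OF assms(2) fg] e using assms(1) by simp
  moreover have "frac_quad s (sym_part g \<epsilon> f)
      = (1 / 4) * frac_form s f f + (\<epsilon> / 2) * frac_form s f (\<lambda>x. f (g x)) + (1 / 4) * frac_form s f f"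
    unfolding sym_part_def[abs_def] E.expand[OF assms(2) fg] e using assms(1) by (simp add: power_divide)
  ultimately show ?thesis by simp
qed

text \<open>Project any approximating sequence: the projection does not increase the energy of the
  error, and it fixes the limit.\<close>

lemma H0s_sym_approx:
  assumes \<epsilon>: "\<epsilon>\<^sup>2 = 1" and u: "u \<in> H0s_sym s \<Omega> g \<epsilon>"
  obtains \<psi> where "\<And>n. \<psi> n \<in> lip0 \<Omega>" "\<And>n x. \<psi> n (g x) = \<epsilon> * \<psi> n x"
    "(\<lambda>n. frac_quad s (\<lambda>x. \<psi> n x - u x)) \<longlonglongrightarrow> 0"
proof -
  have uH: "u \<in> H0s s \<Omega>" using u by (simp add: H0s_sym_def)
  obtain \<psi> where \<psi>: "\<And>n. \<psi> n \<in> lip0 \<Omega>"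
    "(\<lambda>n. frac_quad s (\<lambda>x. \<psi> n x - u x)) \<longlonglongrightarrow> 0" using H0s_approx[OF uH] by blast
  have F: "u \<in> fin_energy s" "\<psi> n \<in> fin_energy s" for n
    using uH H0s_fin_energy \<psi>(1)[of n] lip0_subset_H0s[OF s \<Omega>(1) bounded_domain[OF \<Omega>(2)]] by blast+
  have "sym_part g \<epsilon> (\<lambda>x. \<psi> n x - u x) x = sym_part g \<epsilon> (\<psi> n) x - u x" for n x
    using u \<epsilon> by (simp add: sym_part_def H0s_sym_def algebra_simps power2_eq_square)
  then have eq: "(\<lambda>x. sym_part g \<epsilon> (\<psi> n) x - u x) = sym_part g \<epsilon> (\<lambda>x. \<psi> n x - u x)" for n
    by (simp add: fun_eq_iff)
  have "(\<lambda>n. frac_quad s (\<lambda>x. sym_part g \<epsilon> (\<psi> n) x - u x)) \<longlonglongrightarrow> 0"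
  proof (rule tendsto_sandwich[OF _ _ tendsto_const \<psi>(2)])
    have pF: "sym_part g \<epsilon> (\<psi> n) \<in> fin_energy s" for n
      using H0s_fin_energy sym_part_lip0[OF \<psi>(1)] lip0_subset_H0s[OF s \<Omega>(1) bounded_domain[OF \<Omega>(2)]] by blast
    show "\<forall>\<^sub>F n in sequentially. 0 \<le> frac_quad s (\<lambda>x. sym_part g \<epsilon> (\<psi> n) x - u x)"
      by (intro always_eventually allI E.nonneg E.diff_in pF F)
    show "\<forall>\<^sub>F n in sequentially. frac_quad s (\<lambda>x. sym_part g \<epsilon> (\<psi> n) x - u x)
        \<le> frac_quad s (\<lambda>x. \<psi> n x - u x)"
      unfolding eq by (intro always_eventually allI frac_form_sym_part_le[OF \<epsilon>] E.diff_in F)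
  qed
  then show ?thesis using that[of "\<lambda>n. sym_part g \<epsilon> (\<psi> n)"] sym_part_lip0[OF \<psi>(1)] sym_part_sym[OF \<epsilon>] by blast
qed

lemma compact_form_H0s_sym:
  assumes \<epsilon>: "\<epsilon>\<^sup>2 = 1"
  shows "\<exists>C. compact_form (H0s_sym s \<Omega> g \<epsilon>) (frac_form s) l2_form C"
proof -
  let ?V = "H0s_sym s \<Omega> g \<epsilon>"
  obtain C where C: "0 \<le> C" "\<And>f :: 'a \<Rightarrow> real. f \<in> fin_energy s \<Longrightarrow>
    (\<And>x. x \<notin> ball 0 1 \<Longrightarrow> f x = 0) \<Longrightarrow> f \<in> sq_int \<and> l2_form f f \<le> C * frac_form s f f"
    using poincare[OF s] by metis
  have VF: "f \<in> fin_energy s" "f \<in> sq_int" "f \<in> H0s s \<Omega>" if "f \<in> ?V" for f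
    using that H0s_fin_energy H0s_sq_int[OF s \<Omega>] by (auto simp: H0s_sym_def)
  have V0: "f x = 0" if "f \<in> ?V" "x \<notin> ball 0 1" for f x
    using H0s_vanish[OF VF(3)[OF that(1)]] that(2) \<Omega>(2) by blast
  have lc: "(\<lambda>x. a * f x + b * h x) \<in> ?V" if "f \<in> ?V" "h \<in> ?V" for a b f h
    using that H0s_lincomb[OF s \<Omega>(1) bounded_domain[OF \<Omega>(2)]] by (auto simp: H0s_sym_def algebra_simps)
  have "compact_form ?V (frac_form s) l2_form C"
  proof
    show "\<exists>w\<in>?V. (\<lambda>n. frac_quad s (\<lambda>x. u n x - w x)) \<longlonglongrightarrow> 0"
      if u: "\<And>n. u n \<in> ?V" and cau: "\<And>e. 0 < e \<Longrightarrow> \<exists>N. \<forall>j\<ge>N. \<forall>k\<ge>N. frac_quad s (\<lambda>x. u j x - u k x) < e" for u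
    proof -
      obtain w where w: "w \<in> H0s s \<Omega>" "(\<lambda>n. frac_quad s (\<lambda>x. u n x - w x)) \<longlonglongrightarrow> 0"
        using H0s_complete[OF s \<Omega> VF(3)[OF u] cau] by blast
      have F: "u n \<in> fin_energy s" "w \<in> fin_energy s" for n using VF(1)[OF u] w(1) H0s_fin_energy by auto
      \<comment> \<open>The energy determines \<open>w\<close> only up to a null set, where the
        symmetry may fail; the projection of \<open>w\<close> has the symmetry and is still a
        limit.\<close>
      have wV: "sym_part g \<epsilon> w \<in> ?V" by (rule sym_part_H0s[OF \<epsilon> w(1)])
      have "sym_part g \<epsilon> (\<lambda>x. u n x - w x) x = u n x - sym_part g \<epsilon> w x" for n x
      proof -
        have a: "u n (g x) = \<epsilon> * u n x" using u[of n] by (simp add: H0s_sym_def)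
        have b: "(\<epsilon> / 2) * (\<epsilon> * u n x) = (1 / 2) * u n x"
          using \<epsilon> by (simp add: power2_eq_square mult.assoc[symmetric])
        show ?thesis unfolding sym_part_def a right_diff_distrib b by simp
      qed
      then have eq: "(\<lambda>x. u n x - sym_part g \<epsilon> w x) = sym_part g \<epsilon> (\<lambda>x. u n x - w x)" for n
        by (simp add: fun_eq_iff)
      have "(\<lambda>n. frac_quad s (\<lambda>x. u n x - sym_part g \<epsilon> w x)) \<longlonglongrightarrow> 0"
      proof (rule tendsto_sandwich[OF _ _ tendsto_const w(2)])
        show "\<forall>\<^sub>F n in sequentially. 0 \<le> frac_quad s (\<lambda>x. u n x - sym_part g \<epsilon> w x)"
          by (intro always_eventually allI E.nonneg E.diff_in VF(1)[OF wV] F)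
        show "\<forall>\<^sub>F n in sequentially. frac_quad s (\<lambda>x. u n x - sym_part g \<epsilon> w x)
          \<le> frac_quad s (\<lambda>x. u n x - w x)"
          unfolding eq by (intro always_eventually allI frac_form_sym_part_le[OF \<epsilon>] E.diff_in F)
      qed
      then show ?thesis using wV by blast
    qed
    show "\<exists>r::nat \<Rightarrow> nat. strict_mono r \<and> (\<forall>e>0. \<exists>N. \<forall>j\<ge>N. \<forall>k\<ge>N.
        l2_quad (\<lambda>x. u (r j) x - u (r k) x) < e)"
      if u: "\<And>n. u n \<in> ?V" "\<And>n. frac_quad s (u n) \<le> M" for u :: "nat \<Rightarrow> 'a \<Rightarrow> real" and M
      by (rule energy_compact[OF s VF(1)[OF u(1)] V0[OF u(1)] u(2)])
    show "l2_form f f \<le> C * frac_form s f f" if "f \<in> ?V" for f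
      using C(2)[OF VF(1)[OF that] V0[OF that]] by blast
  qed (assumption | rule lc E.lin E.sym E.nonneg L.lin L.sym L.nonneg VF(1) VF(2))+
  then show ?thesis by blast
qed

text \<open>The minimizer satisfies its equation against functions of parity \<epsilon>, and
  symmetric criticality extends it to every test function. A minimum over one parity is thus an
  eigenvalue of the full problem.\<close>

lemma minimizer_weak_solution:
  assumes \<epsilon>: "\<epsilon>\<^sup>2 = 1" and f0: "f0 \<in> H0s_sym s \<Omega> g \<epsilon>" "0 < l2_form f0 f0"
  obtains u m where "u \<in> H0s_sym s \<Omega> g \<epsilon>" "weak_solution s \<Omega> m u" "0 < l2_form u u"
    "\<And>v. v \<in> H0s_sym s \<Omega> g \<epsilon> \<Longrightarrow> m * l2_form v v \<le> frac_form s v v"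
proof -
  let ?V = "H0s_sym s \<Omega> g \<epsilon>"
  obtain C where "compact_form ?V (frac_form s) l2_form C" using compact_form_H0s_sym[OF \<epsilon>] by blast
  then interpret V: compact_form ?V "frac_form s" l2_form C .
  obtain u m where u: "u \<in> ?V" "0 < l2_form u u" "\<And>v. v \<in> ?V \<Longrightarrow> frac_form s u v = m * l2_form u v"
    "\<And>v. v \<in> ?V \<Longrightarrow> m * l2_form v v \<le> frac_form s v v"
    using V.minimizer_exists[OF f0] by blast
  have uH: "u \<in> H0s s \<Omega>" "\<And>x. u (g x) = \<epsilon> * u x" using u(1) by (auto simp: H0s_sym_def)
  have "frac_form s u \<psi> = m * l2_form u \<psi>" if \<psi>: "\<psi> \<in> H0s s \<Omega>" for \<psi>
    using u(3)[OF sym_part_H0s[OF \<epsilon> \<psi>]]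
      frac_form_sym_part[OF H0s_fin_energy[OF uH(1)] uH(2) \<epsilon> H0s_fin_energy[OF \<psi>]]
      l2_form_sym_part[OF H0s_sq_int[OF s \<Omega> uH(1)] uH(2) \<epsilon> H0s_sq_int[OF s \<Omega> \<psi>]] by simp
  then have "weak_solution s \<Omega> m u" using uH by (simp add: weak_solution_iff[OF s \<Omega>])
  then show ?thesis using that u by blast
qed

end

text \<open>With the identity as involution and \<epsilon> = 1 the symmetric space is all of
  \<open>H0s\<close>, and \<open>finite_spectrum\<close> applies. The minimum in the definition of
  \<open>frac_lambda\<close> is attained because of this.\<close>

lemma finite_eigenvalues:
  fixes \<Omega> :: "'a::euclidean_space set"
  assumes s: "0 < s" "s < 1" and \<Omega>: "open \<Omega>" "\<Omega> \<subseteq> ball 0 1"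
  shows "finite {\<mu>. \<mu> \<le> M \<and> frac_eigenvalue s \<Omega> \<mu>}"
proof -
  obtain C where "compact_form (H0s_sym s \<Omega> (\<lambda>x. x) 1) (frac_form s) l2_form C"
    using compact_form_H0s_sym[OF s \<Omega> isom_invol_id, where \<epsilon> = 1] by auto
  then interpret V: compact_form "H0s_sym s \<Omega> (\<lambda>x. x) 1" "frac_form s" l2_form C .
  have "H0s_sym s \<Omega> (\<lambda>x. x) 1 = H0s s \<Omega>" by (simp add: H0s_sym_def)
  then have "{\<mu>. \<mu> \<le> M \<and> frac_eigenvalue s \<Omega> \<mu>}
      = {\<mu>. \<mu> \<le> M \<and> (\<exists>u\<in>H0s_sym s \<Omega> (\<lambda>x. x) 1. 0 < l2_form u u \<and>
          (\<forall>v\<in>H0s_sym s \<Omega> (\<lambda>x. x) 1. frac_form s u v = \<mu> * l2_form u v))}"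
    unfolding frac_eigenvalue_def weak_solution_iff[OF s \<Omega>]
    using l2_form_pos_iff[OF s \<Omega>] by auto
  then show ?thesis using V.finite_spectrum by simp
qed

section \<open>Multiplicities and the variational bound for the second eigenvalue\<close>

lemma frac_multiplicity_ge:
  assumes "\<And>i. i < m \<Longrightarrow> weak_solution s \<Omega> \<mu> (\<phi> i)" "ae_independent m \<phi>"
  shows "enat m \<le> frac_multiplicity s \<Omega> \<mu>"
  unfolding frac_multiplicity_def using assms by (intro Sup_upper) auto

lemma frac_multiplicity_ge_1:
  assumes "weak_solution s \<Omega> \<mu> \<phi>" "nontrivial \<phi>"
  shows "enat 1 \<le> frac_multiplicity s \<Omega> \<mu>"
proof (rule frac_multiplicity_ge[of _ _ _ _ "\<lambda>_. \<phi>"])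
  show "ae_independent 1 (\<lambda>_. \<phi>)"
    unfolding ae_independent_def
  proof (intro allI impI)
    fix c :: "nat \<Rightarrow> real" and i :: nat
    assume a: "AE x in lborel. (\<Sum>i<1. c i * \<phi> x) = 0" and i: "i < 1"
    have "c 0 = 0"
    proof (rule ccontr)
      assume "c 0 \<noteq> 0"
      then have "AE x in lborel. \<phi> x = 0" using a by auto
      then show False using assms(2) by (simp add: nontrivial_def)
    qed
    then show "c i = 0" using i by simp
  qed
qed (use assms in auto)

lemma frac_form_abs_le:
  fixes f :: "'a::euclidean_space \<Rightarrow> real"
  assumes s: "0 < s" "s < 1" and f: "f \<in> fin_energy s" "(\<lambda>x. \<bar>f x\<bar>) \<in> fin_energy s"
  shows "frac_quad s (\<lambda>x. \<bar>f x\<bar>) \<le> frac_form s f f"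
proof -
  have "(LINT z|lborel. frac_integrand s (\<lambda>x. \<bar>f x\<bar>) (\<lambda>x. \<bar>f x\<bar>) z) \<le> (LINT z|lborel. frac_integrand s f f z)"
  proof (rule integral_mono)
    fix z :: "'a \<times> 'a"
    obtain x y where z: "z = (x, y)" by force
    have "\<bar>\<bar>f x\<bar> - \<bar>f y\<bar>\<bar> \<le> \<bar>f x - f y\<bar>" by (rule abs_triangle_ineq3)
    then have "(\<bar>f x\<bar> - \<bar>f y\<bar>)\<^sup>2 \<le> (f x - f y)\<^sup>2" by (simp add: abs_le_square_iff)
    then show "frac_integrand s (\<lambda>x. \<bar>f x\<bar>) (\<lambda>x. \<bar>f x\<bar>) z \<le> frac_integrand s f f z"
      unfolding z frac_integrand_eq power2_eq_square[symmetric] by (rule mult_right_mono[OF _ frac_ker_nonneg])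
  qed (use f in \<open>auto simp: fin_energy_def\<close>)
  then show ?thesis
    unfolding frac_form_def using frac_const_pos[OF s, where 'a='a] by (intro mult_left_mono) auto
qed

lemma H0s_l2_tendsto:
  fixes \<Omega> :: "'a::euclidean_space set"
  assumes s: "0 < s" "s < 1" and \<Omega>: "open \<Omega>" "\<Omega> \<subseteq> ball 0 1"
    and u: "\<And>n. u n \<in> H0s s \<Omega>" "w \<in> H0s s \<Omega>"
    and lim: "(\<lambda>n. frac_quad s (\<lambda>x. u n x - w x)) \<longlonglongrightarrow> 0"
  shows "(\<lambda>n. l2_quad (\<lambda>x. u n x - w x)) \<longlonglongrightarrow> 0"
proof -
  obtain C where C: "0 \<le> C" "\<And>f :: 'a \<Rightarrow> real. f \<in> fin_energy s \<Longrightarrow>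
    (\<And>x. x \<notin> ball 0 1 \<Longrightarrow> f x = 0) \<Longrightarrow> f \<in> sq_int \<and> l2_form f f \<le> C * frac_form s f f"
    using poincare[OF s] by metis
  have z: "u n x - w x = 0" if "x \<notin> ball 0 1" for n x
  proof -
    have "x \<notin> \<Omega>" using that \<Omega>(2) by blast
    then show ?thesis using H0s_vanish[OF u(1)] H0s_vanish[OF u(2)] by simp
  qed
  have d: "(\<lambda>x. u n x - w x) \<in> fin_energy s" for n
    by (intro semi_inner.diff_in[OF semi_inner_frac_form[OF s]] H0s_fin_energy[OF u(1)] H0s_fin_energy[OF u(2)])
  show ?thesis
  proof (rule tendsto_sandwich[OF _ _ tendsto_const])
    show "(\<lambda>n. C * frac_quad s (\<lambda>x. u n x - w x)) \<longlonglongrightarrow> 0"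
      using tendsto_mult_left[OF lim, of C] by simp
    show "\<forall>\<^sub>F n in sequentially. 0 \<le> l2_quad (\<lambda>x. u n x - w x)"
      unfolding l2_form_def by (intro always_eventually allI integral_nonneg_AE) auto
    show "\<forall>\<^sub>F n in sequentially. l2_quad (\<lambda>x. u n x - w x) \<le> C * frac_quad s (\<lambda>x. u n x - w x)"
      using C(2)[OF d z] by (intro always_eventually allI) blast
  qed
qed

text \<open>Orthogonality to the first eigenfunction is replaced by antisymmetry: the minimizers over the
  symmetric and over the antisymmetric functions are two independent eigenfunctions.\<close>

theorem frac_lambda_2:
  fixes \<Omega> :: "'a::euclidean_space set"
  assumes s: "0 < s" "s < 1" and \<Omega>: "open \<Omega>" "\<Omega> \<subseteq> ball 0 1"
    and g: "isom_invol g" and g\<Omega>: "\<And>x. x \<in> \<Omega> \<Longrightarrow> g x \<in> \<Omega>"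
    and f0: "f0 \<in> lip0 \<Omega>" "\<And>x. f0 (g x) = - f0 x" "0 < l2_form f0 f0"
  shows "frac_eigenvalue s \<Omega> (frac_lambda 2 s \<Omega>)"
    "\<And>v. v \<in> H0s s \<Omega> \<Longrightarrow> (\<And>x. v (g x) = - v x) \<Longrightarrow> frac_lambda 2 s \<Omega> * l2_form v v \<le> frac_form s v v"
proof -
  interpret E: semi_inner "fin_energy s" "frac_form s :: ('a \<Rightarrow> real) \<Rightarrow> _" by (rule semi_inner_frac_form[OF s])
  interpret L: semi_inner sq_int "l2_form :: ('a \<Rightarrow> real) \<Rightarrow> _" by (rule semi_inner_l2_form)
  note ctx = s \<Omega> g g\<Omega>
  have b\<Omega>: "bounded \<Omega>" using \<Omega>(2) bounded_ball bounded_subset by blast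
  have lipH: "f \<in> H0s s \<Omega>" if "f \<in> lip0 \<Omega>" for f using lip0_subset_H0s[OF s \<Omega>(1) b\<Omega>] that by blast
  have absL: "l2_quad (\<lambda>x. \<bar>f x\<bar>) = l2_form f f" for f :: "'a \<Rightarrow> real" by (simp add: l2_form_def)
  have "f0 \<in> H0s_sym s \<Omega> g (-1)" using lipH[OF f0(1)] f0(2) by (simp add: H0s_sym_def)
  then obtain u m where u: "u \<in> H0s_sym s \<Omega> g (-1)" "weak_solution s \<Omega> m u" "0 < l2_form u u"
    "\<And>v. v \<in> H0s_sym s \<Omega> g (-1) \<Longrightarrow> m * l2_form v v \<le> frac_form s v v"
    using minimizer_weak_solution[OF ctx, of "-1" f0] f0(3) by auto
  \<comment> \<open>The absolute value of an odd function is even, so the symmetric class contains a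
    nontrivial function as well.\<close>
  have "(\<lambda>x. \<bar>f0 x\<bar>) \<in> H0s_sym s \<Omega> g 1" using lipH[OF lip0_abs[OF f0(1)]] f0(2) by (simp add: H0s_sym_def)
  then obtain w m1 where w: "w \<in> H0s_sym s \<Omega> g 1" "weak_solution s \<Omega> m1 w" "0 < l2_form w w"
    "\<And>v. v \<in> H0s_sym s \<Omega> g 1 \<Longrightarrow> m1 * l2_form v v \<le> frac_form s v v"
    using minimizer_weak_solution[OF ctx, of 1 "\<lambda>x. \<bar>f0 x\<bar>"] f0(3) absL[of f0] by auto
  have uH: "u \<in> H0s s \<Omega>" "\<And>x. u (g x) = - u x" and wH: "w \<in> H0s s \<Omega>" "\<And>x. w (g x) = w x"
    using u(1) w(1) by (auto simp: H0s_sym_def)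
  note uS = H0s_sq_int[OF s \<Omega> uH(1)] and wS = H0s_sq_int[OF s \<Omega> wH(1)]
  have nt: "nontrivial u" "nontrivial w"
    using l2_form_pos_iff[OF s \<Omega>] uH wH u(3) w(3) by auto
  have orth: "l2_form u w = 0"
  proof -
    have "l2_form (\<lambda>x. u (g x)) (\<lambda>x. w (g x)) = l2_form u w"
      using uS wS by (intro l2_form_isom_invol[OF g]) (auto simp: sq_int_def)
    then show ?thesis using uH(2) wH(2) by (simp add: l2_form_def)
  qed
  \<comment> \<open>Absolute values make an odd function even without raising its energy. They are
    taken of Lipschitz approximants, for which membership in \<open>H0s\<close> is at hand.\<close>
  have m1m: "m1 \<le> m"
  proof -
    obtain \<psi> where \<psi>: "\<And>n. \<psi> n \<in> lip0 \<Omega>" "\<And>n x. \<psi> n (g x) = - 1 * \<psi> n x"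
      "(\<lambda>n. frac_quad s (\<lambda>x. \<psi> n x - u x)) \<longlonglongrightarrow> 0"
      using H0s_sym_approx[OF ctx _ u(1)] by auto
    have F: "\<psi> n \<in> fin_energy s" "u \<in> fin_energy s" for n
      using H0s_fin_energy lipH \<psi>(1) uH(1) by blast+
    have S: "\<psi> n \<in> sq_int" for n using H0s_sq_int[OF s \<Omega> lipH[OF \<psi>(1)]] .
    have limL: "(\<lambda>n. l2_quad (\<lambda>x. \<psi> n x - u x)) \<longlonglongrightarrow> 0"
      by (rule H0s_l2_tendsto[OF s \<Omega> lipH[OF \<psi>(1)] uH(1) \<psi>(3)])
    have "m1 * l2_quad (\<psi> n) \<le> frac_quad s (\<psi> n)" for n
    proof -
      have a: "(\<lambda>x. \<bar>\<psi> n x\<bar>) \<in> H0s s \<Omega>" by (rule lipH[OF lip0_abs[OF \<psi>(1)]])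
      then have "(\<lambda>x. \<bar>\<psi> n x\<bar>) \<in> H0s_sym s \<Omega> g 1" using \<psi>(2) by (simp add: H0s_sym_def)
      from w(4)[OF this] show ?thesis
        using frac_form_abs_le[OF s F(1) H0s_fin_energy[OF a]] absL[of "\<psi> n"] by simp
    qed
    then have "m1 * l2_form u u \<le> frac_form s u u"
      using L.tendsto_diag[OF S uS limL] E.tendsto_diag[OF F \<psi>(3)]
      by (intro LIMSEQ_le[OF tendsto_mult_left]) auto
    also have "\<dots> = m * l2_form u u" using u(2) uH(1) by (simp add: weak_solution_iff[OF s \<Omega>])
    finally show ?thesis using u(3) by simp
  qed
  define P where "P \<mu> \<longleftrightarrow> frac_eigenvalue s \<Omega> \<mu> \<and>
     (\<exists>F. finite F \<and> F \<subseteq> {\<nu>. frac_eigenvalue s \<Omega> \<nu> \<and> \<nu> \<le> \<mu>} \<and>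
          enat 2 \<le> (\<Sum>\<nu>\<in>F. frac_multiplicity s \<Omega> \<nu>))" for \<mu>
  have ev: "frac_eigenvalue s \<Omega> m" "frac_eigenvalue s \<Omega> m1"
    using u(2) w(2) nt by (auto simp: frac_eigenvalue_def)
  \<comment> \<open>If the two minima coincide, the eigenspace has dimension at least 2; otherwise
    two eigenvalues up to \<open>m\<close> contribute at least one each.\<close>
  have Pm: "P m"
  proof (cases "m1 = m")
    case True
    define \<phi> where "\<phi> i = (if i = 0 then u else w)" for i :: nat
    have "ae_independent 2 \<phi>"
      unfolding ae_independent_def
    proof (intro allI impI)
      fix c :: "nat \<Rightarrow> real" and i :: nat
      assume a: "AE x in lborel. (\<Sum>i<2. c i * \<phi> i x) = 0" and i: "i < 2"
      have a': "AE x in lborel. c 0 * u x + c 1 * w x = 0"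
        using a by (simp add: numeral_2_eq_2 \<phi>_def)
      have z: "l2_form (\<lambda>x. c 0 * u x + c 1 * w x) h = 0" for h
        unfolding l2_form_def by (rule integral_eq_zero_AE) (use a' in \<open>auto elim: eventually_mono\<close>)
      have "c 0 * l2_form u u = 0"
        using z[of u] L.lin[OF uS wS uS, of "c 0" "c 1"] orth L.sym[OF uS wS] by simp
      moreover have "c 1 * l2_form w w = 0"
        using z[of w] L.lin[OF uS wS wS, of "c 0" "c 1"] orth by simp
      ultimately have "c 0 = 0" "c 1 = 0" using u(3) w(3) by auto
      then show "c i = 0" using i by (cases i) auto
    qed
    moreover have "weak_solution s \<Omega> m (\<phi> i)" for i using u(2) w(2) True by (simp add: \<phi>_def)
    ultimately have "enat 2 \<le> frac_multiplicity s \<Omega> m" by (intro frac_multiplicity_ge) auto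
    then show ?thesis unfolding P_def using ev by (intro conjI exI[of _ "{m}"]) auto
  next
    case False
    have "enat 2 = enat 1 + enat 1" by simp
    also have "\<dots> \<le> frac_multiplicity s \<Omega> m + frac_multiplicity s \<Omega> m1"
      by (intro add_mono frac_multiplicity_ge_1[OF u(2) nt(1)] frac_multiplicity_ge_1[OF w(2) nt(2)])
    also have "\<dots> = (\<Sum>\<nu>\<in>{m, m1}. frac_multiplicity s \<Omega> \<nu>)" using False by simp
    finally show ?thesis unfolding P_def using ev m1m by (intro conjI exI[of _ "{m, m1}"]) auto
  qed
  \<comment> \<open>\<open>LEAST\<close> on the reals needs an attained minimum: only finitely many
    candidates are at most \<open>m\<close>, and \<open>m\<close> is one of them.\<close>
  define A where "A = {\<mu>. \<mu> \<le> m \<and> P \<mu>}"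
  have "finite A"
    by (rule finite_subset[OF _ finite_eigenvalues[OF s \<Omega>, of m]]) (auto simp: A_def P_def)
  moreover have mA: "m \<in> A" using Pm by (simp add: A_def)
  ultimately have minA: "Min A \<in> A" "\<And>y. y \<in> A \<Longrightarrow> Min A \<le> y" by (auto intro: Min_in)
  have "frac_lambda 2 s \<Omega> = Least P" unfolding frac_lambda_def P_def by simp
  also have "\<dots> = Min A"
  proof (rule Least_equality)
    show "P (Min A)" using minA(1) by (simp add: A_def)
    show "Min A \<le> y" if "P y" for y
      using minA(2)[of y] minA(2)[OF mA] that by (cases "y \<le> m") (auto simp: A_def)
  qed
  finally have l: "frac_lambda 2 s \<Omega> = Min A" .
  show "frac_eigenvalue s \<Omega> (frac_lambda 2 s \<Omega>)" using minA(1) unfolding l A_def P_def by blast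
  show "frac_lambda 2 s \<Omega> * l2_form v v \<le> frac_form s v v" if "v \<in> H0s s \<Omega>" "\<And>x. v (g x) = - v x" for v
  proof -
    have "frac_lambda 2 s \<Omega> * l2_form v v \<le> m * l2_form v v"
      unfolding l using minA(2)[OF mA] L.nonneg[OF H0s_sq_int[OF s \<Omega> that(1)]] by (rule mult_right_mono)
    also have "\<dots> \<le> frac_form s v v" using u(4)[of v] that by (simp add: H0s_sym_def)
    finally show ?thesis .
  qed
qed

section \<open>Reflections and the convexity of the kernel\<close>

text \<open>For a unit vector \<open>v\<close>, the reflection in the hyperplane
  \<open>v \<bullet> x = c\<close>.\<close>

definition hrefl :: "'a::euclidean_space \<Rightarrow> real \<Rightarrow> 'a \<Rightarrow> 'a" where
  "hrefl v c x = x - (2 * (v \<bullet> x - c)) *\<^sub>R v"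

text \<open>All comparisons of kernels rest on this identity: a reflection changes squared distances
  additively, by a term whose sign tells whether the points lie on the same side of the
  mirror.\<close>

lemma norm_sq_hrefl:
  assumes "norm v = 1"
  shows "(norm (x - hrefl v c y))\<^sup>2 = (norm (x - y))\<^sup>2 + 4 * (v \<bullet> x - c) * (v \<bullet> y - c)"
proof -
  have vv: "v \<bullet> v = 1" using assms by (simp add: norm_eq_1)
  define t where "t = v \<bullet> y - c"
  define w where "w = x - y"
  have "x - hrefl v c y = w + (2 * t) *\<^sub>R v" by (simp add: hrefl_def t_def w_def)
  then have "(norm (x - hrefl v c y))\<^sup>2 = (w + (2 * t) *\<^sub>R v) \<bullet> (w + (2 * t) *\<^sub>R v)"
    by (simp only: power2_norm_eq_inner)
  also have "\<dots> = w \<bullet> w + 4 * t * (v \<bullet> w) + 4 * t * t"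
    by (simp add: inner_add_left inner_add_right inner_commute[of w v] vv algebra_simps)
  also have "v \<bullet> w = (v \<bullet> x - c) - t" by (simp add: t_def w_def inner_diff_right)
  finally show ?thesis by (simp add: power2_norm_eq_inner t_def w_def algebra_simps)
qed

lemma inner_hrefl: "norm v = 1 \<Longrightarrow> v \<bullet> hrefl v c x - c = - (v \<bullet> x - c)"
  by (simp add: hrefl_def inner_diff_right norm_eq_1)

lemma inner_hrefl_orth: "v \<bullet> w = 0 \<Longrightarrow> w \<bullet> hrefl v c x = w \<bullet> x"
  by (simp add: hrefl_def inner_diff_right inner_commute)

lemma hrefl_fix: "v \<bullet> x = c \<Longrightarrow> hrefl v c x = x"
  by (simp add: hrefl_def)

lemma isom_invol_hrefl:
  assumes v: "norm v = 1"
  shows "isom_invol (hrefl v c)"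
proof -
  have 1: "hrefl v c (hrefl v c x) = x" for x
  proof -
    have "hrefl v c (hrefl v c x) = hrefl v c x - (2 * (v \<bullet> hrefl v c x - c)) *\<^sub>R v" by (simp add: hrefl_def)
    also have "\<dots> = x" unfolding inner_hrefl[OF v] by (simp add: hrefl_def algebra_simps)
    finally show ?thesis .
  qed
  have "(norm (hrefl v c x - hrefl v c y))\<^sup>2 = (norm (x - y))\<^sup>2" for x y
  proof -
    have "(norm (hrefl v c x - y))\<^sup>2 = (norm (x - y))\<^sup>2 + 4 * (v \<bullet> x - c) * (v \<bullet> y - c)"
      unfolding norm_minus_commute[of "hrefl v c x"] norm_sq_hrefl[OF v]
      by (simp only: norm_minus_commute[of y x] mult_ac)
    then show ?thesis using norm_sq_hrefl[OF v, of "hrefl v c x" c y] unfolding inner_hrefl[OF v]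
      by (simp add: algebra_simps)
  qed
  then have "norm (hrefl v c x - hrefl v c y) = norm (x - y)" for x y
    by (metis norm_ge_zero power2_eq_imp_eq)
  with 1 show ?thesis by (simp add: isom_invol_def)
qed

lemma hrefl_commute:
  assumes "v \<bullet> w = 0"
  shows "hrefl v c (hrefl w d x) = hrefl w d (hrefl v c x)"
  using assms by (simp add: hrefl_def inner_diff_right inner_commute algebra_simps)

text \<open>A power of the squared distance is the right form, since reflections add a term to
  squared distances.\<close>

lemma frac_ker_sq:
  "frac_ker s (z :: 'a::euclidean_space) = ((norm z)\<^sup>2) powr (- ((real DIM('a) + 2 * s) / 2))"
proof (cases "z = 0")
  case False
  define r where "r = real DIM('a) + 2 * s"
  have "frac_ker s z = norm z powr (- r)" by (simp add: frac_ker_def r_def powr_minus_divide[symmetric])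
  also have "- r = 2 * (- (r / 2))" by simp
  also have "norm z powr (2 * (- (r / 2))) = (norm z powr 2) powr (- (r / 2))" by (rule powr_powr[symmetric])
  also have "norm z powr 2 = (norm z)\<^sup>2" using False by simp
  finally show ?thesis by (simp only: r_def)
qed (simp add: frac_ker_def)

section \<open>Monotonicity and convexity of negative powers\<close>

lemma neg_powr_less:
  fixes q d A :: real
  assumes "0 < q" "0 < d" "0 < A"
  shows "(d + A) powr (- q) < d powr (- q)"
  using assms by (intro powr_less_mono2_neg) auto

text \<open>The drop of the strictly convex function t^(-q) over a step of length \<open>A\<close>
  shrinks as t grows: its derivative in t is negative. With \<open>A\<close> and \<open>B\<close>
  from two perpendicular mirrors this compares the four kernels of an orbit.\<close>

lemma neg_powr_convex_strict:
  fixes q d A B :: real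
  assumes "0 < q" "0 < d" "0 < A" "0 < B"
  shows "(d + B) powr (- q) - (d + A + B) powr (- q) < d powr (- q) - (d + A) powr (- q)"
proof -
  define f where "f t = t powr (- q) - (t + A) powr (- q)" for t
  have "f (d + B) < f d"
  proof (rule DERIV_neg_imp_decreasing[of d "d + B" f])
    fix t assume t: "d \<le> t" "t \<le> d + B"
    then have pos: "0 < t" using assms by simp
    have "(f has_real_derivative ((- q) * t powr (- q - 1) - (- q) * (t + A) powr (- q - 1))) (at t)"
      unfolding f_def using pos assms
      by (auto intro!: derivative_eq_intros)
    moreover have "(t + A) powr (- (q + 1)) < t powr (- (q + 1))"
      using pos assms by (intro neg_powr_less) auto
    then have "(- q) * t powr (- q - 1) - (- q) * (t + A) powr (- q - 1) < 0"
      using assms(1) by simp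
    ultimately show "\<exists>y. (f has_real_derivative y) (at t) \<and> y < 0" by blast
  qed (use assms in simp)
  then show ?thesis by (simp add: f_def add_ac)
qed

lemma neg_powr_mono:
  fixes q d A :: real
  assumes "0 < q" "0 < d" "0 \<le> A"
  shows "(d + A) powr (- q) \<le> d powr (- q)"
  using neg_powr_less[OF assms(1,2), of A] assms(3) by (cases "A = 0") auto

lemma neg_powr_convex:
  fixes q d A B :: real
  assumes "0 < q" "0 < d" "0 \<le> A" "0 \<le> B"
  shows "(d + B) powr (- q) - (d + A + B) powr (- q) \<le> d powr (- q) - (d + A) powr (- q)"
  using neg_powr_convex_strict[OF assms(1,2), of A B] assms(3,4)
  by (cases "A = 0"; cases "B = 0") auto

text \<open>\<open>a\<close>, \<open>b\<close> are the values at a point x and its mirror point,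
  \<open>c\<close>, \<open>d\<close> those at y and its mirror point; \<open>p\<close> and
  \<open>q\<close> weight the pairs on the same side and on opposite sides. The products after
  polarization, with the larger absolute values on one side, are compared with those before.\<close>

definition deficit :: "real \<Rightarrow> real \<Rightarrow> real \<Rightarrow> real \<Rightarrow> real \<Rightarrow> real \<Rightarrow> real" where
  "deficit p q a b c d =
     (max \<bar>a\<bar> \<bar>b\<bar> * max \<bar>c\<bar> \<bar>d\<bar> + min \<bar>a\<bar> \<bar>b\<bar> * min \<bar>c\<bar> \<bar>d\<bar> - a * c - b * d) * p +
     (max \<bar>a\<bar> \<bar>b\<bar> * min \<bar>c\<bar> \<bar>d\<bar> + min \<bar>a\<bar> \<bar>b\<bar> * max \<bar>c\<bar> \<bar>d\<bar> - a * d - b * c) * q"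

text \<open>The two-point rearrangement inequality with its defect made explicit.\<close>

lemma max_mult_max_add_min_mult_min:
  fixes a b c d :: real
  shows "max a b * max c d + min a b * min c d = a * c + b * d + max 0 (- ((a - b) * (c - d)))"
proof -
  have e: "(a - b) * (c - d) = (a * c + b * d) - (a * d + b * c)" by (simp add: algebra_simps)
  show ?thesis
  proof (cases "a \<le> b")
    case ab: True
    show ?thesis
    proof (cases "c \<le> d")
      case True
      have "0 \<le> (a - b) * (c - d)" using ab True by (intro mult_nonpos_nonpos) auto
      then show ?thesis using ab True by (simp add: max_absorb2 min_absorb1 max_absorb1)
    next
      case False
      have "(a - b) * (c - d) \<le> 0" using ab False by (intro mult_nonpos_nonneg) auto
      then have "max 0 (- ((a - b) * (c - d))) = - ((a - b) * (c - d))" by (intro max_absorb2) simp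
      then show ?thesis using ab False unfolding e by (simp add: max_def min_def)
    qed
  next
    case ab: False
    show ?thesis
    proof (cases "c \<le> d")
      case True
      have "(a - b) * (c - d) \<le> 0" using ab True by (intro mult_nonneg_nonpos) auto
      then have "max 0 (- ((a - b) * (c - d))) = - ((a - b) * (c - d))" by (intro max_absorb2) simp
      then show ?thesis using ab True unfolding e by (simp add: max_def min_def)
    next
      case False
      have "0 \<le> (a - b) * (c - d)" using ab False by (intro mult_nonneg_nonneg) auto
      then have "max 0 (- ((a - b) * (c - d))) = 0" by (intro max_absorb1) simp
      then show ?thesis using ab False by (simp add: max_def min_def)
    qed
  qed
qed

text \<open>Polarization preserves the sum of all four products of absolute values, so what the
  pairing with weight \<open>p\<close> gains the pairing with weight \<open>q\<close> loses; this is
  the term with \<open>p - q\<close>. The other terms are the gains from making all signs equal.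
  Every term is nonnegative when 0 \<le> q \<le> p.\<close>

lemma deficit_split:
  "deficit p q a b c d = max 0 (- ((\<bar>a\<bar> - \<bar>b\<bar>) * (\<bar>c\<bar> - \<bar>d\<bar>))) * (p - q)
    + (\<bar>a * c\<bar> - a * c) * p + (\<bar>b * d\<bar> - b * d) * p + (\<bar>a * d\<bar> - a * d) * q + (\<bar>b * c\<bar> - b * c) * q"
proof -
  define Z where "Z = max 0 (- ((\<bar>a\<bar> - \<bar>b\<bar>) * (\<bar>c\<bar> - \<bar>d\<bar>)))"
  define M m M' m' where d: "M = max \<bar>a\<bar> \<bar>b\<bar>" "m = min \<bar>a\<bar> \<bar>b\<bar>" "M' = max \<bar>c\<bar> \<bar>d\<bar>" "m' = min \<bar>c\<bar> \<bar>d\<bar>"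
  have s: "M + m = \<bar>a\<bar> + \<bar>b\<bar>" "M' + m' = \<bar>c\<bar> + \<bar>d\<bar>" unfolding d by (simp_all add: max_def min_def)
  have 1: "M * M' + m * m' = \<bar>a * c\<bar> + \<bar>b * d\<bar> + Z"
    unfolding d Z_def abs_mult by (rule max_mult_max_add_min_mult_min)
  have "(M + m) * (M' + m') = (\<bar>a\<bar> + \<bar>b\<bar>) * (\<bar>c\<bar> + \<bar>d\<bar>)" unfolding s ..
  then have "(M * M' + m * m') + (M * m' + m * M') = \<bar>a * c\<bar> + \<bar>b * d\<bar> + (\<bar>a * d\<bar> + \<bar>b * c\<bar>)"
    unfolding abs_mult by (simp only: distrib_left distrib_right add_ac)
  then have 2: "M * m' + m * M' = \<bar>a * d\<bar> + \<bar>b * c\<bar> - Z" using 1 by linarith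
  show ?thesis
    unfolding deficit_def d[symmetric] 1 2 Z_def[symmetric]
    by (simp only: left_diff_distrib right_diff_distrib distrib_right)
qed

lemma deficit_nonneg: "q \<le> p \<Longrightarrow> 0 \<le> q \<Longrightarrow> 0 \<le> deficit p q a b c d"
  unfolding deficit_split by (intro add_nonneg_nonneg mult_nonneg_nonneg) auto

text \<open>Every summand of \<open>deficit_split\<close> is nonnegative with a positive weight, so
  each one vanishes. The last conclusion says that both pairs are ordered the same way by absolute
  value.\<close>

lemma deficit_eq_0:
  assumes "q < p" "0 < q" "deficit p q a b c d = 0"
  shows "0 \<le> a * c" "0 \<le> a * d" "0 \<le> b * c" "0 \<le> b * d" "0 \<le> (\<bar>a\<bar> - \<bar>b\<bar>) * (\<bar>c\<bar> - \<bar>d\<bar>)"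
proof -
  have nn: "0 \<le> max 0 (- ((\<bar>a\<bar> - \<bar>b\<bar>) * (\<bar>c\<bar> - \<bar>d\<bar>))) * (p - q)" "0 \<le> (\<bar>a * c\<bar> - a * c) * p"
      "0 \<le> (\<bar>b * d\<bar> - b * d) * p" "0 \<le> (\<bar>a * d\<bar> - a * d) * q" "0 \<le> (\<bar>b * c\<bar> - b * c) * q"
    using assms by auto
  have pq: "p \<noteq> q" "p \<noteq> 0" "q \<noteq> 0" using assms by auto
  have "max 0 (- ((\<bar>a\<bar> - \<bar>b\<bar>) * (\<bar>c\<bar> - \<bar>d\<bar>))) * (p - q) = 0" "(\<bar>a * c\<bar> - a * c) * p = 0"
      "(\<bar>b * d\<bar> - b * d) * p = 0" "(\<bar>a * d\<bar> - a * d) * q = 0" "(\<bar>b * c\<bar> - b * c) * q = 0"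
    using nn assms(3)[unfolded deficit_split] by linarith+
  then have "max 0 (- ((\<bar>a\<bar> - \<bar>b\<bar>) * (\<bar>c\<bar> - \<bar>d\<bar>))) = 0" "\<bar>a * c\<bar> = a * c"
      "\<bar>b * d\<bar> = b * d" "\<bar>a * d\<bar> = a * d" "\<bar>b * c\<bar> = b * c"
    using pq unfolding mult_eq_0_iff right_minus_eq by blast+
  then show "0 \<le> a * c" "0 \<le> a * d" "0 \<le> b * c" "0 \<le> b * d" "0 \<le> (\<bar>a\<bar> - \<bar>b\<bar>) * (\<bar>c\<bar> - \<bar>d\<bar>)"
    using abs_ge_zero[of "a * c"] abs_ge_zero[of "a * d"] abs_ge_zero[of "b * c"] abs_ge_zero[of "b * d"]
      max.cobounded2[of "- ((\<bar>a\<bar> - \<bar>b\<bar>) * (\<bar>c\<bar> - \<bar>d\<bar>))" 0] by linarith+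
qed

text \<open>The energy density summed over an orbit of pairs of points. The plus signs next to
  \<open>k3\<close> and \<open>k4\<close> come from oddness, which negates the value at the
  reflected point.\<close>

definition orbit_sum :: "real \<Rightarrow> real \<Rightarrow> real \<Rightarrow> real \<Rightarrow> real \<Rightarrow> real \<Rightarrow> real \<Rightarrow> real \<Rightarrow> real" where
  "orbit_sum k1 k2 k3 k4 a b c d = k1 * ((a - c)\<^sup>2 + (b - d)\<^sup>2) + k2 * ((a - d)\<^sup>2 + (b - c)\<^sup>2)
     + k3 * ((a + c)\<^sup>2 + (b + d)\<^sup>2) + k4 * ((a + d)\<^sup>2 + (b + c)\<^sup>2)"

text \<open>The sums of squares are preserved by polarization, so only the mixed products
  change.\<close>

lemma orbit_sum_diff:
  "orbit_sum k1 k2 k3 k4 a b c d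
    - orbit_sum k1 k2 k3 k4 (max \<bar>a\<bar> \<bar>b\<bar>) (min \<bar>a\<bar> \<bar>b\<bar>) (max \<bar>c\<bar> \<bar>d\<bar>) (min \<bar>c\<bar> \<bar>d\<bar>)
    = 2 * deficit (k1 - k3) (k2 - k4) a b c d"
proof -
  define M m M' m' where d: "M = max \<bar>a\<bar> \<bar>b\<bar>" "m = min \<bar>a\<bar> \<bar>b\<bar>" "M' = max \<bar>c\<bar> \<bar>d\<bar>" "m' = min \<bar>c\<bar> \<bar>d\<bar>"
  have sq: "M\<^sup>2 + m\<^sup>2 = a\<^sup>2 + b\<^sup>2" "M'\<^sup>2 + m'\<^sup>2 = c\<^sup>2 + d\<^sup>2"
    unfolding d by (auto simp: max_def min_def)
  have e: "orbit_sum k1 k2 k3 k4 a b c d = (k1 + k2 + k3 + k4) * ((a\<^sup>2 + b\<^sup>2) + (c\<^sup>2 + d\<^sup>2))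
      - 2 * (a * c + b * d) * (k1 - k3) - 2 * (a * d + b * c) * (k2 - k4)" for a b c d
    by (simp add: orbit_sum_def power2_eq_square algebra_simps)
  have "orbit_sum k1 k2 k3 k4 M m M' m' = (k1 + k2 + k3 + k4) * ((a\<^sup>2 + b\<^sup>2) + (c\<^sup>2 + d\<^sup>2))
      - 2 * (M * M' + m * m') * (k1 - k3) - 2 * (M * m' + m * M') * (k2 - k4)"
    unfolding e sq ..
  then show ?thesis
    unfolding e[of a b c d] deficit_def d[symmetric] by (simp add: algebra_simps)
qed

text \<open>The sign jumps only across the hyperplane, where \<open>u\<close> vanishes. For points
  on opposite sides, the absolute value of \<open>u\<close> is at most \<open>A\<close> times the
  distance to the hyperplane, and the two distances add up to at most the distance of the
  points.\<close>

lemma lipschitz_sgn: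
  fixes u :: "'a::euclidean_space \<Rightarrow> real"
  assumes v: "norm v = 1" and lip: "\<And>x y. \<bar>u x - u y\<bar> \<le> A * norm (x - y)"
    and z: "\<And>x. v \<bullet> x = c \<Longrightarrow> u x = 0"
  shows "\<bar>sgn (v \<bullet> x - c) * u x - sgn (v \<bullet> y - c) * u y\<bar> \<le> A * norm (x - y)"
proof -
  have vv: "v \<bullet> v = 1" using v by (simp add: norm_eq_1)
  have bd: "\<bar>u x\<bar> \<le> A * \<bar>v \<bullet> x - c\<bar>" for x
  proof -
    let ?z = "x - (v \<bullet> x - c) *\<^sub>R v"
    have "v \<bullet> ?z = c" by (simp add: inner_diff_right vv)
    then have "u ?z = 0" by (rule z)
    then show ?thesis using lip[of x ?z] v by simp
  qed
  have A: "0 \<le> A" using lip[of v 0] v by (smt (verit) diff_zero mult_cancel_left2 abs_ge_zero)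
  define p where "p = v \<bullet> x - c"
  define q where "q = v \<bullet> y - c"
  have pq: "A * \<bar>p - q\<bar> \<le> A * norm (x - y)"
  proof (rule mult_left_mono[OF _ A])
    have "p - q = v \<bullet> (x - y)" by (simp add: p_def q_def inner_diff_right)
    then show "\<bar>p - q\<bar> \<le> norm (x - y)" using Cauchy_Schwarz_ineq2[of v "x - y"] v by simp
  qed
  have bp: "\<bar>u x\<bar> \<le> A * \<bar>p\<bar>" "\<bar>u y\<bar> \<le> A * \<bar>q\<bar>" using bd by (auto simp: p_def q_def)
  consider "p > 0 \<and> q > 0" | "p < 0 \<and> q < 0" | "p * q \<le> 0" 
    by (metis linorder_not_le mult_le_0_iff zero_less_mult_iff not_less)
  then have "\<bar>sgn p * u x - sgn q * u y\<bar> \<le> A * norm (x - y)"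
  proof cases
    case 1 then show ?thesis using lip[of x y] by simp
  next
    case 2 then show ?thesis using lip[of y x] by (simp add: norm_minus_commute)
  next
    case 3
    have "\<bar>p - q\<bar> = \<bar>p\<bar> + \<bar>q\<bar>" using 3 by (auto simp: mult_le_0_iff)
    then have "A * \<bar>p\<bar> + A * \<bar>q\<bar> \<le> A * norm (x - y)" using pq by (simp add: distrib_left)
    moreover have "\<bar>sgn r * t\<bar> \<le> \<bar>t\<bar>" for r t :: real by (simp add: abs_mult abs_sgn_eq)
    then have "\<bar>sgn p * u x - sgn q * u y\<bar> \<le> \<bar>u x\<bar> + \<bar>u y\<bar>"
      by (metis abs_triangle_ineq4 add_mono order_trans)
    ultimately show ?thesis using bp by linarith
  qed
  then show ?thesis by (simp add: p_def q_def)
qed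

section \<open>Polarization of antisymmetric functions\<close>

lemma AE_off_diagonal: "AE z in (lborel :: ('a::euclidean_space \<times> 'a) measure). fst z \<noteq> snd z"
proof -
  let ?D = "{z :: 'a \<times> 'a. fst z = snd z}"
  have D: "?D \<in> sets borel" by (intro borel_closed closed_Collect_eq continuous_intros)
  have "emeasure lborel ?D = (\<integral>\<^sup>+z. indicator ?D z \<partial>lborel)" using D by simp
  also have "\<dots> = (\<integral>\<^sup>+x. \<integral>\<^sup>+y. indicator ?D (x, y) \<partial>lborel \<partial>lborel)"
    using D by (intro nn_integral_product) simp
  also have "\<dots> = (\<integral>\<^sup>+x. \<integral>\<^sup>+y. indicator {x} y \<partial>lborel \<partial>(lborel :: 'a measure))"
    by (intro nn_integral_cong) (auto simp: indicator_def)
  also have "\<dots> = 0" by simp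
  finally have "?D \<in> null_sets lborel" using D by (simp add: null_sets_def)
  then show ?thesis by (rule AE_I') auto
qed

lemma AE_neq_isom_invol:
  fixes h :: "'a::euclidean_space \<Rightarrow> 'a"
  assumes h: "isom_invol h"
  shows "AE z in (lborel :: ('a \<times> 'a) measure). fst z \<noteq> h (snd z)"
proof -
  let ?T = "\<lambda>z. (fst z, h (snd z))"
  have T: "?T \<in> measurable (lborel :: ('a \<times> 'a) measure) borel"
    using isom_invol_pair_measurable[OF isom_invol_id h] by simp
  have "AE z in distr (lborel :: ('a \<times> 'a) measure) borel ?T. fst z \<noteq> snd z"
    unfolding distr_isom_invol_pair[OF isom_invol_id h] by (rule AE_off_diagonal)
  from AE_distrD[OF T this] show ?thesis by simp
qed

text \<open>\<open>rho\<close> will be the mirror of the antisymmetry, through 0, and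
  \<open>sigma\<close> the mirror of the polarization. Orthogonality of \<open>v\<close> and
  \<open>e\<close> makes them commute, so that polarization preserves oddness, and puts all
  multiples of \<open>e\<close> on the odd hyperplane.\<close>

locale two_reflections =
  fixes v e :: "'a::euclidean_space" and c s :: real
  assumes norm_v: "norm v = 1" and norm_e: "norm e = 1" and orth: "v \<bullet> e = 0"
    and s: "0 < s" "s < 1"
begin

abbreviation rho :: "'a \<Rightarrow> 'a" where "rho \<equiv> hrefl v 0"
abbreviation sigma :: "'a \<Rightarrow> 'a" where "sigma \<equiv> hrefl e c"

lemma isom: "isom_invol rho" "isom_invol sigma"
  using isom_invol_hrefl norm_v norm_e by auto

lemma rho_rho [simp]: "rho (rho x) = x" and sigma_sigma [simp]: "sigma (sigma x) = x"
  using isom by (auto simp: isom_invol_def)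

lemma sigma_rho: "sigma (rho x) = rho (sigma x)"
  using orth by (intro hrefl_commute) (simp add: inner_commute)

lemma isom_rho_sigma: "isom_invol (\<lambda>x. rho (sigma x))"
  using isom_invol_simps(2)[OF isom(1)] isom_invol_simps(2)[OF isom(2)]
  by (simp add: isom_invol_def sigma_rho)

lemma inner_simps_refl [simp]:
  "v \<bullet> rho x = - (v \<bullet> x)" "v \<bullet> sigma x = v \<bullet> x" "e \<bullet> rho x = e \<bullet> x" "e \<bullet> sigma x = 2 * c - e \<bullet> x"
  using inner_hrefl[OF norm_v, of 0 x] inner_hrefl[OF norm_e, of c x]
    inner_hrefl_orth[of e v c x] inner_hrefl_orth[of v e 0 x] orth
  by (auto simp: inner_commute)

text \<open>An open fundamental domain, up to null sets, of the group generated by the two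
  mirrors.\<close>

definition quarter :: "'a set" where
  "quarter = {x. 0 < v \<bullet> x \<and> e \<bullet> x < c}"

text \<open>The kernel that odd functions see on a half space: the image point under
  \<open>rho\<close> enters with the opposite sign. \<open>ker2\<close> is the same with y replaced
  by its mirror point under \<open>sigma\<close>.\<close>

definition ker1 :: "'a \<Rightarrow> 'a \<Rightarrow> real" where
  "ker1 x y = frac_ker s (x - y) - frac_ker s (x - rho y)"

definition ker2 :: "'a \<Rightarrow> 'a \<Rightarrow> real" where
  "ker2 x y = frac_ker s (x - sigma y) - frac_ker s (x - rho (sigma y))"

lemma ker_sq:
  fixes x y :: 'a
  defines "D \<equiv> (norm (x - y))\<^sup>2" and "A \<equiv> 4 * (v \<bullet> x) * (v \<bullet> y)" and "B \<equiv> 4 * (e \<bullet> x - c) * (e \<bullet> y - c)"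
    and "q \<equiv> (real DIM('a) + 2 * s) / 2"
  shows "ker1 x y = D powr (- q) - (D + A) powr (- q)"
    "ker2 x y = (D + B) powr (- q) - (D + A + B) powr (- q)"
proof -
  have "(norm (x - rho y))\<^sup>2 = D + A" "(norm (x - sigma y))\<^sup>2 = D + B"
    using norm_sq_hrefl[OF norm_v, of x 0 y] norm_sq_hrefl[OF norm_e, of x c y] by (simp_all add: assms)
  moreover have "(norm (x - rho (sigma y)))\<^sup>2 = D + A + B"
    using norm_sq_hrefl[OF norm_v, of x 0 "sigma y"] norm_sq_hrefl[OF norm_e, of x c y] by (simp add: assms)
  ultimately show "ker1 x y = D powr (- q) - (D + A) powr (- q)"
    "ker2 x y = (D + B) powr (- q) - (D + A + B) powr (- q)"
    unfolding ker1_def ker2_def frac_ker_sq q_def D_def by simp_all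
qed

lemma exponent_pos: "0 < (real DIM('a) + 2 * s) / 2"
  using s by (simp add: add_nonneg_pos)

text \<open>Monotonicity of t^(-q) gives the first inequality, convexity the second; x and y lie on
  the same sides of both mirrors.\<close>

lemma ker_order:
  assumes "x \<noteq> y" "0 \<le> (v \<bullet> x) * (v \<bullet> y)" "0 \<le> (e \<bullet> x - c) * (e \<bullet> y - c)"
  shows "0 \<le> ker2 x y" "ker2 x y \<le> ker1 x y"
proof -
  have D: "0 < (norm (x - y))\<^sup>2" using assms(1) by simp
  have A: "0 \<le> 4 * (v \<bullet> x) * (v \<bullet> y)" "0 \<le> 4 * (e \<bullet> x - c) * (e \<bullet> y - c)"
    by (simp_all only: mult.assoc mult_nonneg_nonneg[OF zero_le_numeral] assms(2,3))
  show "ker2 x y \<le> ker1 x y" unfolding ker_sq by (rule neg_powr_convex[OF exponent_pos D A])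
  show "0 \<le> ker2 x y" unfolding ker_sq
    using neg_powr_mono[OF exponent_pos _ A(1), of "(norm (x - y))\<^sup>2 + 4 * (e \<bullet> x - c) * (e \<bullet> y - c)"] D A
    by (simp add: add_ac add_pos_nonneg)
qed

lemma ker_order_strict:
  assumes "x \<noteq> y" "x \<in> quarter" "y \<in> quarter"
  shows "0 < ker2 x y" "ker2 x y < ker1 x y"
proof -
  have D: "0 < (norm (x - y))\<^sup>2" using assms(1) by simp
  have A: "0 < 4 * (v \<bullet> x) * (v \<bullet> y)" "0 < 4 * (e \<bullet> x - c) * (e \<bullet> y - c)"
    using assms(2,3) by (auto simp: quarter_def mult.assoc mult_neg_neg)
  show "ker2 x y < ker1 x y" unfolding ker_sq by (rule neg_powr_convex_strict[OF exponent_pos D A])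
  show "0 < ker2 x y" unfolding ker_sq
    using neg_powr_less[OF exponent_pos _ A(1), of "(norm (x - y))\<^sup>2 + 4 * (e \<bullet> x - c) * (e \<bullet> y - c)"] D A
    by (simp add: add_ac add_pos_pos)
qed

lemma ker1_pos:
  assumes "x \<noteq> y" "0 < v \<bullet> x" "0 < v \<bullet> y"
  shows "0 < ker1 x y"
  unfolding ker_sq using neg_powr_less[OF exponent_pos, of "(norm (x - y))\<^sup>2" "4 * (v \<bullet> x) * (v \<bullet> y)"] assms by simp

text \<open>On the mirror of \<open>sigma\<close> the two branches agree, and
  \<open>sgn 0 = 0\<close> keeps the function odd on the mirror of \<open>rho\<close>.\<close>

definition polar :: "('a \<Rightarrow> real) \<Rightarrow> 'a \<Rightarrow> real" where
  "polar f x = sgn (v \<bullet> x) *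
     (if e \<bullet> x \<le> c then max \<bar>f x\<bar> \<bar>f (sigma x)\<bar> else min \<bar>f x\<bar> \<bar>f (sigma x)\<bar>)"

text \<open>A full orbit has sixteen pairs; for odd functions, reflecting the first variable by
  \<open>rho\<close> amounts to reflecting the second, which leaves eight. For odd functions the sum
  is invariant in each variable separately, while the density alone is not.\<close>

definition orbit_integrand :: "('a \<Rightarrow> real) \<Rightarrow> 'a \<Rightarrow> 'a \<Rightarrow> real" where
  "orbit_integrand f x y =
     frac_integrand s f f (x, y) + frac_integrand s f f (x, sigma y) +
     frac_integrand s f f (x, rho y) + frac_integrand s f f (x, rho (sigma y)) +
     frac_integrand s f f (sigma x, y) + frac_integrand s f f (sigma x, sigma y) +
     frac_integrand s f f (sigma x, rho y) + frac_integrand s f f (sigma x, rho (sigma y))"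

definition odd_refl :: "('a \<Rightarrow> real) \<Rightarrow> bool" where
  "odd_refl f \<longleftrightarrow> (\<forall>x. f (rho x) = - f x)"

lemma odd_reflD: "odd_refl f \<Longrightarrow> f (rho x) = - f x"
  by (simp add: odd_refl_def)

context
  fixes f :: "'a \<Rightarrow> real"
  assumes odd_f: "odd_refl f"
begin

lemma anti: "f (rho x) = - f x"
  by (rule odd_reflD[OF odd_f])

lemma anti_zero: "v \<bullet> x = 0 \<Longrightarrow> f x = 0"
  using anti[of x] hrefl_fix[of v x 0] by simp

lemma anti_sigma: "f (sigma (rho x)) = - f (sigma x)"
  by (simp add: sigma_rho anti)

lemma polar_odd: "odd_refl (polar f)"
  unfolding odd_refl_def by (simp add: polar_def anti anti_sigma sgn_minus)

lemma polar_quarter: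
  assumes "0 \<le> v \<bullet> x" "e \<bullet> x \<le> c"
  shows "polar f x = max \<bar>f x\<bar> \<bar>f (sigma x)\<bar>" "polar f (sigma x) = min \<bar>f x\<bar> \<bar>f (sigma x)\<bar>"
proof -
  have z: "f x = 0 \<and> f (sigma x) = 0" if "v \<bullet> x = 0" using anti_zero[of x] anti_zero[of "sigma x"] that by simp
  show "polar f x = max \<bar>f x\<bar> \<bar>f (sigma x)\<bar>"
    using assms z by (cases "v \<bullet> x = 0") (auto simp: polar_def)
  show "polar f (sigma x) = min \<bar>f x\<bar> \<bar>f (sigma x)\<bar>"
  proof (cases "e \<bullet> x = c")
    case True
    then have "sigma x = x" by (rule hrefl_fix)
    then show ?thesis using assms z True by (cases "v \<bullet> x = 0") (auto simp: polar_def)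
  next
    case False
    then have "\<not> e \<bullet> sigma x \<le> c" using assms by simp
    then show ?thesis using assms z by (cases "v \<bullet> x = 0") (auto simp: polar_def min.commute)
  qed
qed

lemma frac_integrand_rho: "frac_integrand s f f (rho x, y) = frac_integrand s f f (x, rho y)"
proof -
  have "frac_ker s (rho x - y) = frac_ker s (x - rho y)"
    unfolding frac_ker_def using isom_invol_simps[OF isom(1)] by metis
  moreover have "(f (rho x) - f y) * (f (rho x) - f y) = (f x - f (rho y)) * (f x - f (rho y))"
    by (simp add: anti algebra_simps)
  ultimately show ?thesis by (simp only: frac_integrand_eq)
qed

lemma orbit_integrand_invariant:
  "orbit_integrand f (sigma x) y = orbit_integrand f x y"
  "orbit_integrand f (rho x) y = orbit_integrand f x y"
  "orbit_integrand f x (sigma y) = orbit_integrand f x y"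
  "orbit_integrand f x (rho y) = orbit_integrand f x y"
  unfolding orbit_integrand_def by (simp_all add: sigma_rho frac_integrand_rho)

lemma orbit_integrand_eq:
  "orbit_integrand f x y = orbit_sum (frac_ker s (x - y)) (frac_ker s (x - sigma y))
     (frac_ker s (x - rho y)) (frac_ker s (x - rho (sigma y))) (f x) (f (sigma x)) (f y) (f (sigma y))"
proof -
  have n: "norm (sigma x - y) = norm (x - sigma y)" for x y
    using isom_invol_simps[OF isom(2)] by metis
  have k: "frac_ker s (sigma x - y) = frac_ker s (x - sigma y)" "frac_ker s (sigma x - sigma y) = frac_ker s (x - y)"
      "frac_ker s (sigma x - rho y) = frac_ker s (x - rho (sigma y))"
      "frac_ker s (sigma x - rho (sigma y)) = frac_ker s (x - rho y)"
    by (simp_all add: frac_ker_def n sigma_rho)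
  show ?thesis
    unfolding orbit_integrand_def frac_integrand_eq k orbit_sum_def anti
    by (simp add: power2_eq_square algebra_simps)
qed

end

lemma orbit_integrand_diff:
  assumes anti: "odd_refl f" and "0 \<le> v \<bullet> x" "e \<bullet> x \<le> c" "0 \<le> v \<bullet> y" "e \<bullet> y \<le> c"
  shows "orbit_integrand f x y - orbit_integrand (polar f) x y
    = 2 * deficit (ker1 x y) (ker2 x y) (f x) (f (sigma x)) (f y) (f (sigma y))"
  unfolding orbit_integrand_eq[OF anti] orbit_integrand_eq[OF polar_odd[OF anti]]
    polar_quarter[OF anti assms(2,3)] polar_quarter[OF anti assms(4,5)] orbit_sum_diff ker1_def ker2_def ..

lemma to_quarter:
  obtains x' where "0 \<le> v \<bullet> x'" "e \<bullet> x' \<le> c" "x' \<in> {x, rho x, sigma x, rho (sigma x)}"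
proof (cases "0 \<le> v \<bullet> x"; cases "e \<bullet> x \<le> c")
  assume "0 \<le> v \<bullet> x" "e \<bullet> x \<le> c" then show ?thesis using that[of x] by simp
next
  assume "0 \<le> v \<bullet> x" "\<not> e \<bullet> x \<le> c" then show ?thesis using that[of "sigma x"] by simp
next
  assume "\<not> 0 \<le> v \<bullet> x" "e \<bullet> x \<le> c" then show ?thesis using that[of "rho x"] by simp
next
  assume "\<not> 0 \<le> v \<bullet> x" "\<not> e \<bullet> x \<le> c" then show ?thesis using that[of "rho (sigma x)"] by simp
qed

text \<open>Invariance moves both points into the closed quarter, where the deficit formula holds.
  The four inequalities keep the representatives distinct, as the comparison of kernels
  requires.\<close>

lemma orbit_integrand_polar_le:
  assumes anti: "odd_refl f"
    and ne: "x \<noteq> y" "x \<noteq> rho y" "x \<noteq> sigma y" "x \<noteq> rho (sigma y)"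
  shows "orbit_integrand (polar f) x y \<le> orbit_integrand f x y"
proof -
  obtain x' where x: "0 \<le> v \<bullet> x'" "e \<bullet> x' \<le> c" "x' \<in> {x, rho x, sigma x, rho (sigma x)}" by (rule to_quarter)
  obtain y' where y: "0 \<le> v \<bullet> y'" "e \<bullet> y' \<le> c" "y' \<in> {y, rho y, sigma y, rho (sigma y)}" by (rule to_quarter)
  have "x = x' \<or> x = rho x' \<or> x = sigma x' \<or> x = rho (sigma x')" using x(3) by (auto simp: sigma_rho)
  then have "x' \<noteq> y'" using ne y(3) by (auto simp: sigma_rho)
  then have "0 \<le> ker2 x' y'" "ker2 x' y' \<le> ker1 x' y'"
    using x(1,2) y(1,2) by (intro ker_order; auto intro: mult_nonneg_nonneg mult_nonpos_nonpos)+
  then have "orbit_integrand (polar f) x' y' \<le> orbit_integrand f x' y'"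
    using orbit_integrand_diff[OF anti x(1,2) y(1,2)] deficit_nonneg[of "ker2 x' y'" "ker1 x' y'"] by (metis diff_ge_0_iff_ge mult_nonneg_nonneg zero_le_numeral)
  moreover have "orbit_integrand h x' y' = orbit_integrand h x y" if "odd_refl h" for h
    using x(3) y(3) orbit_integrand_invariant[OF that] by auto
  ultimately show ?thesis using anti polar_odd[OF anti] by simp
qed

text \<open>Half the energy loss of an orbit, written with \<open>f\<close> and not with
  \<open>polar f\<close>. It is continuous in the values of \<open>f\<close> and makes sense for
  limits whose polarization is not known to lie in the energy space.\<close>

definition polar_gap :: "('a \<Rightarrow> real) \<Rightarrow> 'a \<times> 'a \<Rightarrow> real" where
  "polar_gap f z = indicator {z. fst z \<in> quarter \<and> snd z \<in> quarter \<and> fst z \<noteq> snd z} z *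
     deficit (ker1 (fst z) (snd z)) (ker2 (fst z) (snd z)) (f (fst z)) (f (sigma (fst z))) (f (snd z)) (f (sigma (snd z)))"

lemma polar_gap_nonneg: "0 \<le> polar_gap f z"
proof (cases "fst z \<in> quarter \<and> snd z \<in> quarter \<and> fst z \<noteq> snd z")
  case True
  then have "0 < ker2 (fst z) (snd z)" "ker2 (fst z) (snd z) < ker1 (fst z) (snd z)"
    using ker_order_strict by auto
  then show ?thesis unfolding polar_gap_def by (intro mult_nonneg_nonneg deficit_nonneg) auto
qed (simp add: polar_gap_def)

lemma open_quarter: "open quarter"
  unfolding quarter_def by (intro open_Collect_conj open_Collect_less continuous_intros)

lemma hrefl_measurable [measurable]: "rho \<in> borel_measurable borel" "sigma \<in> borel_measurable borel"
  using isom isom_invol_measurable by auto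

lemma polar_gap_measurable [measurable]:
  assumes [measurable]: "f \<in> borel_measurable borel"
  shows "polar_gap f \<in> borel_measurable borel"
proof -
  have "open {z. fst z \<in> quarter \<and> snd z \<in> quarter \<and> fst z \<noteq> snd z}"
    by (intro open_Collect_conj open_Collect_neq continuous_intros
        open_vimage[OF open_quarter, of fst, unfolded vimage_def] open_vimage[OF open_quarter, of snd, unfolded vimage_def])
  then have [measurable]: "{z. fst z \<in> quarter \<and> snd z \<in> quarter \<and> fst z \<noteq> snd z} \<in> sets borel" by (rule borel_open)
  show ?thesis unfolding polar_gap_def[abs_def] deficit_def ker1_def ker2_def by measurable
qed

section \<open>Effect of polarization on energy, norm and support\<close>

lemma integral_orbit_integrand:
  assumes f: "f \<in> fin_energy s"
  shows "integrable lborel (\<lambda>z. orbit_integrand f (fst z) (snd z))"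
    "(LINT z|lborel. orbit_integrand f (fst z) (snd z)) = 8 * (LINT z|lborel. frac_integrand s f f z)"
proof -
  let ?F = "frac_integrand s f f"
  have m: "?F \<in> borel_measurable borel"
    by (intro frac_integrand_measurable) (use f in \<open>auto simp: fin_energy_def\<close>)
  have i: "integrable lborel ?F" using f by (simp add: fin_energy_def)
  note T = isom_invol_id isom isom_rho_sigma
  have "integrable lborel (\<lambda>z. ?F (g (fst z), h (snd z)))" "(LINT z|lborel. ?F (g (fst z), h (snd z))) = (LINT z|lborel. ?F z)"
    if "isom_invol g" "isom_invol h" for g h
    using integral_isom_invol_pair[OF that m] i by auto
  note I = this[OF T(1) T(1)] this[OF T(1) T(3)] this[OF T(1) T(2)] this[OF T(1) T(4)]
     this[OF T(3) T(1)] this[OF T(3) T(3)] this[OF T(3) T(2)] this[OF T(3) T(4)]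
  show "integrable lborel (\<lambda>z. orbit_integrand f (fst z) (snd z))"
    unfolding orbit_integrand_def by (intro Bochner_Integration.integrable_add I)
  show "(LINT z|lborel. orbit_integrand f (fst z) (snd z)) = 8 * (LINT z|lborel. ?F z)"
    unfolding orbit_integrand_def using I by (simp add: Bochner_Integration.integral_add)
qed

text \<open>The orbit sum integrates to eight times the integral of the density; its loss is twice
  the gap on the quarter and nonnegative elsewhere. With the factor \<open>frac_const\<close> / 2 of
  the form, this gives the constant 8.\<close>

lemma energy_polar:
  assumes anti: "odd_refl f" and f: "f \<in> fin_energy s" "polar f \<in> fin_energy s"
  shows "(\<integral>\<^sup>+z. ennreal (polar_gap f z) \<partial>lborel)
    \<le> ennreal (8 / frac_const DIM('a) s * (frac_form s f f - frac_quad s (polar f)))"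
proof -
  let ?F = "LINT z|lborel. frac_integrand s f f z" and ?P = "LINT z|lborel. frac_integrand s (polar f) (polar f) z"
  let ?d = "\<lambda>z. orbit_integrand f (fst z) (snd z) - orbit_integrand (polar f) (fst z) (snd z)"
  have nn: "AE z in lborel. 0 \<le> ?d z"
    using AE_off_diagonal AE_neq_isom_invol[OF isom(1)] AE_neq_isom_invol[OF isom(2)] AE_neq_isom_invol[OF isom_rho_sigma]
    by eventually_elim (use orbit_integrand_polar_le[OF anti] in auto)
  have "(\<integral>\<^sup>+z. ennreal (polar_gap f z) \<partial>lborel) \<le> (\<integral>\<^sup>+z. ennreal (?d z / 2) \<partial>lborel)"
  proof (rule nn_integral_mono_AE, use nn in eventually_elim)
    fix z :: "'a \<times> 'a" assume z: "0 \<le> ?d z"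
    show "ennreal (polar_gap f z) \<le> ennreal (?d z / 2)"
    proof (cases "fst z \<in> quarter \<and> snd z \<in> quarter \<and> fst z \<noteq> snd z")
      case True
      then have "?d z = 2 * polar_gap f z"
        by (subst orbit_integrand_diff[OF anti]) (auto simp: quarter_def polar_gap_def)
      then show ?thesis by simp
    next
      case False
      then have "polar_gap f z = 0" by (simp add: polar_gap_def)
      then show ?thesis using z by simp
    qed
  qed
  also have "\<dots> = ennreal (LINT z|lborel. ?d z / 2)"
    using integral_orbit_integrand(1)[OF f(1)] integral_orbit_integrand(1)[OF f(2)] nn
    by (intro nn_integral_eq_integral) auto
  also have "(LINT z|lborel. ?d z / 2) = 4 * (?F - ?P)"
    using integral_orbit_integrand[OF f(1)] integral_orbit_integrand[OF f(2)] by simp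
  also have "4 * (?F - ?P) = 8 / frac_const DIM('a) s * (frac_form s f f - frac_quad s (polar f))"
    unfolding frac_form_def using frac_const_pos[OF s, where 'a='a] by (simp add: field_simps)
  finally show ?thesis .
qed

text \<open>At a pair of mirror points the two squares are at most exchanged, so the doubled
  integrals agree.\<close>

lemma l2_form_polar:
  assumes anti: "odd_refl f" and f: "f \<in> sq_int" "polar f \<in> sq_int"
  shows "l2_quad (polar f) = l2_form f f"
proof -
  have m [measurable]: "f \<in> borel_measurable borel" "polar f \<in> borel_measurable borel" using f by (auto simp: sq_int_def)
  have pt: "polar f x * polar f x + polar f (sigma x) * polar f (sigma x) = f x * f x + f (sigma x) * f (sigma x)" for x
  proof -
    have mm: "max \<bar>a\<bar> \<bar>b\<bar> * max \<bar>a\<bar> \<bar>b\<bar> + min \<bar>a\<bar> \<bar>b\<bar> * min \<bar>a\<bar> \<bar>b\<bar> = a * a + b * b" for a b :: real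
      by (auto simp: max_def min_def)
    obtain x' where x: "0 \<le> v \<bullet> x'" "e \<bullet> x' \<le> c" "x' \<in> {x, rho x, sigma x, rho (sigma x)}" by (rule to_quarter)
    have "polar f x' * polar f x' + polar f (sigma x') * polar f (sigma x') = f x' * f x' + f (sigma x') * f (sigma x')"
      unfolding polar_quarter[OF anti x(1,2)] by (rule mm)
    then show ?thesis using x(3) by (auto simp: sigma_rho odd_reflD[OF anti] odd_reflD[OF polar_odd[OF anti]] add.commute)
  qed
  have dbl: "(LINT x|lborel. h x * h x + h (sigma x) * h (sigma x)) = 2 * l2_form h h" if h: "h \<in> sq_int" for h
  proof -
    have hm: "(\<lambda>x. h x * h x) \<in> borel_measurable borel" using h by (auto simp: sq_int_def)
    have "integrable lborel (\<lambda>x. h (sigma x) * h (sigma x))" "(LINT x|lborel. h (sigma x) * h (sigma x)) = l2_form h h"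
      using integral_isom_invol[OF isom(2) hm] h by (auto simp: sq_int_def l2_form_def)
    then show ?thesis using h by (simp add: sq_int_def l2_form_def)
  qed
  show ?thesis using dbl[OF f(1)] dbl[OF f(2)] unfolding pt by simp
qed

text \<open>The hypotheses say that the polarization of \<Omega> lies in \<Omega>': on the side
  \<open>e \<bullet> x \<le> c\<close> one of two mirror points in \<Omega> is enough, on the other
  side both are needed.\<close>

lemma polar_lip0:
  assumes anti: "odd_refl f" and f: "f \<in> lip0 \<Omega>"
    and \<Omega>1: "\<And>x. e \<bullet> x \<le> c \<Longrightarrow> x \<in> \<Omega> \<or> sigma x \<in> \<Omega> \<Longrightarrow> x \<in> \<Omega>'"
    and \<Omega>2: "\<And>x. c \<le> e \<bullet> x \<Longrightarrow> x \<in> \<Omega> \<Longrightarrow> sigma x \<in> \<Omega> \<Longrightarrow> x \<in> \<Omega>'"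
  shows "polar f \<in> lip0 \<Omega>'"
proof -
  obtain A K where f: "compact K" "K \<subseteq> \<Omega>" "\<And>x. x \<notin> K \<Longrightarrow> f x = 0"
      "\<And>x y. \<bar>f x - f y\<bar> \<le> A * norm (x - y)" "\<And>x. \<bar>f x\<bar> \<le> A"
    using f unfolding lip0_def by blast
  have A0: "0 \<le> A" using f(5)[of 0] by linarith
  define u where "u x = \<bar>f x\<bar>" for x
  define w where "w x = \<bar>u x - u (sigma x)\<bar>" for x
  \<comment> \<open>Maximum and minimum as half the sum plus or minus half the difference; the case
    distinction then sits in a sign factor that \<open>lipschitz_sgn\<close> can handle.\<close>
  define p where "p x = (u x + u (sigma x)) / 2 - sgn (e \<bullet> x - c) * w x / 2" for x
  have u: "\<bar>u x - u y\<bar> \<le> A * norm (x - y)" for x y using f(4)[of x y] unfolding u_def by linarith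
  have us: "\<bar>u (sigma x) - u (sigma y)\<bar> \<le> A * norm (x - y)" for x y
    using u[of "sigma x" "sigma y"] by (simp add: isom_invol_simps[OF isom(2)])
  have w: "\<bar>w x - w y\<bar> \<le> (2 * A) * norm (x - y)" for x y
    using u[of x y] us[of x y] unfolding w_def by (simp add: mult.assoc)
  have sw: "\<bar>sgn (e \<bullet> x - c) * w x - sgn (e \<bullet> y - c) * w y\<bar> \<le> (2 * A) * norm (x - y)" for x y
  proof (rule lipschitz_sgn[OF norm_e w])
    show "w x = 0" if "e \<bullet> x = c" for x using hrefl_fix[OF that] by (simp add: w_def)
  qed
  have p: "\<bar>p x - p y\<bar> \<le> (2 * A) * norm (x - y)" for x y
  proof -
    have "\<bar>((U + V) / 2 - a / 2) - ((U' + V') / 2 - b / 2)\<bar> \<le> 2 * D"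
      if "\<bar>U - U'\<bar> \<le> D" "\<bar>V - V'\<bar> \<le> D" "\<bar>a - b\<bar> \<le> 2 * D" for U V a U' V' b D :: real
      using that unfolding abs_le_iff by (auto simp: field_simps)
    from this[OF u[of x y] us[of x y], of "sgn (e \<bullet> x - c) * w x" "sgn (e \<bullet> y - c) * w y"]
    show ?thesis using sw[of x y] unfolding p_def by (simp add: mult.assoc)
  qed
  have pe: "p x = (if e \<bullet> x \<le> c then max \<bar>f x\<bar> \<bar>f (sigma x)\<bar> else min \<bar>f x\<bar> \<bar>f (sigma x)\<bar>)" for x
  proof (cases "e \<bullet> x = c")
    case True
    then show ?thesis using hrefl_fix[OF True] by (simp add: p_def u_def)
  next
    case False
    then show ?thesis by (auto simp: p_def u_def w_def sgn_if max_def min_def field_simps)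
  qed
  have pol: "polar f x = sgn (v \<bullet> x - 0) * p x" for x by (simp add: polar_def pe)
  have lip: "\<bar>polar f x - polar f y\<bar> \<le> (2 * A) * norm (x - y)" for x y
    unfolding pol
  proof (rule lipschitz_sgn[OF norm_v p])
    show "p x = 0" if "v \<bullet> x = 0" for x
      using anti_zero[OF anti, of x] anti_zero[OF anti, of "sigma x"] that by (simp add: pe)
  qed
  have bd: "\<bar>polar f x\<bar> \<le> 2 * A" for x
  proof -
    have "\<bar>p x\<bar> \<le> A" unfolding pe using f(5)[of x] f(5)[of "sigma x"] by auto
    moreover have "\<bar>polar f x\<bar> \<le> \<bar>p x\<bar>" unfolding pol by (simp add: abs_mult abs_sgn_eq)
    ultimately show ?thesis using A0 by linarith
  qed
  \<comment> \<open>The polarization of the support \<open>K\<close>, again compact.\<close>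
  define K' where "K' = ({x. e \<bullet> x \<le> c} \<inter> (K \<union> sigma ` K)) \<union> ({x. c \<le> e \<bullet> x} \<inter> (K \<inter> sigma ` K))"
  have sK: "compact (sigma ` K)" by (intro compact_continuous_image isom_invol_continuous isom f)
  have cl: "closed {x. e \<bullet> x \<le> c}" "closed {x. c \<le> e \<bullet> x}"
    by (auto intro!: closed_Collect_le continuous_intros)
  have cK: "compact K'"
    unfolding K'_def
    by (intro compact_Un closed_Int_compact cl f(1) sK compact_Int)
  have mem: "sigma x \<in> K \<longleftrightarrow> x \<in> sigma ` K" for x by (metis image_iff sigma_sigma)
  have "K' \<subseteq> \<Omega>'"
  proof
    fix x assume "x \<in> K'"
    then have "e \<bullet> x \<le> c \<and> (x \<in> K \<or> sigma x \<in> K) \<or> c \<le> e \<bullet> x \<and> x \<in> K \<and> sigma x \<in> K"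
      unfolding K'_def mem by blast
    then show "x \<in> \<Omega>'" using \<Omega>1[of x] \<Omega>2[of x] f(2) by blast
  qed
  moreover have "polar f x = 0" if "x \<notin> K'" for x
  proof -
    have "(e \<bullet> x \<le> c \<longrightarrow> x \<notin> K \<and> sigma x \<notin> K) \<and> (c \<le> e \<bullet> x \<longrightarrow> x \<notin> K \<or> sigma x \<notin> K)"
      using that unfolding K'_def mem by blast
    then have "p x = 0" unfolding pe using f(3)[of x] f(3)[of "sigma x"] by (auto simp: min_def)
    then show ?thesis by (simp add: pol)
  qed
  ultimately show ?thesis unfolding lip0_def
    using cK lip bd by (intro CollectI exI[of _ "2 * A"] exI[of _ K']) auto
qed

end

section \<open>Eigenfunctions vanishing on an open set\<close>

lemma weak_solution_lincomb:
  fixes \<Omega> :: "'a::euclidean_space set"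
  assumes s: "0 < s" "s < 1" and \<Omega>: "open \<Omega>" "\<Omega> \<subseteq> ball 0 1"
    and f: "weak_solution s \<Omega> \<mu> f" and h: "weak_solution s \<Omega> \<mu> h"
  shows "weak_solution s \<Omega> \<mu> (\<lambda>x. a * f x + b * h x)"
proof -
  note H = H0s_lincomb[OF s \<Omega>(1) bounded_domain[OF \<Omega>(2)]]
  have fh: "f \<in> H0s s \<Omega>" "h \<in> H0s s \<Omega>" using f h by (auto simp: weak_solution_def)
  show ?thesis
    unfolding weak_solution_iff[OF s \<Omega>]
  proof (intro conjI ballI H fh)
    fix \<psi> assume \<psi>: "\<psi> \<in> H0s s \<Omega>"
    note F = H0s_fin_energy[OF fh(1)] H0s_fin_energy[OF fh(2)] H0s_fin_energy[OF \<psi>]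
    note S = H0s_sq_int[OF s \<Omega> fh(1)] H0s_sq_int[OF s \<Omega> fh(2)] H0s_sq_int[OF s \<Omega> \<psi>]
    show "frac_form s (\<lambda>x. a * f x + b * h x) \<psi> = \<mu> * l2_form (\<lambda>x. a * f x + b * h x) \<psi>"
      unfolding semi_inner.lin[OF semi_inner_frac_form[OF s] F] semi_inner.lin[OF semi_inner_l2_form S]
      using f h \<psi> unfolding weak_solution_iff[OF s \<Omega>] by (simp add: algebra_simps)
  qed
qed

lemma weak_solution_isom_invol:
  fixes \<Omega> :: "'a::euclidean_space set"
  assumes s: "0 < s" "s < 1" and \<Omega>: "open \<Omega>" "\<Omega> \<subseteq> ball 0 1"
    and g: "isom_invol g" and g\<Omega>: "\<And>x. x \<in> \<Omega> \<Longrightarrow> g x \<in> \<Omega>"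
    and f: "weak_solution s \<Omega> \<mu> f"
  shows "weak_solution s \<Omega> \<mu> (\<lambda>x. f (g x))"
proof -
  note H = H0s_isom_invol[OF s \<Omega>(1) bounded_domain[OF \<Omega>(2)] g g\<Omega>]
  have fH: "f \<in> H0s s \<Omega>" using f by (auto simp: weak_solution_def)
  show ?thesis
    unfolding weak_solution_iff[OF s \<Omega>]
  proof (intro conjI ballI H fH)
    fix \<psi> assume \<psi>: "\<psi> \<in> H0s s \<Omega>"
    have m: "f \<in> borel_measurable borel" "(\<lambda>x. \<psi> (g x)) \<in> borel_measurable borel"
      using fH H[OF _ \<psi>] by (auto simp: H0s_def)
    have e: "(\<lambda>x. \<psi> (g (g x))) = \<psi>" using isom_invol_simps(1)[OF g] by simp
    have "frac_form s (\<lambda>x. f (g x)) \<psi> = frac_form s f (\<lambda>x. \<psi> (g x))"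
      using frac_form_isom_invol[OF g m, of s] unfolding e .
    also have "\<dots> = \<mu> * l2_form f (\<lambda>x. \<psi> (g x))"
      using f H[OF _ \<psi>] unfolding weak_solution_iff[OF s \<Omega>] by blast
    also have "l2_form f (\<lambda>x. \<psi> (g x)) = l2_form (\<lambda>x. f (g x)) \<psi>"
      using l2_form_isom_invol[OF g m] unfolding e by simp
    finally show "frac_form s (\<lambda>x. f (g x)) \<psi> = \<mu> * l2_form (\<lambda>x. f (g x)) \<psi>" .
  qed
qed

context two_reflections
begin

text \<open>A bump minus its mirror image. It shows that the odd class is nontrivial, and it is a
  test function with known sign in the half space.\<close>

lemma odd_bump:
  assumes \<Omega>: "\<And>x. x \<in> \<Omega> \<Longrightarrow> rho x \<in> \<Omega>" and O: "open O'" "O' \<noteq> {}" "O' \<subseteq> \<Omega>" "\<And>x. x \<in> O' \<Longrightarrow> 0 < v \<bullet> x"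
  obtains \<eta> a r where "\<eta> \<in> lip0 \<Omega>" "odd_refl \<eta>" "0 < r" "ball a r \<subseteq> O'" "\<And>x. 0 < v \<bullet> x \<Longrightarrow> 0 \<le> \<eta> x"
    "\<And>x. \<eta> x \<noteq> 0 \<Longrightarrow> x \<in> O' \<or> rho x \<in> O'" "\<And>x. x \<in> ball a r \<Longrightarrow> 0 < \<eta> x"
proof -
  obtain a r where r: "0 < r" "cball a r \<subseteq> O'" using O(1,2) open_contains_cball by blast
  have br: "ball a r \<subseteq> O'" using r ball_subset_cball by blast
  define \<beta> where "\<beta> = bump a r"
  have \<beta>0: "\<beta> x = 0" if "x \<notin> O'" for x using bump_eq_0[OF r(1), of x a] that br unfolding \<beta>_def by blast
  have \<beta>n: "0 \<le> \<beta> x" for x by (simp add: \<beta>_def bump_nonneg)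
  have sub: "closure {x. \<beta> x \<noteq> 0} \<subseteq> cball a r"
    using bump_eq_0[OF r(1)] ball_subset_cball unfolding \<beta>_def by (intro closure_minimal) fastforce+
  have "compact (closure {x. \<beta> x \<noteq> 0})"
    using compact_Int_closed[OF compact_cball closed_closure, of a r "{x. \<beta> x \<noteq> 0}"] sub by (simp add: Int_absorb1)
  then have "test_function \<Omega> \<beta>"
    unfolding test_function_def using sub r(2) O(3) times_cont_diff_bump by (auto simp: \<beta>_def)
  then have l: "\<beta> \<in> lip0 \<Omega>" by (rule test_function_lip0)
  define \<eta> where "\<eta> x = 1 * \<beta> x + (-1) * \<beta> (rho x)" for x
  have 1: "\<eta> \<in> lip0 \<Omega>" unfolding \<eta>_def[abs_def] by (intro lip0_lincomb lip0_isom_invol[OF isom(1)] \<Omega> l)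
  have 2: "odd_refl \<eta>" by (simp add: odd_refl_def \<eta>_def)
  have z: "\<beta> (rho x) = 0" if "0 < v \<bullet> x" for x using \<beta>0[of "rho x"] O(4)[of "rho x"] that by force
  have 3: "0 \<le> \<eta> x" if "0 < v \<bullet> x" for x using z[OF that] \<beta>n by (simp add: \<eta>_def)
  have 4: "x \<in> O' \<or> rho x \<in> O'" if "\<eta> x \<noteq> 0" for x
    using that by (cases "x \<in> O'"; cases "rho x \<in> O'"; simp add: \<eta>_def \<beta>0)
  have 5: "0 < \<eta> x" if "x \<in> ball a r" for x
  proof -
    have "0 < v \<bullet> x" using that br O(4) by blast
    moreover have "0 < \<beta> x" using that bump_pos_iff[OF r(1), of a x] by (simp add: \<beta>_def)
    ultimately show ?thesis using z by (simp add: \<eta>_def)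
  qed
  show ?thesis using that[OF 1 2 r(1) br 3 4 5] by blast
qed

lemma ker1_sign:
  assumes "x \<noteq> y" "x \<noteq> rho y"
  shows "0 \<le> (v \<bullet> x) * (v \<bullet> y) \<Longrightarrow> 0 \<le> ker1 x y" "(v \<bullet> x) * (v \<bullet> y) \<le> 0 \<Longrightarrow> ker1 x y \<le> 0"
proof -
  define D where "D = (norm (x - y))\<^sup>2"
  define D' where "D' = (norm (x - rho y))\<^sup>2"
  define A where "A = (v \<bullet> x) * (v \<bullet> y)"
  have "0 < D" "0 < D'" using assms unfolding D_def D'_def by simp_all
  moreover have "D' = D + 4 * A"
    using norm_sq_hrefl[OF norm_v, of x 0 y] by (simp add: D_def D'_def A_def)
  ultimately have D: "0 < D" "0 < D'" "D' = D + 4 * A" by auto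
  have k: "ker1 x y = D powr (- ((real DIM('a) + 2 * s) / 2)) - D' powr (- ((real DIM('a) + 2 * s) / 2))"
    unfolding ker1_def frac_ker_sq D_def D'_def ..
  show "0 \<le> ker1 x y" if "0 \<le> (v \<bullet> x) * (v \<bullet> y)"
    using neg_powr_mono[OF exponent_pos D(1), of "4 * A"] that D(3) unfolding k A_def by simp
  show "ker1 x y \<le> 0" if "(v \<bullet> x) * (v \<bullet> y) \<le> 0"
    using neg_powr_mono[OF exponent_pos D(2), of "- 4 * A"] that D(3) unfolding k A_def by simp
qed

text \<open>Nonlocality replaces unique continuation: if \<open>\<phi>\<close> vanishes on \<open>O'\<close>, then testing with a bump
  in \<open>O'\<close> leaves only the interaction with the rest of the half space, which has a sign.\<close>

lemma vanishing_on_open: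
  assumes \<Omega>: "open \<Omega>" "\<Omega> \<subseteq> ball 0 1" "\<And>x. x \<in> \<Omega> \<Longrightarrow> rho x \<in> \<Omega>"
    and \<phi>: "weak_solution s \<Omega> \<mu> \<phi>" "odd_refl \<phi>" "AE x in lborel. 0 < v \<bullet> x \<longrightarrow> 0 \<le> \<phi> x"
    and O: "open O'" "O' \<noteq> {}" "O' \<subseteq> \<Omega>" "\<And>x. x \<in> O' \<Longrightarrow> 0 < v \<bullet> x"
    and z: "AE x in lborel. x \<in> O' \<longrightarrow> \<phi> x = 0"
  shows "AE x in lborel. \<phi> x = 0"
proof -
  obtain \<eta> a r where \<eta>: "\<eta> \<in> lip0 \<Omega>" "odd_refl \<eta>" and r: "0 < r" "ball a r \<subseteq> O'" and \<eta>n: "\<And>x. 0 < v \<bullet> x \<Longrightarrow> 0 \<le> \<eta> x"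
    and \<eta>s: "\<And>x. \<eta> x \<noteq> 0 \<Longrightarrow> x \<in> O' \<or> rho x \<in> O'" and \<eta>p: "\<And>x. x \<in> ball a r \<Longrightarrow> 0 < \<eta> x"
    by (rule odd_bump[OF \<Omega>(3) O]) (assumption, assumption, rule that)
  have \<eta>H: "\<eta> \<in> H0s s \<Omega>" using \<eta>(1) lip0_subset_H0s[OF s \<Omega>(1) bounded_domain[OF \<Omega>(2)]] by blast
  have \<phi>H: "\<phi> \<in> H0s s \<Omega>" using \<phi>(1) by (simp add: weak_solution_def)
  \<comment> \<open>\<open>\<phi>\<close> vanishes almost everywhere on \<open>O'\<close> and, by
    oddness, on its mirror image; \<open>\<eta>\<close> lives on these two sets.\<close>
  have z': "AE x in lborel. \<eta> x * \<phi> x = 0"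
    using z AE_isom_invol[OF isom(1) z]
  proof eventually_elim
    case (elim x)
    have "\<phi> x = 0" if "\<eta> x \<noteq> 0"
    proof (cases "x \<in> O'")
      case False
      then have "\<phi> (rho x) = 0" using \<eta>s[OF that] elim(2) by (simp only: simp_thms)
      then show ?thesis using odd_reflD[OF \<phi>(2), of x] by simp
    qed (use elim(1) in blast)
    then show ?case by (cases "\<eta> x = 0") simp_all
  qed
  define F where "F = frac_integrand s \<phi> \<eta>"
  have Fi: "integrable lborel F"
    unfolding F_def by (rule frac_integrand_integrable[OF H0s_fin_energy[OF \<phi>H] H0s_fin_energy[OF \<eta>H]])
  have Fm: "F \<in> borel_measurable borel"
    unfolding F_def by (intro frac_integrand_measurable) (use \<phi>H \<eta>H in \<open>auto simp: H0s_def\<close>)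
  have "l2_form \<phi> \<eta> = 0"
    unfolding l2_form_def by (rule integral_eq_zero_AE) (use z' in \<open>simp add: mult.commute\<close>)
  then have "frac_form s \<phi> \<eta> = 0" using \<phi>(1) \<eta>H unfolding weak_solution_iff[OF s \<Omega>(1,2)] by simp
  then have F0: "(LINT z|lborel. F z) = 0"
    using frac_const_pos[OF s, where 'a='a] by (simp add: frac_form_def F_def)
  \<comment> \<open>Reflecting the second variable keeps the integral but flips the sign of the
    numerator; adding both versions replaces the kernel by \<open>ker1\<close>.\<close>
  define F' where "F' z = F (fst z, rho (snd z))" for z
  have F': "integrable lborel F'" "(LINT z|lborel. F' z) = 0"
    using integral_isom_invol_pair[OF isom_invol_id isom(1) Fm] Fi F0 by (auto simp: F'_def[abs_def])
  define G where "G z = (\<eta> (fst z) * \<phi> (snd z) + \<eta> (snd z) * \<phi> (fst z)) * ker1 (fst z) (snd z)" for z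
  have G: "AE z in lborel. - (F z + F' z) = G z"
    using AE_product[OF z'] AE_product[OF AE_isom_invol[OF isom(1) z']]
  proof eventually_elim
    case (elim z)
    have zz: "\<eta> (fst z) * \<phi> (fst z) = 0" "\<eta> (snd z) * \<phi> (snd z) = 0" using elim by auto
    have "(\<phi> x - \<phi> y) * (\<eta> x - \<eta> y) = - (\<eta> x * \<phi> y + \<eta> y * \<phi> x)" if "\<eta> x * \<phi> x = 0" "\<eta> y * \<phi> y = 0" for x y
    proof -
      have "(\<phi> x - \<phi> y) * (\<eta> x - \<eta> y) = \<eta> x * \<phi> x + \<eta> y * \<phi> y - (\<eta> x * \<phi> y + \<eta> y * \<phi> x)" by (simp add: algebra_simps)
      then show ?thesis using that by simp
    qed
    note q = this
    have "F z = - (\<eta> (fst z) * \<phi> (snd z) + \<eta> (snd z) * \<phi> (fst z)) * frac_ker s (fst z - snd z)"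
      using q[OF zz] frac_integrand_eq[of s \<phi> \<eta> "fst z" "snd z"] by (simp add: F_def)
    moreover have "F' z = (\<eta> (fst z) * \<phi> (snd z) + \<eta> (snd z) * \<phi> (fst z)) * frac_ker s (fst z - rho (snd z))"
      using q[of "fst z" "rho (snd z)"] zz frac_integrand_eq[of s \<phi> \<eta> "fst z" "rho (snd z)"]
      by (simp add: F'_def F_def odd_reflD[OF \<phi>(2)] odd_reflD[OF \<eta>(2)])
    ultimately show ?case by (simp add: G_def ker1_def algebra_simps)
  qed
  have sgn_ae: "AE x in lborel. (0 \<le> v \<bullet> x \<longrightarrow> 0 \<le> \<phi> x) \<and> (v \<bullet> x \<le> 0 \<longrightarrow> \<phi> x \<le> 0)"
    using \<phi>(3) AE_isom_invol[OF isom(1) \<phi>(3)]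
  proof eventually_elim
    case (elim x)
    then show ?case using odd_reflD[OF \<phi>(2), of x] anti_zero[OF \<phi>(2), of x]
      by (cases "v \<bullet> x" "0::real" rule: linorder_cases) auto
  qed
  have sgn_eta: "(0 \<le> v \<bullet> x \<longrightarrow> 0 \<le> \<eta> x) \<and> (v \<bullet> x \<le> 0 \<longrightarrow> \<eta> x \<le> 0)" for x
    using \<eta>n[of x] \<eta>n[of "rho x"] odd_reflD[OF \<eta>(2), of x] anti_zero[OF \<eta>(2), of x]
    by (cases "v \<bullet> x" "0::real" rule: linorder_cases) auto
  \<comment> \<open>Both functions are odd and nonnegative in the half space, so the bracket in
    \<open>G\<close> is nonnegative or nonpositive together with \<open>ker1\<close>, according to
    the sides on which the two points lie.\<close>
  have Gn: "AE z in lborel. 0 \<le> G z"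
    using AE_product[OF sgn_ae] AE_off_diagonal AE_neq_isom_invol[OF isom(1)]
  proof eventually_elim
    case (elim z)
    define x y where xy: "x = fst z" "y = snd z"
    have sx: "(0 \<le> v \<bullet> x \<longrightarrow> 0 \<le> \<phi> x) \<and> (v \<bullet> x \<le> 0 \<longrightarrow> \<phi> x \<le> 0)"
      and sy: "(0 \<le> v \<bullet> y \<longrightarrow> 0 \<le> \<phi> y) \<and> (v \<bullet> y \<le> 0 \<longrightarrow> \<phi> y \<le> 0)" using elim by (auto simp: xy)
    have k: "0 \<le> (v \<bullet> x) * (v \<bullet> y) \<Longrightarrow> 0 \<le> ker1 x y" "(v \<bullet> x) * (v \<bullet> y) \<le> 0 \<Longrightarrow> ker1 x y \<le> 0"
      using ker1_sign[of x y] elim by (auto simp: xy)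
    have "0 \<le> (\<eta> x * \<phi> y + \<eta> y * \<phi> x) * ker1 x y"
    proof (cases "0 \<le> v \<bullet> x"; cases "0 \<le> v \<bullet> y")
      assume h: "0 \<le> v \<bullet> x" "0 \<le> v \<bullet> y"
      then show ?thesis using sx sy sgn_eta[of x] sgn_eta[of y] k by (intro mult_nonneg_nonneg add_nonneg_nonneg) auto
    next
      assume h: "0 \<le> v \<bullet> x" "\<not> 0 \<le> v \<bullet> y"
      then have "ker1 x y \<le> 0" using k by (simp add: mult_nonneg_nonpos)
      then show ?thesis using h sx sy sgn_eta[of x] sgn_eta[of y]
        by (intro mult_nonpos_nonpos add_nonpos_nonpos) (auto simp: mult_nonneg_nonpos mult_nonpos_nonneg)
    next
      assume h: "\<not> 0 \<le> v \<bullet> x" "0 \<le> v \<bullet> y"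
      then have "ker1 x y \<le> 0" using k by (simp add: mult_nonpos_nonneg)
      then show ?thesis using h sx sy sgn_eta[of x] sgn_eta[of y]
        by (intro mult_nonpos_nonpos add_nonpos_nonpos) (auto simp: mult_nonneg_nonpos mult_nonpos_nonneg)
    next
      assume h: "\<not> 0 \<le> v \<bullet> x" "\<not> 0 \<le> v \<bullet> y"
      then have "0 \<le> ker1 x y" using k by (simp add: mult_nonpos_nonpos)
      moreover have "0 \<le> \<eta> x * \<phi> y + \<eta> y * \<phi> x"
        using h sx sy sgn_eta[of x] sgn_eta[of y] by (intro add_nonneg_nonneg mult_nonpos_nonpos) auto
      ultimately show ?thesis by (rule mult_nonneg_nonneg[rotated])
    qed
    then show ?case by (simp add: G_def xy)
  qed
  have Hi: "integrable lborel (\<lambda>z. - (F z + F' z))" "(LINT z|lborel. - (F z + F' z)) = 0"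
    using Fi F' F0 by auto
  have Hn: "AE z in lborel. 0 \<le> - (F z + F' z)" using G Gn by eventually_elim simp
  have "AE z in lborel. - (F z + F' z) = 0"
    using integral_nonneg_eq_0_iff_AE[OF Hi(1) Hn] Hi(2) by blast
  with G have "AE z in lborel. G z = 0" by eventually_elim simp
  then have "AE z in (lborel \<Otimes>\<^sub>M lborel). G z = 0" unfolding lborel_prod .
  then have "AE x in lborel. AE y in lborel. G (x, y) = 0" by (rule lborel_pair.AE_pair)
  with z have "AE x in lborel. (x \<in> O' \<longrightarrow> \<phi> x = 0) \<and> (AE y in lborel. G (x, y) = 0)" by eventually_elim simp
  \<comment> \<open>At such a point \<open>\<phi> x = 0\<close> and \<open>\<eta> x\<close> is
    positive, so \<open>G (x, y)\<close> is a positive multiple of \<open>\<phi> y\<close> for every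
    other \<open>y\<close> in the half space.\<close>
  then obtain x where x: "x \<in> ball a r" "x \<in> O' \<longrightarrow> \<phi> x = 0" "AE y in lborel. G (x, y) = 0"
    by (rule AE_open_witness[rotated 2, of _ "ball a r"]) (use r in auto)
  have xO: "x \<in> O'" using x(1) r(2) by blast
  have "AE y in lborel. y \<noteq> x" by (rule AE_lborel_singleton)
  with x(3) have pos: "AE y in lborel. 0 < v \<bullet> y \<longrightarrow> \<phi> y = 0"
  proof eventually_elim
    case (elim y)
    show ?case
    proof
      assume "0 < v \<bullet> y"
      then have "0 < ker1 x y" using elim(2) O(4)[OF xO] by (intro ker1_pos) auto
      then show "\<phi> y = 0" using elim(1) x(2) xO \<eta>p[OF x(1)] by (simp add: G_def)
    qed
  qed
  from pos AE_isom_invol[OF isom(1) pos] show ?thesis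
  proof eventually_elim
    case (elim y)
    then show ?case using odd_reflD[OF \<phi>(2), of y] anti_zero[OF \<phi>(2), of y]
      by (cases "v \<bullet> y" "0::real" rule: linorder_cases) auto
  qed
qed

text \<open>The mirror of \<open>sigma\<close> cuts the half space into two mirror images and is
  itself a null set.\<close>

lemma AE_half_space:
  assumes "AE y in lborel. y \<in> quarter \<longrightarrow> P y \<and> P (sigma y)"
  shows "AE y in lborel. 0 < v \<bullet> y \<longrightarrow> P y"
proof -
  have "e \<noteq> 0" using norm_e by auto
  then have "negligible {y. e \<bullet> y = c}" by (intro negligible_hyperplane) simp
  then have "{y. e \<bullet> y = c} \<in> null_sets lborel"
    using borel_closed[OF closed_hyperplane, of e c] by (simp add: negligible_iff_null_sets null_sets_completion_iff)
  then have "AE y in lborel. e \<bullet> y \<noteq> c" by (rule AE_I') auto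
  with assms AE_isom_invol[OF isom(2) assms] show ?thesis
    by eventually_elim (auto simp: quarter_def not_less le_less)
qed

end

section \<open>Strict monotonicity\<close>

lemma l2_tendsto_AE_subseq:
  fixes u :: "nat \<Rightarrow> 'a::euclidean_space \<Rightarrow> real"
  assumes d: "\<And>n. (\<lambda>x. u n x - w x) \<in> sq_int"
    and lim: "(\<lambda>n. l2_quad (\<lambda>x. u n x - w x)) \<longlonglongrightarrow> 0"
  obtains r :: "nat \<Rightarrow> nat" where "strict_mono r" "AE x in lborel. (\<lambda>n. u (r n) x) \<longlonglongrightarrow> w x"
proof -
  have i: "integrable lborel (\<lambda>x. (u n x - w x) * (u n x - w x))" for n using d[of n] by (simp add: sq_int_def)
  have "(\<lambda>n. LINT x|lborel. norm ((u n x - w x) * (u n x - w x))) \<longlonglongrightarrow> 0"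
    using lim by (simp add: l2_form_def)
  from tendsto_L1_AE_subseq[OF i this]
  obtain r where r: "strict_mono r" "AE x in lborel. (\<lambda>n. (u (r n) x - w x) * (u (r n) x - w x)) \<longlonglongrightarrow> 0" by blast
  from r(2) have "AE x in lborel. (\<lambda>n. u (r n) x) \<longlonglongrightarrow> w x"
  proof eventually_elim
    case (elim x)
    then have "(\<lambda>n. (u (r n) x - w x)\<^sup>2) \<longlonglongrightarrow> 0" by (simp add: power2_eq_square)
    then have "(\<lambda>n. u (r n) x - w x) \<longlonglongrightarrow> 0" by (simp add: tendsto_null_power)
    then show ?case using LIM_zero_iff by blast
  qed
  then show ?thesis using that r(1) by blast
qed

context two_reflections
begin

lemma polar_gap_fatou:
  assumes \<psi>: "\<And>n. \<psi> n \<in> borel_measurable borel" and lim: "AE x in lborel. (\<lambda>n. \<psi> n x) \<longlonglongrightarrow> \<phi> x"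
  shows "(\<integral>\<^sup>+z. ennreal (polar_gap \<phi> z) \<partial>lborel) \<le> liminf (\<lambda>n. \<integral>\<^sup>+z. ennreal (polar_gap (\<psi> n) z) \<partial>lborel)"
proof -
  have "AE x in lborel. (\<lambda>n. \<psi> n x) \<longlonglongrightarrow> \<phi> x \<and> (\<lambda>n. \<psi> n (sigma x)) \<longlonglongrightarrow> \<phi> (sigma x)"
    using lim AE_isom_invol[OF isom(2) lim] by eventually_elim simp
  from AE_product[OF this]
  have "AE z in lborel. ennreal (polar_gap \<phi> z) = liminf (\<lambda>n. ennreal (polar_gap (\<psi> n) z))"
  proof eventually_elim
    case (elim z)
    have "(\<lambda>n. polar_gap (\<psi> n) z) \<longlonglongrightarrow> polar_gap \<phi> z"
      unfolding polar_gap_def deficit_def using elim by (intro tendsto_intros) auto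
    then have "(\<lambda>n. ennreal (polar_gap (\<psi> n) z)) \<longlonglongrightarrow> ennreal (polar_gap \<phi> z)" by (rule tendsto_ennrealI)
    then show ?case by (intro lim_imp_Liminf[symmetric]) auto
  qed
  then have "(\<integral>\<^sup>+z. ennreal (polar_gap \<phi> z) \<partial>lborel) = (\<integral>\<^sup>+z. liminf (\<lambda>n. ennreal (polar_gap (\<psi> n) z)) \<partial>lborel)"
    by (rule nn_integral_cong_AE)
  also have "\<dots> \<le> liminf (\<lambda>n. \<integral>\<^sup>+z. ennreal (polar_gap (\<psi> n) z) \<partial>lborel)"
    using polar_gap_measurable[OF \<psi>] by (intro nn_integral_liminf) simp
  finally show ?thesis .
qed

text \<open>The equality case of the deficit holds for almost all pairs. One good point with a
  nonzero value fixes the sign on the whole half space; one good point whose absolute value differs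
  from that at its mirror point fixes the direction of the order.\<close>

lemma polar_gap_zero:
  assumes m: "\<phi> \<in> borel_measurable borel" and z: "(\<integral>\<^sup>+z. ennreal (polar_gap \<phi> z) \<partial>lborel) = 0"
  obtains t where "t \<noteq> 0" "AE x in lborel. 0 < v \<bullet> x \<longrightarrow> 0 \<le> t * \<phi> x"
    "(AE x in lborel. x \<in> quarter \<longrightarrow> \<bar>\<phi> (sigma x)\<bar> \<le> \<bar>\<phi> x\<bar>) \<or> (AE x in lborel. x \<in> quarter \<longrightarrow> \<bar>\<phi> x\<bar> \<le> \<bar>\<phi> (sigma x)\<bar>)"
proof -
  define R where "R x y \<longleftrightarrow> 0 \<le> \<phi> x * \<phi> y \<and> 0 \<le> \<phi> x * \<phi> (sigma y) \<and> 0 \<le> \<phi> (sigma x) * \<phi> y \<and> 0 \<le> \<phi> (sigma x) * \<phi> (sigma y)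
    \<and> 0 \<le> (\<bar>\<phi> x\<bar> - \<bar>\<phi> (sigma x)\<bar>) * (\<bar>\<phi> y\<bar> - \<bar>\<phi> (sigma y)\<bar>)" for x y
  have "AE z in lborel. polar_gap \<phi> z = 0"
    using z polar_gap_measurable[OF m] polar_gap_nonneg[of \<phi>]
    by (subst (asm) nn_integral_0_iff_AE) (auto simp: antisym)
  then have "AE z in (lborel \<Otimes>\<^sub>M lborel). polar_gap \<phi> z = 0" unfolding lborel_prod .
  then have "AE x in lborel. AE y in lborel. polar_gap \<phi> (x, y) = 0" by (rule lborel_pair.AE_pair)
  then have good: "AE x in lborel. x \<in> quarter \<longrightarrow> (AE y in lborel. y \<in> quarter \<longrightarrow> R x y)"
  proof eventually_elim
    case (elim x)
    show ?case
    proof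
      assume x: "x \<in> quarter"
      have "AE y in lborel. y \<noteq> x" by (rule AE_lborel_singleton)
      with elim show "AE y in lborel. y \<in> quarter \<longrightarrow> R x y"
      proof eventually_elim
        case (elim y)
        show ?case
        proof
          assume y: "y \<in> quarter"
          have xy: "x \<noteq> y" using elim by auto
          have "deficit (ker1 x y) (ker2 x y) (\<phi> x) (\<phi> (sigma x)) (\<phi> y) (\<phi> (sigma y)) = 0"
            using elim x y xy by (simp add: polar_gap_def)
          from deficit_eq_0[OF ker_order_strict(2)[OF xy x y] ker_order_strict(1)[OF xy x y] this]
          show "R x y" by (simp add: R_def)
        qed
      qed
    qed
  qed
  have 1: "\<exists>t. t \<noteq> 0 \<and> (AE x in lborel. 0 < v \<bullet> x \<longrightarrow> 0 \<le> t * \<phi> x)"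
  proof (cases "\<exists>x\<in>quarter. (AE y in lborel. y \<in> quarter \<longrightarrow> R x y) \<and> (\<phi> x \<noteq> 0 \<or> \<phi> (sigma x) \<noteq> 0)")
    case True
    then obtain x where x: "AE y in lborel. y \<in> quarter \<longrightarrow> R x y" "\<phi> x \<noteq> 0 \<or> \<phi> (sigma x) \<noteq> 0" by blast
    define t where "t = (if \<phi> x \<noteq> 0 then \<phi> x else \<phi> (sigma x))"
    have "AE y in lborel. y \<in> quarter \<longrightarrow> 0 \<le> t * \<phi> y \<and> 0 \<le> t * \<phi> (sigma y)"
      using x(1) by eventually_elim (auto simp: R_def t_def)
    then have "AE y in lborel. 0 < v \<bullet> y \<longrightarrow> 0 \<le> t * \<phi> y" by (rule AE_half_space)
    moreover have "t \<noteq> 0" using x(2) by (auto simp: t_def)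
    ultimately show ?thesis by blast
  next
    case False
    \<comment> \<open>No good point carries a nonzero value, so the function vanishes almost
      everywhere in the half space and 1 serves as \<open>t\<close>.\<close>
    have "AE y in lborel. y \<in> quarter \<longrightarrow> 0 \<le> 1 * \<phi> y \<and> 0 \<le> 1 * \<phi> (sigma y)"
      using good by eventually_elim (use False in auto)
    then have "AE y in lborel. 0 < v \<bullet> y \<longrightarrow> 0 \<le> 1 * \<phi> y" by (rule AE_half_space)
    then show ?thesis by (intro exI[of _ 1]) simp
  qed
  have 2: "(AE x in lborel. x \<in> quarter \<longrightarrow> \<bar>\<phi> (sigma x)\<bar> \<le> \<bar>\<phi> x\<bar>) \<or> (AE x in lborel. x \<in> quarter \<longrightarrow> \<bar>\<phi> x\<bar> \<le> \<bar>\<phi> (sigma x)\<bar>)"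
  proof (cases "\<exists>x\<in>quarter. (AE y in lborel. y \<in> quarter \<longrightarrow> R x y) \<and> \<bar>\<phi> x\<bar> \<noteq> \<bar>\<phi> (sigma x)\<bar>")
    case True
    then obtain x where x: "AE y in lborel. y \<in> quarter \<longrightarrow> R x y" "\<bar>\<phi> x\<bar> \<noteq> \<bar>\<phi> (sigma x)\<bar>" by blast
    show ?thesis
    proof (cases "\<bar>\<phi> (sigma x)\<bar> < \<bar>\<phi> x\<bar>")
      case True
      have "AE y in lborel. y \<in> quarter \<longrightarrow> \<bar>\<phi> (sigma y)\<bar> \<le> \<bar>\<phi> y\<bar>"
        using x(1) by eventually_elim (use True in \<open>auto simp: R_def zero_le_mult_iff\<close>)
      then show ?thesis by blast
    next
      case False
      then have *: "\<bar>\<phi> x\<bar> < \<bar>\<phi> (sigma x)\<bar>" using x(2) by simp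
      have "AE y in lborel. y \<in> quarter \<longrightarrow> \<bar>\<phi> y\<bar> \<le> \<bar>\<phi> (sigma y)\<bar>"
        using x(1) by eventually_elim (use * in \<open>auto simp: R_def zero_le_mult_iff\<close>)
      then show ?thesis by blast
    qed
  next
    case False
    have "AE y in lborel. y \<in> quarter \<longrightarrow> \<bar>\<phi> (sigma y)\<bar> \<le> \<bar>\<phi> y\<bar>"
      using good by eventually_elim (use False in auto)
    then show ?thesis by blast
  qed
  show ?thesis using that 1 2 by blast
qed

text \<open>The reflection \<open>sigma\<close> exchanges the centres \<open>0\<close> and \<open>(2 * c) *\<^sub>R e\<close> of the two holes.\<close>

theorem frac_lambda_2_strict:
  fixes \<tau> :: real
  defines "a \<equiv> (2 * c) *\<^sub>R e"
  defines "\<Omega>\<^sub>0 \<equiv> ball 0 1 - cball (0::'a) \<tau>" and "\<Omega>\<^sub>a \<equiv> ball 0 1 - cball a \<tau>"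
  assumes c: "0 < c" "2 * c < 1 - \<tau>" and \<tau>: "0 < \<tau>" "\<tau> < 1"
    and \<phi>: "weak_solution s \<Omega>\<^sub>0 \<mu> \<phi>" "odd_refl \<phi>" "nontrivial \<phi>"
  shows "frac_lambda 2 s \<Omega>\<^sub>a < \<mu>"
proof (rule ccontr)
  interpret E: semi_inner "fin_energy s" "frac_form s :: ('a \<Rightarrow> real) \<Rightarrow> _" by (rule semi_inner_frac_form[OF s])
  interpret L: semi_inner sq_int "l2_form :: ('a \<Rightarrow> real) \<Rightarrow> _" by (rule semi_inner_l2_form)
  define lam where "lam = frac_lambda 2 s \<Omega>\<^sub>a"
  assume "\<not> frac_lambda 2 s \<Omega>\<^sub>a < \<mu>"
  then have le: "\<mu> \<le> lam" by (simp add: lam_def)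
  have \<Omega>: "open \<Omega>\<^sub>0" "\<Omega>\<^sub>0 \<subseteq> ball 0 1" "open \<Omega>\<^sub>a" "\<Omega>\<^sub>a \<subseteq> ball 0 1"
    by (auto simp: \<Omega>\<^sub>0_def \<Omega>\<^sub>a_def)
  have ee: "e \<bullet> e = 1" "v \<bullet> v = 1" using norm_e norm_v by (simp_all add: norm_eq_1)
  have sa: "sigma a = 0" by (simp add: hrefl_def a_def ee)
  have norm_sigma: "norm (sigma x) = norm (x - a)" for x
    using isom_invol_simps(2)[OF isom(2), of x a] by (simp add: sa)
  have ra: "rho a = a" "rho 0 = 0" using orth by (auto simp: hrefl_def a_def)
  have norm_rho: "norm (rho x) = norm x" "norm (rho x - a) = norm (x - a)" for x
    using isom_invol_simps(2)[OF isom(1), of x 0] isom_invol_simps(2)[OF isom(1), of x a] ra by simp_all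
  have \<Omega>0: "x \<in> \<Omega>\<^sub>0 \<longleftrightarrow> norm x < 1 \<and> \<tau> < norm x" for x by (auto simp: \<Omega>\<^sub>0_def)
  have \<Omega>a: "x \<in> \<Omega>\<^sub>a \<longleftrightarrow> norm x < 1 \<and> \<tau> < norm (x - a)" for x
    by (auto simp: \<Omega>\<^sub>a_def dist_norm norm_minus_commute)
  have rho0: "rho x \<in> \<Omega>\<^sub>0" if "x \<in> \<Omega>\<^sub>0" for x using that by (simp add: \<Omega>0 norm_rho)
  have rhoa: "rho x \<in> \<Omega>\<^sub>a" if "x \<in> \<Omega>\<^sub>a" for x using that by (simp add: \<Omega>a norm_rho)
  have norm_xa: "(norm (x - a))\<^sup>2 = (norm x)\<^sup>2 - 4 * c * (e \<bullet> x - c)" for x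
    by (simp add: power2_norm_eq_inner a_def inner_diff_left inner_diff_right ee inner_commute[of x e] algebra_simps)
  have near: "norm x \<le> norm (x - a)" if "e \<bullet> x \<le> c" for x
  proof (rule power2_le_imp_le)
    show "(norm x)\<^sup>2 \<le> (norm (x - a))\<^sup>2" unfolding norm_xa using c(1) that by (simp add: mult_nonneg_nonpos)
  qed simp
  \<comment> \<open>This and the next fact are the hypotheses of \<open>polar_lip0\<close>:
    polarization moves the hole of the concentric annulus from 0 to \<open>a\<close>.\<close>
  have \<Omega>1: "x \<in> \<Omega>\<^sub>a" if "e \<bullet> x \<le> c" "x \<in> \<Omega>\<^sub>0 \<or> sigma x \<in> \<Omega>\<^sub>0" for x
    using that near[OF that(1)] by (auto simp: \<Omega>0 \<Omega>a norm_sigma)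
  have \<Omega>2: "x \<in> \<Omega>\<^sub>a" if "c \<le> e \<bullet> x" "x \<in> \<Omega>\<^sub>0" "sigma x \<in> \<Omega>\<^sub>0" for x
    using that by (auto simp: \<Omega>0 \<Omega>a norm_sigma)
  have normxy: "(norm (p *\<^sub>R e + q *\<^sub>R v))\<^sup>2 = p\<^sup>2 + q\<^sup>2" for p q
    unfolding power2_norm_eq_inner
    by (simp add: inner_add_left inner_add_right ee orth inner_commute[of e v] power2_eq_square)
  have ip: "e \<bullet> (p *\<^sub>R e + q *\<^sub>R v) = p" "v \<bullet> (p *\<^sub>R e + q *\<^sub>R v) = q" for p q
    using orth by (simp_all add: inner_add_right ee inner_commute[of e v])
  \<comment> \<open>\<open>O1\<close> lies in the hole around \<open>a\<close>, and its mirror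
    points in the hole around 0; the mirror points of \<open>O2\<close> leave the unit ball. At all
    these mirror points \<open>\<phi>\<close> is 0.\<close>
  define O1 where "O1 = {x. 0 < v \<bullet> x} \<inter> {x. c < e \<bullet> x} \<inter> {x. norm (x - a) < \<tau>} \<inter> {x. \<tau> < norm x} \<inter> {x. norm x < 1}"
  define O2 where "O2 = {x. 0 < v \<bullet> x} \<inter> {x. e \<bullet> x < c} \<inter> {x. 1 < norm (x - a)} \<inter> {x. \<tau> < norm x} \<inter> {x. norm x < 1}"
  have oO: "open O1" "open O2"
    unfolding O1_def O2_def by (intro open_Int open_Collect_less continuous_intros)+
  have O1ne: "O1 \<noteq> {}"
  proof -
    \<comment> \<open>The witness is \<open>a\<close> plus p (e + v), at squared distance
      \<open>R\<close> from \<open>a\<close>. The minimum puts \<open>R\<close> below \<tau>^2 yet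
      keeps R + 4 c^2 above it, so the point is outside the hole around 0.\<close>
    define R where "R = \<tau>\<^sup>2 - min (2 * c\<^sup>2) (\<tau>\<^sup>2 / 2)"
    have "0 < c\<^sup>2" "0 < \<tau>\<^sup>2" using c(1) \<tau>(1) by auto
    moreover from this have "0 < min (2 * c\<^sup>2) (\<tau>\<^sup>2 / 2)" unfolding min_less_iff_conj by linarith
    ultimately have R: "0 < R" "R < \<tau>\<^sup>2" "\<tau>\<^sup>2 < R + 4 * c\<^sup>2"
      using min.cobounded1[of "2 * c\<^sup>2" "\<tau>\<^sup>2 / 2"] min.cobounded2[of "2 * c\<^sup>2" "\<tau>\<^sup>2 / 2"]
      unfolding R_def by linarith+
    define p where "p = sqrt (R / 2)"
    have p: "0 < p" "p\<^sup>2 + p\<^sup>2 = R" using R by (auto simp: p_def)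
    define x where "x = (2 * c + p) *\<^sub>R e + p *\<^sub>R v"
    have xa: "x - a = p *\<^sub>R e + p *\<^sub>R v" by (simp add: x_def a_def algebra_simps)
    have 1: "norm (x - a) < \<tau>"
    proof (rule power2_less_imp_less)
      show "(norm (x - a))\<^sup>2 < \<tau>\<^sup>2" unfolding xa normxy using p R by simp
    qed (use \<tau> in simp)
    have 2: "\<tau> < norm x"
    proof (rule power2_less_imp_less)
      have "(2 * c + p)\<^sup>2 + p\<^sup>2 = 4 * c\<^sup>2 + 4 * c * p + (p\<^sup>2 + p\<^sup>2)" by (simp add: power2_eq_square algebra_simps)
      moreover have "0 < c * p" using c p by simp
      ultimately show "\<tau>\<^sup>2 < (norm x)\<^sup>2" unfolding x_def normxy using p R by simp
    qed simp
    have "norm x \<le> norm (x - a) + norm a" by (metis diff_add_cancel norm_triangle_ineq)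
    moreover have "norm a = 2 * c" using c norm_e by (simp add: a_def)
    ultimately have 3: "norm x < 1" using 1 c by linarith
    have "x \<in> O1" unfolding O1_def using 1 2 3 p c ip[of "2 * c + p" p] by (simp add: x_def)
    then show ?thesis by blast
  qed
  have O2ne: "O2 \<noteq> {}"
  proof -
    \<comment> \<open>Here the witness is p (v - e), of squared norm \<open>R\<close> between
      \<tau>^2 and 1; its squared distance to \<open>a\<close> exceeds R + 4 c^2, hence 1.\<close>
    define R where "R = 1 - min (2 * c\<^sup>2) ((1 - \<tau>\<^sup>2) / 2)"
    have t1: "\<tau>\<^sup>2 < 1" using \<tau> by (simp add: power_less_one_iff abs_square_less_1)
    have R: "\<tau>\<^sup>2 < R" "R < 1" "1 < R + 4 * c\<^sup>2" using c(1) t1 by (auto simp: R_def min_def field_simps)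
    have R0: "0 < R" using R(1) zero_le_power2[of \<tau>] by linarith
    define p where "p = sqrt (R / 2)"
    have p: "0 < p" "p\<^sup>2 + p\<^sup>2 = R" using R0 by (auto simp: p_def)
    define x where "x = (- p) *\<^sub>R e + p *\<^sub>R v"
    have nx: "(norm x)\<^sup>2 = R" unfolding x_def normxy using p by simp
    have 1: "1 < norm (x - a)"
    proof (rule power2_less_imp_less)
      have "e \<bullet> x = - p" unfolding x_def ip ..
      moreover have "0 < c * p" using c p by simp
      ultimately show "1\<^sup>2 < (norm (x - a))\<^sup>2" unfolding norm_xa nx using R by (simp add: power2_eq_square algebra_simps)
    qed simp
    have 2: "\<tau> < norm x" by (rule power2_less_imp_less) (use nx R in auto)
    have 3: "norm x < 1" by (rule power2_less_imp_less) (use nx R in auto)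
    have "x \<in> O2" unfolding O2_def using 1 2 3 p c ip[of "- p" p] by (simp add: x_def)
    then show ?thesis by blast
  qed
  have O1: "O1 \<subseteq> \<Omega>\<^sub>0" "\<And>x. x \<in> O1 \<Longrightarrow> 0 < v \<bullet> x" and O2: "O2 \<subseteq> \<Omega>\<^sub>0" "\<And>x. x \<in> O2 \<Longrightarrow> 0 < v \<bullet> x"
    by (auto simp: O1_def O2_def \<Omega>0)
  have O2a: "O2 \<subseteq> \<Omega>\<^sub>a" using \<tau>(2) by (auto simp: O2_def \<Omega>a)
  have lipHa: "f \<in> H0s s \<Omega>\<^sub>a" if "f \<in> lip0 \<Omega>\<^sub>a" for f
    using lip0_subset_H0s[OF s \<Omega>(3) bounded_domain[OF \<Omega>(4)]] that by blast
  have lipH0: "f \<in> H0s s \<Omega>\<^sub>0" if "f \<in> lip0 \<Omega>\<^sub>0" for f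
    using lip0_subset_H0s[OF s \<Omega>(1) bounded_domain[OF \<Omega>(2)]] that by blast
  \<comment> \<open>\<open>frac_lambda_2\<close> asks for one nontrivial odd element of
    \<open>lip0\<close> on the eccentric annulus; a bump in \<open>O2\<close> provides it.\<close>
  have var: "lam * l2_form h h \<le> frac_form s h h" if "h \<in> H0s s \<Omega>\<^sub>a" "odd_refl h" for h
  proof -
    obtain \<eta> b r where \<eta>: "\<eta> \<in> lip0 \<Omega>\<^sub>a" "odd_refl \<eta>" "0 < r" "ball b r \<subseteq> O2" "\<And>x. 0 < v \<bullet> x \<Longrightarrow> 0 \<le> \<eta> x"
      "\<And>x. \<eta> x \<noteq> 0 \<Longrightarrow> x \<in> O2 \<or> rho x \<in> O2" "\<And>x. x \<in> ball b r \<Longrightarrow> 0 < \<eta> x"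
      by (rule odd_bump[OF rhoa oO(2) O2ne O2a O2(2)]) (assumption, assumption, rule that)
    have "nontrivial \<eta>"
      unfolding nontrivial_def
    proof
      assume "AE x in lborel. \<eta> x = 0"
      then obtain x where "x \<in> ball b r" "\<eta> x = 0"
        by (rule AE_open_witness[rotated 2, of _ "ball b r"]) (use \<eta>(3) in auto)
      then show False using \<eta>(7)[of x] by simp
    qed
    then have p: "0 < l2_form \<eta> \<eta>" using l2_form_pos_iff[OF s \<Omega>(3,4) lipHa[OF \<eta>(1)]] by simp
    show ?thesis
      unfolding lam_def
      by (rule frac_lambda_2(2)[OF s \<Omega>(3,4) isom(1) rhoa \<eta>(1) odd_reflD[OF \<eta>(2)] p that(1) odd_reflD[OF that(2)]])
  qed
  have \<phi>H: "\<phi> \<in> H0s s \<Omega>\<^sub>0" using \<phi>(1) by (simp add: weak_solution_def)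
  have \<phi>S: "\<phi> \<in> H0s_sym s \<Omega>\<^sub>0 rho (-1)" using \<phi>H odd_reflD[OF \<phi>(2)] by (simp add: H0s_sym_def)
  obtain \<psi> where \<psi>: "\<And>n. \<psi> n \<in> lip0 \<Omega>\<^sub>0" "\<And>n x. \<psi> n (rho x) = - 1 * \<psi> n x"
    "(\<lambda>n. frac_quad s (\<lambda>x. \<psi> n x - \<phi> x)) \<longlonglongrightarrow> 0"
    using H0s_sym_approx[OF s \<Omega>(1,2) isom(1) rho0 _ \<phi>S] by auto
  have \<psi>o: "odd_refl (\<psi> n)" for n using \<psi>(2) by (simp add: odd_refl_def)
  have \<psi>H: "\<psi> n \<in> H0s s \<Omega>\<^sub>0" for n by (rule lipH0[OF \<psi>(1)])
  note F = H0s_fin_energy[OF \<psi>H] H0s_fin_energy[OF \<phi>H]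
  note S = H0s_sq_int[OF s \<Omega>(1,2) \<psi>H] H0s_sq_int[OF s \<Omega>(1,2) \<phi>H]
  have limL: "(\<lambda>n. l2_quad (\<lambda>x. \<psi> n x - \<phi> x)) \<longlonglongrightarrow> 0"
    by (rule H0s_l2_tendsto[OF s \<Omega>(1,2) \<psi>H \<phi>H \<psi>(3)])
  define k where "k = 8 / frac_const DIM('a) s"
  have k: "0 < k" using frac_const_pos[OF s, where 'a='a] by (simp add: k_def)
  \<comment> \<open>The polarized approximant is odd and admissible on the eccentric annulus with
    unchanged L2 norm, so the energy lost is at most the excess of \<open>\<psi> n\<close> over the
    bound with \<open>lam\<close>.\<close>
  have gap: "(\<integral>\<^sup>+z. ennreal (polar_gap (\<psi> n) z) \<partial>lborel) \<le> ennreal (k * (frac_quad s (\<psi> n) - lam * l2_quad (\<psi> n)))" for n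
  proof -
    have T: "polar (\<psi> n) \<in> H0s s \<Omega>\<^sub>a" by (rule lipHa[OF polar_lip0[OF \<psi>o \<psi>(1) \<Omega>1 \<Omega>2]])
    have "lam * l2_quad (\<psi> n) \<le> frac_quad s (polar (\<psi> n))"
      using var[OF T polar_odd[OF \<psi>o]] l2_form_polar[OF \<psi>o S(1) H0s_sq_int[OF s \<Omega>(3,4) T]] by simp
    then have "k * (frac_quad s (\<psi> n) - frac_quad s (polar (\<psi> n)))
      \<le> k * (frac_quad s (\<psi> n) - lam * l2_quad (\<psi> n))" using k by simp
    then show ?thesis
      using energy_polar[OF \<psi>o F(1) H0s_fin_energy[OF T]] unfolding k_def[symmetric]
      by (meson ennreal_leI order_trans)
  qed
  obtain r where r: "strict_mono r" "AE x in lborel. (\<lambda>n. \<psi> (r n) x) \<longlonglongrightarrow> \<phi> x"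
    using l2_tendsto_AE_subseq[OF L.diff_in[OF S] limL] by blast
  have \<phi>pos: "0 < l2_form \<phi> \<phi>" using \<phi>(3) l2_form_pos_iff[OF s \<Omega>(1,2) \<phi>H] by simp
  have "(\<integral>\<^sup>+z. ennreal (polar_gap \<phi> z) \<partial>lborel) \<le> liminf (\<lambda>n. \<integral>\<^sup>+z. ennreal (polar_gap (\<psi> (r n)) z) \<partial>lborel)"
    by (rule polar_gap_fatou[OF _ r(2)]) (use F(1) in \<open>auto simp: fin_energy_def\<close>)
  also have "\<dots> \<le> liminf (\<lambda>n. ennreal (k * (frac_quad s (\<psi> (r n)) - lam * l2_quad (\<psi> (r n)))))"
    by (intro Liminf_mono always_eventually allI gap)
  also have "\<dots> = ennreal (k * (frac_form s \<phi> \<phi> - lam * l2_form \<phi> \<phi>))"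
  proof (rule lim_imp_Liminf[OF sequentially_bot])
    have "(\<lambda>n. k * (frac_quad s (\<psi> n) - lam * l2_quad (\<psi> n))) \<longlonglongrightarrow> k * (frac_form s \<phi> \<phi> - lam * l2_form \<phi> \<phi>)"
      by (intro tendsto_intros E.tendsto_diag[OF F \<psi>(3)] L.tendsto_diag[OF S limL])
    from LIMSEQ_subseq_LIMSEQ[OF this r(1)]
    show "(\<lambda>n. ennreal (k * (frac_quad s (\<psi> (r n)) - lam * l2_quad (\<psi> (r n)))))
      \<longlonglongrightarrow> ennreal (k * (frac_form s \<phi> \<phi> - lam * l2_form \<phi> \<phi>))"
      by (intro tendsto_ennrealI) (simp add: o_def)
  qed
  also have "frac_form s \<phi> \<phi> = \<mu> * l2_form \<phi> \<phi>" using \<phi>(1) \<phi>H by (simp add: weak_solution_iff[OF s \<Omega>(1,2)])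
  \<comment> \<open>The limit of the excess is a positive multiple of \<mu> - \<open>lam\<close>,
    nonpositive by the assumption to be refuted, so \<open>\<phi>\<close> has no gap at all.\<close>
  also have "k * (\<mu> * l2_form \<phi> \<phi> - lam * l2_form \<phi> \<phi>) \<le> 0"
    using k \<phi>pos le by (simp add: mult_nonneg_nonpos)
  then have "ennreal (k * (\<mu> * l2_form \<phi> \<phi> - lam * l2_form \<phi> \<phi>)) = 0" by (simp add: ennreal_eq_0_iff)
  finally have g0: "(\<integral>\<^sup>+z. ennreal (polar_gap \<phi> z) \<partial>lborel) = 0" by simp
  have \<phi>m: "\<phi> \<in> borel_measurable borel" using \<phi>H by (simp add: H0s_def)
  obtain t where t: "t \<noteq> 0" "AE x in lborel. 0 < v \<bullet> x \<longrightarrow> 0 \<le> t * \<phi> x"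
    "(AE x in lborel. x \<in> quarter \<longrightarrow> \<bar>\<phi> (sigma x)\<bar> \<le> \<bar>\<phi> x\<bar>) \<or> (AE x in lborel. x \<in> quarter \<longrightarrow> \<bar>\<phi> x\<bar> \<le> \<bar>\<phi> (sigma x)\<bar>)"
    using polar_gap_zero[OF \<phi>m g0] by blast
  have "\<exists>O'. open O' \<and> O' \<noteq> {} \<and> O' \<subseteq> \<Omega>\<^sub>0 \<and> (\<forall>x\<in>O'. 0 < v \<bullet> x) \<and> (AE x in lborel. x \<in> O' \<longrightarrow> \<phi> x = 0)"
    using t(3)
  proof
    assume h: "AE x in lborel. x \<in> quarter \<longrightarrow> \<bar>\<phi> (sigma x)\<bar> \<le> \<bar>\<phi> x\<bar>"
    \<comment> \<open>The mirror point lies in the quarter, where the larger absolute value sits,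
      and in the hole around 0, where it is 0.\<close>
    have "AE x in lborel. x \<in> O1 \<longrightarrow> \<phi> x = 0"
      using AE_isom_invol[OF isom(2) h]
    proof eventually_elim
      case (elim x)
      show ?case
      proof
        assume x: "x \<in> O1"
        have "sigma x \<in> quarter" using x by (simp add: O1_def quarter_def)
        moreover have "\<phi> (sigma x) = 0"
          by (rule H0s_vanish[OF \<phi>H]) (use x in \<open>auto simp: O1_def \<Omega>0 norm_sigma\<close>)
        ultimately show "\<phi> x = 0" using elim by simp
      qed
    qed
    then show ?thesis using oO O1ne O1 by blast
  next
    assume h: "AE x in lborel. x \<in> quarter \<longrightarrow> \<bar>\<phi> x\<bar> \<le> \<bar>\<phi> (sigma x)\<bar>"
    \<comment> \<open>Here the point itself is in the quarter and is dominated by its mirror point,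
      which is outside the unit ball.\<close>
    have "AE x in lborel. x \<in> O2 \<longrightarrow> \<phi> x = 0"
      using h
    proof eventually_elim
      case (elim x)
      show ?case
      proof
        assume x: "x \<in> O2"
        have "x \<in> quarter" using x by (simp add: O2_def quarter_def)
        moreover have "\<phi> (sigma x) = 0"
          by (rule H0s_vanish[OF \<phi>H]) (use x in \<open>auto simp: O2_def \<Omega>0 norm_sigma\<close>)
        ultimately show "\<phi> x = 0" using elim by simp
      qed
    qed
    then show ?thesis using oO O2ne O2 by blast
  qed
  then obtain O' where O': "open O'" "O' \<noteq> {}" "O' \<subseteq> \<Omega>\<^sub>0" "\<And>x. x \<in> O' \<Longrightarrow> 0 < v \<bullet> x"
    "AE x in lborel. x \<in> O' \<longrightarrow> \<phi> x = 0" by blast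
  \<comment> \<open>Scaling by \<open>t\<close> makes the function nonnegative in the half space, as
    \<open>vanishing_on_open\<close> requires.\<close>
  have "weak_solution s \<Omega>\<^sub>0 \<mu> (\<lambda>x. t * \<phi> x)"
    using weak_solution_lincomb[OF s \<Omega>(1,2) \<phi>(1) \<phi>(1), of t 0] by simp
  moreover have "odd_refl (\<lambda>x. t * \<phi> x)" using \<phi>(2) by (simp add: odd_refl_def)
  moreover have "AE x in lborel. x \<in> O' \<longrightarrow> t * \<phi> x = 0" using O'(5) by eventually_elim simp
  ultimately have "AE x in lborel. t * \<phi> x = 0"
    using vanishing_on_open[OF \<Omega>(1,2) rho0 _ _ t(2) O'(1-4)] by blast
  then show False using \<phi>(3) t(1) by (simp add: nontrivial_def)
qed

end

section \<open>Nonradial eigenfunctions\<close>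

text \<open>Invariance under a reflection holds off a null set that depends on the reflection, and
  there are uncountably many of them. Averages over balls do not see null sets, so for them each
  invariance holds at every point.\<close>

definition ball_mean :: "('a::euclidean_space \<Rightarrow> real) \<Rightarrow> real \<Rightarrow> 'a \<Rightarrow> real" where
  "ball_mean f r x = (LINT y|lborel. indicator (ball x r) y * f y) / measure lborel (ball x r)"

lemma ball_mean_isom_invol:
  fixes h :: "'a::euclidean_space \<Rightarrow> 'a"
  assumes h: "isom_invol h" and f: "f \<in> borel_measurable borel" and inv: "AE x in lborel. f (h x) = f x"
  shows "ball_mean f r (h x) = ball_mean f r x"
proof -
  have [measurable]: "h \<in> borel_measurable borel" "f \<in> borel_measurable borel"
    using isom_invol_measurable[OF h] f by auto
  have m1: "(\<lambda>y. indicator (ball z r) y * f y) \<in> borel_measurable borel" for z by measurable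
  have m2: "(\<lambda>y. indicator (ball (h x) r) (h y) * f (h y)) \<in> borel_measurable borel"
    by (rule measurable_compose[OF isom_invol_measurable[OF h] m1])
  have "(LINT y|lborel. indicator (ball (h x) r) y * f y) = (LINT y|lborel. indicator (ball (h x) r) (h y) * f (h y))"
    by (rule integral_isom_invol(1)[OF h m1, symmetric])
  also have "\<dots> = (LINT y|lborel. indicator (ball x r) y * f y)"
  proof (rule integral_cong_AE)
    have ie: "indicator (ball (h x) r) (h y) = (indicator (ball x r) y :: real)" for y
      using isom_invol_simps(2)[OF h, of x y] by (simp add: indicator_def dist_norm)
    show "AE y in lborel. indicator (ball (h x) r) (h y) * f (h y) = indicator (ball x r) y * f y"
      using inv by eventually_elim (simp add: ie)
  qed (use m1 m2 in simp_all)
  finally have "(LINT y|lborel. indicator (ball (h x) r) y * f y) = (LINT y|lborel. indicator (ball x r) y * f y)" .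
  moreover have "measure lborel (ball (h x) r) = measure lborel (ball x r)"
    by (cases "0 \<le> r") (simp_all add: content_ball ball_empty)
  ultimately show ?thesis by (simp add: ball_mean_def)
qed

text \<open>A differentiation theorem read off from the energy: for almost every x the density is
  integrable in y, and the average over a ball of radius r then differs from f(x) by order
  r^s.\<close>

lemma ball_mean_tendsto:
  fixes f :: "'a::euclidean_space \<Rightarrow> real"
  assumes s: "0 < s" "s < 1" and f: "f \<in> fin_energy s" "f \<in> sq_int"
  shows "AE x in lborel. (\<lambda>n::nat. ball_mean f (1 / (real n + 1)) x) \<longlonglongrightarrow> f x"
proof -
  have [measurable]: "f \<in> borel_measurable borel" using f by (simp add: sq_int_def)
  define p where "p = real DIM('a) + 2 * s"
  have p: "0 < p" using s by (simp add: p_def add_nonneg_pos)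
  define V where "V = unit_ball_vol (real DIM('a))"
  have V: "0 < V" by (simp add: V_def)
  have "(\<integral>\<^sup>+x. \<integral>\<^sup>+y. ennreal (frac_integrand s f f (x, y)) \<partial>lborel \<partial>lborel) = frac_energy s f"
    unfolding frac_energy_def by (rule nn_integral_product[symmetric]) simp
  also have "\<dots> < \<infinity>" using f(1) by (simp add: fin_energy_iff)
  finally have fin: "(\<integral>\<^sup>+x. \<integral>\<^sup>+y. ennreal (frac_integrand s f f (x, y)) \<partial>lborel \<partial>lborel) \<noteq> \<infinity>" by simp
  have "(\<lambda>z. ennreal (frac_integrand s f f z)) \<in> borel_measurable (lborel \<Otimes>\<^sub>M lborel)"
    by (simp add: lborel_prod)
  then have "(\<lambda>x. \<integral>\<^sup>+y. ennreal (frac_integrand s f f (x, y)) \<partial>lborel) \<in> borel_measurable lborel"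
    by (rule lborel.borel_measurable_nn_integral_fst)
  from nn_integral_noteq_infinite[OF this fin]
  show ?thesis
  proof eventually_elim
    case (elim x)
    define F where "F y = frac_integrand s f f (x, y)" for y
    have F0: "0 \<le> F y" for y by (simp add: F_def frac_integrand_nonneg)
    have [measurable]: "F \<in> borel_measurable borel"
      unfolding F_def frac_integrand_eq by measurable
    have Fi: "integrable lborel F"
      by (rule integrableI_nonneg) (use elim F0 in \<open>auto simp: F_def less_top\<close>)
    define I where "I = (LINT y|lborel. F y)"
    have est: "\<bar>ball_mean f r x - f x\<bar> \<le> r powr s * (1 + I / V)" if r: "0 < r" for r
    proof -
      define B where "B = ball x r"
      have [measurable]: "B \<in> sets borel" by (simp add: B_def)
      define m where "m = V * r ^ DIM('a)"
      have m: "0 < m" using V r by (simp add: m_def)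
      have mB: "measure lborel B = m" using r by (simp add: B_def content_ball m_def V_def)
      have iB: "integrable lborel (indicator B :: 'a \<Rightarrow> real)"
        unfolding B_def by (rule integrable_real_indicator) (simp, rule emeasure_lborel_ball_finite)
      have "(\<lambda>y. indicator B y * indicator B y) = (indicator B :: 'a \<Rightarrow> real)" by (auto simp: indicator_def)
      then have "indicator B \<in> sq_int" unfolding sq_int_def using iB by simp
      then have iBf: "integrable lborel (\<lambda>y. indicator B y * f y)" using f(2) by (rule sq_int_mult_integrable)
      \<comment> \<open>This balances t \<le> \<delta> + t^2 / \<delta>: on the ball t^2 is at most
        r^(N + 2s) times \<open>F y\<close>, and division by the volume, of order r^N, leaves r^s in
        both terms.\<close>
      define \<delta> where "\<delta> = r powr s"
      have \<delta>: "0 < \<delta>" using r by (simp add: \<delta>_def)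
      have pt: "\<bar>indicator B y * f y - indicator B y * f x\<bar> \<le> \<delta> * indicator B y + (r powr p / \<delta>) * F y" for y
      proof (cases "y \<in> B")
        case True
        define t where "t = \<bar>f y - f x\<bar>"
        have "t * t \<le> r powr p * F y"
        proof (cases "y = x")
          case True then show ?thesis using F0 by (simp add: t_def)
        next
          case False
          have "norm (x - y) powr p \<le> r powr p"
            using True p by (intro powr_mono2) (auto simp: B_def dist_norm)
          then have "1 \<le> r powr p * frac_ker s (x - y)"
            using False by (simp add: frac_ker_def p_def field_simps)
          then have "t * t * 1 \<le> t * t * (r powr p * frac_ker s (x - y))" by (intro mult_left_mono) auto
          also have "\<dots> = r powr p * F y"
            by (simp add: t_def F_def frac_integrand_eq algebra_simps)
          finally show ?thesis by simp
        qed
        then have "t * t / \<delta> \<le> r powr p * F y / \<delta>" using \<delta> by (simp add: divide_right_mono)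
        moreover have "t \<le> \<delta> + t * t / \<delta>"
        proof -
          have "0 \<le> (t - \<delta>)\<^sup>2" by simp
          then have "2 * (t * \<delta>) \<le> t * t + \<delta> * \<delta>" by (simp add: power2_eq_square algebra_simps)
          moreover have "0 \<le> t * \<delta>" using \<delta> by (simp add: t_def)
          ultimately have "t * \<delta> \<le> \<delta> * \<delta> + t * t" by linarith
          then show ?thesis using \<delta> by (simp add: field_simps)
        qed
        ultimately have "t \<le> \<delta> + r powr p * F y / \<delta>" by linarith
        then show ?thesis using True by (simp add: t_def)
      next
        case False
        then show ?thesis using F0[of y] \<delta> by simp
      qed
      have "ball_mean f r x - f x = ((LINT y|lborel. indicator B y * f y) - m * f x) / m"
        using m by (simp add: ball_mean_def B_def[symmetric] mB field_simps)
      also have "m * f x = (LINT y|lborel. indicator B y * f x)" using iB by (simp add: mB)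
      also have "(LINT y|lborel. indicator B y * f y) - \<dots> = (LINT y|lborel. indicator B y * f y - indicator B y * f x)"
        using iBf iB by (subst Bochner_Integration.integral_diff) auto
      finally have "\<bar>ball_mean f r x - f x\<bar> = \<bar>LINT y|lborel. indicator B y * f y - indicator B y * f x\<bar> / m"
        using m by simp
      also have "\<bar>LINT y|lborel. indicator B y * f y - indicator B y * f x\<bar> \<le> (LINT y|lborel. \<bar>indicator B y * f y - indicator B y * f x\<bar>)"
        by (rule integral_abs_bound)
      also have "\<dots> \<le> (LINT y|lborel. \<delta> * indicator B y + (r powr p / \<delta>) * F y)"
        by (rule integral_mono[OF _ _ pt]) (use iBf iB Fi in auto)
      also have "\<dots> = \<delta> * m + (r powr p / \<delta>) * I" using iB Fi by (simp add: mB I_def)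
      also have "(\<delta> * m + (r powr p / \<delta>) * I) / m = \<delta> + r powr p / (\<delta> * m) * I"
        using m \<delta> by (simp add: field_simps)
      also have "r powr p / (\<delta> * m) = r powr s / V"
      proof -
        have "r powr p = r powr s * (r powr s * r ^ DIM('a))"
          using r by (simp add: p_def powr_add[symmetric] powr_realpow[symmetric] add_ac)
        then show ?thesis using r V by (simp add: \<delta>_def m_def)
      qed
      finally show ?thesis using m by (simp add: \<delta>_def divide_right_mono algebra_simps)
    qed
    have "(\<lambda>n. ball_mean f (1 / (real n + 1)) x - f x) \<longlonglongrightarrow> 0"
    proof (rule Lim_null_comparison[where g = "\<lambda>n. (1 / (real n + 1)) powr s * (1 + I / V)"])
      show "\<forall>\<^sub>F n in sequentially. norm (ball_mean f (1 / (real n + 1)) x - f x) \<le> (1 / (real n + 1)) powr s * (1 + I / V)"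
        using est by (intro always_eventually allI) simp
      have "(\<lambda>n. 1 / (real n + 1)) \<longlonglongrightarrow> 0"
        using LIMSEQ_inverse_real_of_nat by (simp add: inverse_eq_divide add.commute)
      then have "(\<lambda>n. (1 / (real n + 1)) powr s) \<longlonglongrightarrow> 0 powr s"
        using s by (intro tendsto_powr2) auto
      then have "(\<lambda>n. (1 / (real n + 1)) powr s * (1 + I / V)) \<longlonglongrightarrow> 0 powr s * (1 + I / V)"
        by (intro tendsto_mult tendsto_const)
      then show "(\<lambda>n. (1 / (real n + 1)) powr s * (1 + I / V)) \<longlonglongrightarrow> 0" by simp
    qed
    then show ?case using LIM_zero_iff by blast
  qed
qed

text \<open>The mirror is the perpendicular bisector of the two points; equal norms put 0 on
  it.\<close>

lemma hrefl_swap: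
  fixes x y :: "'a::euclidean_space"
  assumes "norm x = norm y" "x \<noteq> y"
  shows "norm ((1 / norm (x - y)) *\<^sub>R (x - y)) = 1" "hrefl ((1 / norm (x - y)) *\<^sub>R (x - y)) 0 x = y"
proof -
  let ?w = "(1 / norm (x - y)) *\<^sub>R (x - y)"
  have n: "norm (x - y) \<noteq> 0" using assms by simp
  then show "norm ?w = 1" by simp
  have "x \<bullet> x = y \<bullet> y" using assms(1) by (simp add: norm_eq)
  then have "2 * ((x - y) \<bullet> x) = (norm (x - y))\<^sup>2"
    by (simp add: power2_norm_eq_inner inner_diff_left inner_diff_right inner_commute)
  then have "(1 / norm (x - y)) * (2 * ((x - y) \<bullet> x)) = norm (x - y)" using n by (simp add: power2_eq_square)
  then have "2 * (?w \<bullet> x) = norm (x - y)" unfolding inner_scaleR_left by (simp only: mult.left_commute)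
  then have "hrefl ?w 0 x = x - norm (x - y) *\<^sub>R ?w" by (simp add: hrefl_def)
  then show "hrefl ?w 0 x = y" using n by simp
qed

text \<open>Reflections act transitively on each sphere around 0, so the averages depend on the norm
  of the centre only, and so does their limit. The profile is read off along one ray.\<close>

lemma radial_if_hrefl_invariant:
  fixes f :: "'a::euclidean_space \<Rightarrow> real"
  assumes s: "0 < s" "s < 1" and f: "f \<in> fin_energy s" "f \<in> sq_int"
    and inv: "\<And>v. norm v = 1 \<Longrightarrow> AE x in lborel. f (hrefl v 0 x) = f x"
  shows "radial f"
proof -
  have m: "f \<in> borel_measurable borel" using f by (simp add: sq_int_def)
  obtain b :: 'a where "b \<in> Basis" by (meson nonempty_Basis ex_in_conv)
  then have b: "norm b = 1" by simp
  have eq: "ball_mean f r x = ball_mean f r y" if "norm x = norm y" for r x y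
  proof (cases "x = y")
    case False
    from ball_mean_isom_invol[OF isom_invol_hrefl[OF hrefl_swap(1)[OF that False]] m inv[OF hrefl_swap(1)[OF that False]], of r x]
    show ?thesis unfolding hrefl_swap(2)[OF that False] by simp
  qed simp
  define g where "g t = lim (\<lambda>n::nat. ball_mean f (1 / (real n + 1)) (t *\<^sub>R b))" for t
  have "AE x in lborel. f x = g (norm x)"
    using ball_mean_tendsto[OF s f]
  proof eventually_elim
    case (elim x)
    have "norm x = norm (norm x *\<^sub>R b)" using b by simp
    from eq[OF this] elim show ?case by (simp add: g_def limI)
  qed
  then show ?thesis unfolding radial_def by blast
qed

text \<open>The reflection that exchanges the two normals carries one mirror to the other; unlike a
  general rotation it is an involution, so the results on \<open>isom_invol\<close> apply.\<close>

lemma hrefl_conjugate: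
  fixes v w :: "'a::euclidean_space"
  assumes "norm v = 1" "norm w = 1"
  obtains g where "isom_invol g" "\<And>x. norm (g x) = norm x" "\<And>x. g (hrefl w 0 x) = hrefl v 0 (g x)"
proof (cases "v = w")
  case True
  then show ?thesis using that[of "\<lambda>x. x"] isom_invol_id by simp
next
  case False
  define u where "u = (1 / norm (w - v)) *\<^sub>R (w - v)"
  have u: "norm u = 1" "hrefl u 0 w = v" using hrefl_swap[of w v] assms False by (auto simp: u_def)
  let ?g = "hrefl u 0"
  have g: "isom_invol ?g" by (rule isom_invol_hrefl[OF u(1)])
  have g0: "?g 0 = 0" by (simp add: hrefl_def)
  have ng: "norm (?g x) = norm x" for x using isom_invol_simps(2)[OF g, of x 0] g0 by simp
  have gi: "?g x \<bullet> ?g y = x \<bullet> y" for x y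
    unfolding dot_norm_neg ng isom_invol_simps(2)[OF g] ..
  have "?g (hrefl w 0 x) = hrefl v 0 (?g x)" for x
  proof -
    have "?g (x - t *\<^sub>R w) = ?g x - t *\<^sub>R ?g w" for t
      by (simp add: hrefl_def inner_diff_right algebra_simps)
    then have "?g (hrefl w 0 x) = ?g x - (2 * (w \<bullet> x)) *\<^sub>R v" by (simp add: hrefl_def[of w] u(2))
    also have "w \<bullet> x = v \<bullet> ?g x" using gi[of w x] u(2) by simp
    finally show ?thesis by (simp add: hrefl_def[of v])
  qed
  then show ?thesis using that[of ?g] g ng by blast
qed

theorem annulus_frac_lambda_2_less:
  fixes a :: "'a::euclidean_space" and s \<tau> :: real
  assumes dim: "2 \<le> DIM('a)" and s: "0 < s" "s < 1" and \<tau>: "0 < \<tau>" "\<tau> < 1"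
    and nr: "\<And>\<phi> :: 'a \<Rightarrow> real. second_eigenfunction s (ball 0 1 - cball 0 \<tau>) \<phi> \<Longrightarrow> \<not> radial \<phi>"
    and a: "a \<noteq> 0" "norm a < 1 - \<tau>"
  shows "frac_lambda 2 s (ball 0 1 - cball a \<tau>) < frac_lambda 2 s (ball (0::'a) 1 - cball 0 \<tau>)"
proof -
  define \<Omega> where "\<Omega> = ball (0::'a) 1 - cball 0 \<tau>"
  have \<Omega>: "open \<Omega>" "\<Omega> \<subseteq> ball 0 1" by (auto simp: \<Omega>_def)
  have mem: "x \<in> \<Omega> \<longleftrightarrow> norm x < 1 \<and> \<tau> < norm x" for x by (auto simp: \<Omega>_def)
  \<comment> \<open>Here the dimension enters: the odd hyperplane needs a normal orthogonal to
    \<open>a\<close>.\<close>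
  obtain v' where v': "v' \<noteq> 0" "orthogonal a v'" using orthogonal_to_vector_exists[OF dim] by blast
  define v where "v = (1 / norm v') *\<^sub>R v'"
  define e where "e = (1 / norm a) *\<^sub>R a"
  \<comment> \<open>The mirror of \<open>sigma\<close> is midway between the centres 0 and
    \<open>a\<close>.\<close>
  define c where "c = norm a / 2"
  interpret R: two_reflections v e c s
  proof
    show "norm v = 1" "norm e = 1" using v' a by (auto simp: v_def e_def)
    show "v \<bullet> e = 0" using v'(2) by (simp add: v_def e_def orthogonal_def inner_commute)
  qed (use s in auto)
  have ae: "(2 * c) *\<^sub>R e = a" using a by (simp add: c_def e_def)
  have rho_norm: "norm (hrefl w 0 x) = norm x" if "norm w = 1" for w x :: 'a
  proof -
    have "hrefl w 0 0 = 0" by (simp add: hrefl_def)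
    then show ?thesis using isom_invol_simps(2)[OF isom_invol_hrefl[OF that, of 0], of x 0] by simp
  qed
  have inv\<Omega>: "hrefl w 0 x \<in> \<Omega>" if "norm w = 1" "x \<in> \<Omega>" for w x
    using that rho_norm by (simp add: mem)
  \<comment> \<open>The assumption that no second eigenfunction is radial only helps once one
    exists, that is, once the value \<open>frac_lambda\<close> is an eigenvalue.\<close>
  have "frac_eigenvalue s \<Omega> (frac_lambda 2 s \<Omega>)"
  proof -
    define O' where "O' = {x. 0 < v \<bullet> x} \<inter> {x. \<tau> < norm x} \<inter> {x. norm x < 1}"
    have "open O'" unfolding O'_def by (intro open_Int open_Collect_less continuous_intros)
    have vv: "v \<bullet> v = 1" using R.norm_v by (simp add: norm_eq_1)
    define t where "t = (1 + \<tau>) / 2"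
    have t: "\<tau> < t" "t < 1" "0 < t" using \<tau> by (auto simp: t_def)
    then have "t *\<^sub>R v \<in> O'" using R.norm_v vv by (simp add: O'_def)
    then have "O' \<noteq> {}" by blast
    moreover have "O' \<subseteq> \<Omega>" "\<And>x. x \<in> O' \<Longrightarrow> 0 < v \<bullet> x" by (auto simp: O'_def mem)
    ultimately have O: "open O'" "O' \<noteq> {}" "O' \<subseteq> \<Omega>" "\<And>x. x \<in> O' \<Longrightarrow> 0 < v \<bullet> x"
      using \<open>open O'\<close> by blast+
    obtain \<eta> b r where \<eta>: "\<eta> \<in> lip0 \<Omega>" "R.odd_refl \<eta>" "0 < r" "ball b r \<subseteq> O'" "\<And>x. 0 < v \<bullet> x \<Longrightarrow> 0 \<le> \<eta> x"
      "\<And>x. \<eta> x \<noteq> 0 \<Longrightarrow> x \<in> O' \<or> hrefl v 0 x \<in> O'" "\<And>x. x \<in> ball b r \<Longrightarrow> 0 < \<eta> x"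
      by (rule R.odd_bump[OF inv\<Omega>[OF R.norm_v] O]) (assumption, assumption, rule that)
    have \<eta>H: "\<eta> \<in> H0s s \<Omega>"
      using lip0_subset_H0s[OF s \<Omega>(1) bounded_domain[OF \<Omega>(2)]] \<eta>(1) by blast
    have "nontrivial \<eta>"
      unfolding nontrivial_def
    proof
      assume "AE x in lborel. \<eta> x = 0"
      then obtain x where "x \<in> ball b r" "\<eta> x = 0"
        by (rule AE_open_witness[rotated 2, of _ "ball b r"]) (use \<eta>(3) in auto)
      then show False using \<eta>(7)[of x] by simp
    qed
    then have p: "0 < l2_form \<eta> \<eta>" using l2_form_pos_iff[OF s \<Omega> \<eta>H] by simp
    show ?thesis
      by (rule frac_lambda_2(1)[OF s \<Omega> R.isom(1) inv\<Omega>[OF R.norm_v] \<eta>(1) R.odd_reflD[OF \<eta>(2)] p])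
  qed
  then obtain \<phi> where \<phi>: "weak_solution s \<Omega> (frac_lambda 2 s \<Omega>) \<phi>" "nontrivial \<phi>"
    by (auto simp: frac_eigenvalue_def)
  then have "\<not> radial \<phi>" using nr by (simp add: second_eigenfunction_def \<Omega>_def)
  have \<phi>H: "\<phi> \<in> H0s s \<Omega>" using \<phi>(1) by (simp add: weak_solution_def)
  obtain w where w: "norm w = 1" "\<not> (AE x in lborel. \<phi> (hrefl w 0 x) = \<phi> x)"
    using radial_if_hrefl_invariant[OF s H0s_fin_energy[OF \<phi>H] H0s_sq_int[OF s \<Omega> \<phi>H]] \<open>\<not> radial \<phi>\<close> by blast
  \<comment> \<open>Twice the odd part with respect to the mirror of \<open>w\<close>; it is
    nontrivial by the choice of \<open>w\<close>.\<close>
  define \<phi>1 where "\<phi>1 x = 1 * \<phi> x + (-1) * \<phi> (hrefl w 0 x)" for x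
  have \<phi>1: "weak_solution s \<Omega> (frac_lambda 2 s \<Omega>) \<phi>1"
    unfolding \<phi>1_def[abs_def]
    by (intro weak_solution_lincomb[OF s \<Omega>] weak_solution_isom_invol[OF s \<Omega> isom_invol_hrefl[OF w(1)] inv\<Omega>[OF w(1)]] \<phi>(1))
  have odd1: "\<phi>1 (hrefl w 0 x) = - \<phi>1 x" for x
    using isom_invol_simps(1)[OF isom_invol_hrefl[OF w(1), of 0]] by (simp add: \<phi>1_def)
  have nt1: "nontrivial \<phi>1"
    unfolding nontrivial_def
  proof
    assume "AE x in lborel. \<phi>1 x = 0"
    then have "AE x in lborel. \<phi> (hrefl w 0 x) = \<phi> x" by eventually_elim (simp add: \<phi>1_def)
    then show False using w(2) by simp
  qed
  \<comment> \<open>The eigenfunction dictates \<open>w\<close>, while \<open>v\<close> has to be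
    orthogonal to \<open>a\<close>; the concentric annulus is invariant under the conjugating
    map.\<close>
  obtain g where g: "isom_invol g" "\<And>x. norm (g x) = norm x" "\<And>x. g (hrefl v 0 x) = hrefl w 0 (g x)"
    using hrefl_conjugate[OF w(1) R.norm_v] by blast
  have 1: "weak_solution s \<Omega> (frac_lambda 2 s \<Omega>) (\<lambda>x. \<phi>1 (g x))"
    by (rule weak_solution_isom_invol[OF s \<Omega> g(1) _ \<phi>1]) (simp add: mem g(2))
  have 2: "R.odd_refl (\<lambda>x. \<phi>1 (g x))" unfolding R.odd_refl_def by (simp add: g(3) odd1)
  have 3: "nontrivial (\<lambda>x. \<phi>1 (g x))"
    unfolding nontrivial_def
  proof
    assume "AE x in lborel. \<phi>1 (g x) = 0"
    from AE_isom_invol[OF g(1) this] show False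
      using nt1 isom_invol_simps(1)[OF g(1)] by (simp add: nontrivial_def)
  qed
  have "frac_lambda 2 s (ball 0 1 - cball ((2 * c) *\<^sub>R e) \<tau>) < frac_lambda 2 s \<Omega>"
    using R.frac_lambda_2_strict[of \<tau>, folded \<Omega>_def, OF _ _ \<tau> 1 2 3] a by (simp add: c_def)
  then show ?thesis unfolding ae \<Omega>_def .
qed

theorem theorem1p3:
  fixes s \<tau> :: real
  assumes "CARD('n::finite) \<ge> 2"
    and "0 < s" "s < 1"
    and "0 < \<tau>" "\<tau> < 1"
    and "\<And>\<phi> :: real ^ 'n \<Rightarrow> real.
           second_eigenfunction s (ball 0 1 - closure (ball 0 \<tau>)) \<phi> \<Longrightarrow> \<not> radial \<phi>"
  shows "\<forall>a \<in> ball (0 :: real ^ 'n) (1 - \<tau>).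
           frac_lambda 2 s (ball 0 1 - closure (ball a \<tau>))
             \<le> frac_lambda 2 s (ball (0 :: real ^ 'n) 1 - closure (ball 0 \<tau>)) \<and>
           (frac_lambda 2 s (ball 0 1 - closure (ball a \<tau>))
             = frac_lambda 2 s (ball (0 :: real ^ 'n) 1 - closure (ball 0 \<tau>)) \<longleftrightarrow> a = 0)"
proof
  have cl: "closure (ball b \<tau>) = cball b \<tau>" for b :: "real ^ 'n" using assms(4) by simp
  have dim: "2 \<le> DIM(real ^ 'n)" using assms(1) by simp
  note less = annulus_frac_lambda_2_less[OF dim assms(2-5) assms(6)[unfolded cl]]
  fix a :: "real ^ 'n" assume "a \<in> ball 0 (1 - \<tau>)"
  then have a: "norm a < 1 - \<tau>" by simp
  show "frac_lambda 2 s (ball 0 1 - closure (ball a \<tau>))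
             \<le> frac_lambda 2 s (ball (0 :: real ^ 'n) 1 - closure (ball 0 \<tau>)) \<and>
           (frac_lambda 2 s (ball 0 1 - closure (ball a \<tau>))
             = frac_lambda 2 s (ball (0 :: real ^ 'n) 1 - closure (ball 0 \<tau>)) \<longleftrightarrow> a = 0)"
  proof (cases "a = 0")
    case False
    from less[OF _ False a] show ?thesis unfolding cl using False by auto
  qed simp
qed

end
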